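(* Let $\alpha,\beta,u^*>0$. There exists a weak solution $(u,p)$ to the HHMO-model having property (P): there exists a measurable function $p^*$ such that for almost every $x\in\mathbb{R}_+$, $$p(x,t)=p^*(x)\quad\text{for all }t>x^2/\alpha^2 .$$
   Context: Fix parameters $\alpha,\beta,u^*>0$. The HHMO-model is, formally, $u_t=u_{xx}+\frac{\alpha\beta}{2\sqrt t}\,\delta(x-\alpha\sqrt t)-p\,u$ for $x>0$, with $u_x(0,t)=0$, $u(x,0)=0$, extended to $x\in\mathbb{R}$ by even reflection. Put $\psi(x,t)=\Psi(|x|/\sqrt t)$ for $t>0$ and $\psi(x,0)=0$ for $x\ne0$ (the single point $(0,0)$, where $\psi$ is not defined, is disregarded), where $\Psi(\eta)=\frac{\alpha\beta\sqrt\pi}{2}e^{\alpha^2/4}\,\mathrm{erfc}(\alpha/2)$ for $\eta\le\alpha$ and $\Psi(\eta)=\frac{\alpha\beta\sqrt\pi}{2}e^{\alpha^2/4}\,\mathrm{erfc}(\eta/2)$ for $\eta>\alpha$. A weak solution is a pair $(u,p)$ of functions on $\mathbb{R}\times[0,\infty)$ such that: (i) $u$ and $p$ are even in $x$; (ii) $u-\psi\in C^{1,0}(\mathbb{R}\times[0,T])\cap L^\infty(\mathbb{R}\times[0,T])$ for every $T>0$ ($C^{1,0}$: continuous together with the first $x$-derivative); (iii) $p$ is measurable, defined pointwise, and $p(x,t)=0$ if $\sup_{s\in[0,t]}u(x,s)<u^*$, $p(x,t)\in[0,1]$ if $\sup_{s\in[0,t]}u(x,s)=u^*$, $p(x,t)=1$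 if $\sup_{s\in[0,t]}u(x,s)>u^*$; (iv) $p(x,t)$ is non-decreasing in $t$ for every $x$; (v) for every $T>0$, $\int_0^T\!\int_{\mathbb R}\varphi_t\,(u-\psi)\,dy\,ds=\int_0^T\!\int_{\mathbb R}\bigl(\varphi_x\,(u-\psi)_x+p\,u\,\varphi\bigr)\,dy\,ds$ for every $\varphi\in C^{1,1}(\mathbb{R}\times[0,T])$ (continuously differentiable once in $x$ and once in $t$) that vanishes for large $|x|$ and for $t=T$. *)

theory Defs
  imports "HOL-Analysis.Analysis"
begin

text \<open>Functions of space and time are curried, \<open>f x t\<close> with \<open>x\<close> real and \<open>t \<ge> 0\<close>; as HOL functions
  they are total, and their values at negative times never matter.\<close>

definition erfc :: "real \<Rightarrow> real" where
  "erfc x = 2 / sqrt pi * (LINT s:{x..}|lebesgue. exp (- s\<^sup>2))"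

definition Psi :: "real \<Rightarrow> real \<Rightarrow> real \<Rightarrow> real" where
  "Psi \<alpha> \<beta> \<eta> = \<alpha> * \<beta> * sqrt pi / 2 * exp (\<alpha>\<^sup>2 / 4) *
     (if \<eta> \<le> \<alpha> then erfc (\<alpha> / 2) else erfc (\<eta> / 2))"

text \<open>The value assigned at the origin \<open>(0, 0)\<close> is an artefact of totality and is never used below.\<close>

definition psi :: "real \<Rightarrow> real \<Rightarrow> real \<Rightarrow> real \<Rightarrow> real" where
  "psi \<alpha> \<beta> x t = (if t > 0 then Psi \<alpha> \<beta> (\<bar>x\<bar> / sqrt t) else 0)"

text \<open>\<open>f\<close> is of class \<open>C\<^sup>1\<^sup>,\<^sup>0\<close> on \<open>\<real> \<times> [0, T]\<close>, with \<open>x\<close>-derivative \<open>fx\<close> there.\<close>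

definition C10_deriv ::
    "real \<Rightarrow> (real \<Rightarrow> real \<Rightarrow> real) \<Rightarrow> (real \<Rightarrow> real \<Rightarrow> real) \<Rightarrow> bool" where
  "C10_deriv T f fx \<longleftrightarrow>
     continuous_on (UNIV \<times> {0..T}) (\<lambda>(x, t). f x t) \<and>
     continuous_on (UNIV \<times> {0..T}) (\<lambda>(x, t). fx x t) \<and>
     (\<forall>x. \<forall>t\<in>{0..T}. ((\<lambda>y. f y t) has_real_derivative fx x t) (at x))"

text \<open>\<open>f\<close> is of class \<open>C\<^sup>1\<^sup>,\<^sup>1\<close> on \<open>\<real> \<times> [0, T]\<close>, with partial derivatives \<open>fx\<close> and \<open>ft\<close> there;
  the \<open>t\<close>-derivative is one-sided at \<open>t = 0\<close> and \<open>t = T\<close>.\<close>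

definition C11_deriv ::
    "real \<Rightarrow> (real \<Rightarrow> real \<Rightarrow> real) \<Rightarrow> (real \<Rightarrow> real \<Rightarrow> real) \<Rightarrow> (real \<Rightarrow> real \<Rightarrow> real) \<Rightarrow> bool" where
  "C11_deriv T f fx ft \<longleftrightarrow>
     C10_deriv T f fx \<and>
     continuous_on (UNIV \<times> {0..T}) (\<lambda>(x, t). ft x t) \<and>
     (\<forall>x. \<forall>t\<in>{0..T}. (f x has_real_derivative ft x t) (at t within {0..T}))"

text \<open>The supremum of \<open>u x\<close> over \<open>[0, t]\<close>, where the space-time origin is disregarded.\<close>

definition running_sup :: "(real \<Rightarrow> real \<Rightarrow> real) \<Rightarrow> real \<Rightarrow> real \<Rightarrow> real" where
  "running_sup u x t = (SUP s\<in>{s\<in>{0..t}. (x, s) \<noteq> (0, 0)}. u x s)"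

text \<open>Since \<open>psi\<close> is undefined at the origin, \<open>u - psi\<close> being of class \<open>C\<^sup>1\<^sup>,\<^sup>0\<close> means that it agrees off
  the origin with such a function \<open>w\<close>. This \<open>w\<close> and its derivative \<open>wx\<close> are unique on the strip,
  and they are \<open>u - psi\<close> and its \<open>x\<close>-derivative in the weak formulation.\<close>

definition weak_solution ::
    "real \<Rightarrow> real \<Rightarrow> real \<Rightarrow> (real \<Rightarrow> real \<Rightarrow> real) \<Rightarrow> (real \<Rightarrow> real \<Rightarrow> real) \<Rightarrow> bool" where
  "weak_solution \<alpha> \<beta> ustar u p \<longleftrightarrow>
     (\<forall>x. \<forall>t\<ge>0. u (- x) t = u x t \<and> p (- x) t = p x t) \<and>
     (\<lambda>(x, t). p x t) \<in> borel_measurable (lebesgue_on (UNIV \<times> {0..})) \<and>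
     (\<forall>x. \<forall>t\<ge>0. (x, t) \<noteq> (0, 0) \<longrightarrow>
        (running_sup u x t < ustar \<longrightarrow> p x t = 0) \<and>
        (running_sup u x t = ustar \<longrightarrow> p x t \<in> {0..1}) \<and>
        (running_sup u x t > ustar \<longrightarrow> p x t = 1)) \<and>
     (\<forall>x. mono_on {0..} (p x)) \<and>
     (\<forall>T>0. \<exists>w wx.
        (\<forall>x. \<forall>t\<in>{0..T}. (x, t) \<noteq> (0, 0) \<longrightarrow> w x t = u x t - psi \<alpha> \<beta> x t) \<and>
        C10_deriv T w wx \<and>
        (\<exists>C. AE (x, t) in lebesgue_on (UNIV \<times> {0..T}). \<bar>w x t\<bar> \<le> C) \<and>
        (\<forall>\<phi> \<phi>x \<phi>t. C11_deriv T \<phi> \<phi>x \<phi>t \<and>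
           (\<exists>R. \<forall>x. \<forall>t\<in>{0..T}. \<bar>x\<bar> > R \<longrightarrow> \<phi> x t = 0) \<and>
           (\<forall>x. \<phi> x T = 0) \<longrightarrow>
           (LINT s:{0..T}|lebesgue. (LINT y|lebesgue. \<phi>t y s * w y s)) =
           (LINT s:{0..T}|lebesgue. (LINT y|lebesgue.
              \<phi>x y s * wx y s + p y s * u y s * \<phi> y s))))"

definition property_P :: "real \<Rightarrow> (real \<Rightarrow> real \<Rightarrow> real) \<Rightarrow> bool" where
  "property_P \<alpha> p \<longleftrightarrow>
     (\<exists>pstar \<in> borel_measurable (lebesgue_on {0..}).
        AE x in lebesgue_on {0..}. \<forall>t. t > x\<^sup>2 / \<alpha>\<^sup>2 \<longrightarrow> p x t = pstar x)"

end

theory Submission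
  imports Defs "HOL-Complex_Analysis.Great_Picard" "HOL-Probability.Distributions"
begin

text \<open>The deviation \<open>w = u - psi\<close> is to solve \<open>w = k * (w - p u)\<close>, where \<open>k\<close> is the heat kernel damped by
  \<open>exp (- t)\<close>. For a time delay \<open>h > 0\<close> let \<open>p\<close> switch to 1 as soon as \<open>u\<close> has exceeded the threshold, and
  evaluate the right-hand side at time \<open>t - h\<close>; the delayed equation can be solved explicitly, one time step
  of length \<open>h\<close> after the other. Since \<open>psi\<close> is a supersolution of the heat equation and nondecreasing in time,
  induction over the time steps shows \<open>u \<ge> 0\<close> and then that \<open>w\<close> is nonincreasing in time. Behind the parabola
  \<open>t = x\<^sup>2 / \<alpha>\<^sup>2\<close> the function \<open>psi\<close> is constant, so \<open>u\<close> is nonincreasing there: if the threshold is ever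
  passed at \<open>x\<close>, then it is passed before the parabola is left behind, and \<open>p\<close> is constant afterwards.

  For \<open>h \<rightarrow> 0\<close> the functions \<open>w\<close> have a common modulus of continuity, being convolutions of bounded functions
  with one integrable kernel, and so a subsequence converges locally uniformly. The functions \<open>p\<close> are monotone in time,
  and a Helly-type selection gives a weak-* limit which is again monotone in time; it can be corrected on a
  null set so as to satisfy the threshold conditions everywhere. The damping makes the kernel integrable
  over the whole plane and is compensated by the summand \<open>w\<close> of the source.\<close>

section \<open>Weak-* compactness\<close>

text \<open>The obstacle is the feedback: \<open>p\<close> depends on the whole past of
  \<open>u\<close>, and not continuously, so a fixed-point theorem for continuous maps does not
  apply directly. With a delay the source of a time step is already known, and every comparison
  becomes an induction over the steps that uses only positivity and causality of the kernel. The
  damping rate 1 equals the absorption rate. Therefore the source w - p u is w before ignition and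
  -psi after it, and this dichotomy is what closes the inductions for the sign and for monotonicity.
  The weak-* limit loses pointwise information, and where the supremum of \<open>u\<close> equals
  the threshold nothing determines its value. Hence constancy in time behind the parabola has to be
  carried through the limit separately. Shifts by natural numbers suffice: they cost countably many
  null sets, and monotonicity in time fills in the remaining shifts. Test functions have only one
  derivative in x. The weak form is therefore obtained by integrating the test function along
  parabolic paths, not by applying the heat operator to it.\<close>

lemma integrable_mult_unit:
  fixes g h :: "'a \<Rightarrow> real"
  assumes "integrable M g" "h \<in> borel_measurable M" "\<And>x. h x \<in> {0..1}"
  shows "integrable M (\<lambda>x. g x * h x)"
proof (rule Bochner_Integration.integrable_bound[OF assms(1)])
  show "(\<lambda>x. g x * h x) \<in> borel_measurable M" using assms(1,2) by measurable
  show "AE x in M. norm (g x * h x) \<le> norm (g x)"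
    using assms(3) by (auto simp: abs_mult intro!: mult_left_le)
qed

text \<open>Half-open intervals are an intersection-stable generator, so a Dynkin induction carries
  the convergence to Borel sets inside a bounded window. Since all functions take values in [0, 1],
  the error of replacing the test function is at most its L1 distance, uniformly in
  \<open>n\<close>, and integrable functions follow by approximation.\<close>

lemma weak_limit_of_intervals:
  fixes f :: "nat \<Rightarrow> real \<Rightarrow> real" and q g :: "real \<Rightarrow> real"
  assumes f[measurable]: "\<And>n. f n \<in> borel_measurable borel"
    and f01: "\<And>n x. f n x \<in> {0..1}"
    and q[measurable]: "q \<in> borel_measurable borel" and q01: "\<And>x. q x \<in> {0..1}"
    and lim: "\<And>a b. (\<lambda>n. LBINT x. indicator {a<..b} x * f n x)
                \<longlonglongrightarrow> (LBINT x. indicator {a<..b} x * q x)"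
    and g: "integrable lborel g"
  shows "(\<lambda>n. LBINT x. g x * f n x) \<longlonglongrightarrow> (LBINT x. g x * q x)"
proof -
  have intf: "integrable lborel (\<lambda>x. g x * h x)"
    if "integrable lborel g" "h \<in> borel_measurable borel" "\<And>x. h x \<in> {0..1}" for g h :: "real \<Rightarrow> real"
    using that by (intro integrable_mult_unit) auto
  have intA: "integrable lborel (indicator A :: real \<Rightarrow> real)"
    if "A \<in> sets borel" "A \<subseteq> {a<..b}" for A :: "real set" and a b
  proof -
    have "emeasure lborel A \<le> emeasure lborel {a<..b}"
      using that by (intro emeasure_mono) auto
    also have "\<dots> < \<infinity>" by (cases "a \<le> b") auto
    finally show ?thesis using that by simp
  qed
  define S where "S h A = (LBINT x. indicator A x * h x)" for h :: "real \<Rightarrow> real" and A :: "real set"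
  have Sbound: "\<bar>S h A\<bar> \<le> measure lborel A"
    if A: "A \<in> sets borel" "A \<subseteq> {a<..b}" and h: "h \<in> borel_measurable borel" "\<And>x. h x \<in> {0..1}" for h A a b
  proof -
    have "\<bar>S h A\<bar> \<le> (LBINT x. \<bar>indicator A x * h x\<bar>)"
      unfolding S_def by (rule integral_abs_bound)
    also have "\<dots> \<le> (LBINT x. indicator A x)"
      using intA[OF A] h(2) intf[OF intA[OF A] h]
      by (intro integral_mono) (auto simp: abs_mult split: split_indicator)
    also have "\<dots> = measure lborel A" by simp
    finally show ?thesis .
  qed
  \<comment> \<open>The bounded window keeps all measures finite, so that the complement step is a
    subtraction and the union step has a summable bound.\<close>
  have box: "(\<lambda>n. S (f n) (A \<inter> {-N<..N})) \<longlonglongrightarrow> S q (A \<inter> {-N<..N})"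
    if A: "A \<in> sets borel" for A N
  proof -
    let ?J = "{-N<..N::real}"
    have A': "A \<in> sigma_sets UNIV (range (\<lambda>(a, b). {a <.. b::real}))"
      using A unfolding borel_sigma_sets_Ioc by (simp add: sets_measure_of)
    have stable: "Int_stable (range (\<lambda>(a, b). {a<..b::real}))"
      by (auto simp: Int_stable_def image_iff)
    have closed: "range (\<lambda>(a, b). {a<..b::real}) \<subseteq> Pow UNIV" by simp
    from stable closed A' show ?thesis
    proof (induction rule: sigma_sets_induct_disjoint)
      case (basic A)
      then have "A \<in> range (\<lambda>(a, b). {a <.. b::real})" .
      then obtain a b where "A = {a<..b}" by auto
      then have "A \<inter> ?J = {max a (-N)<..min b N}" by auto
      then show "(\<lambda>n. S (f n) (A \<inter> ?J)) \<longlonglongrightarrow> S q (A \<inter> ?J)"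
        using lim unfolding S_def by simp
    next
      fix A :: "real set"
      assume "A \<in> sigma_sets UNIV (range (\<lambda>(a, b). {a <.. b::real}))"
        and IH: "(\<lambda>n. S (f n) (A \<inter> ?J)) \<longlonglongrightarrow> S q (A \<inter> ?J)"
      then have [measurable]: "A \<in> sets borel"
        unfolding borel_sigma_sets_Ioc by (simp add: sets_measure_of)
      have *: "S h ((UNIV - A) \<inter> ?J) = S h ?J - S h (A \<inter> ?J)"
        if h: "h \<in> borel_measurable borel" "\<And>x. h x \<in> {0..1}" for h
        unfolding S_def
        by (subst Bochner_Integration.integral_diff[symmetric])
           (auto intro!: Bochner_Integration.integral_cong intf intA h simp: split: split_indicator)
      show "(\<lambda>n. S (f n) ((UNIV - A) \<inter> ?J)) \<longlonglongrightarrow> S q ((UNIV - A) \<inter> ?J)"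
        unfolding *[OF f f01] *[OF q q01]
        by (intro tendsto_diff IH) (use lim in \<open>simp add: S_def\<close>)
    next
      fix A :: "nat \<Rightarrow> real set"
      assume disj: "disjoint_family A"
        and A: "range A \<subseteq> sigma_sets UNIV (range (\<lambda>(a, b). {a <.. b::real}))"
        and IH: "\<And>i. (\<lambda>n. S (f n) (A i \<inter> ?J)) \<longlonglongrightarrow> S q (A i \<inter> ?J)"
      have Am[measurable]: "A i \<in> sets borel" for i
        using A unfolding borel_sigma_sets_Ioc by (auto simp: sets_measure_of)
      have disj': "disjoint_family (\<lambda>i. A i \<inter> ?J)" using disj by (auto simp: disjoint_family_on_def)
      have m: "(\<lambda>i. measure lborel (A i \<inter> ?J)) sums measure lborel (\<Union>i. A i \<inter> ?J)"
      proof (rule measure_UNION)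
        have "emeasure lborel (\<Union>i. A i \<inter> ?J) \<le> emeasure lborel ?J"
          by (intro emeasure_mono) auto
        also have "\<dots> < \<infinity>" by (cases "-N \<le> N") auto
        finally show "emeasure lborel (\<Union>i. A i \<inter> ?J) \<noteq> \<infinity>" by simp
      qed (use disj' in auto)
      have *: "S h ((\<Union>i. A i) \<inter> ?J) = (\<Sum>i. S h (A i \<inter> ?J))"
        if h: "h \<in> borel_measurable borel" "\<And>x. h x \<in> {0..1}" for h
      proof -
        have "S h ((\<Union>i. A i) \<inter> ?J) = (\<integral>x\<in>(\<Union>i. A i \<inter> ?J). h x \<partial>lborel)"
          unfolding S_def set_lebesgue_integral_def
          by (rule Bochner_Integration.integral_cong) (auto split: split_indicator)
        also have "\<dots> = (\<Sum>i. \<integral>x\<in>(A i \<inter> ?J). h x \<partial>lborel)"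
        proof (rule lebesgue_integral_countable_add)
          show "\<And>i j. i \<noteq> j \<Longrightarrow> (A i \<inter> ?J) \<inter> (A j \<inter> ?J) = {}"
            using disj' by (auto simp: disjoint_family_on_def)
          show "set_integrable lborel (\<Union>i. A i \<inter> ?J) h"
            unfolding set_integrable_def real_scaleR_def
            by (intro intf intA[of _ "-N" N] h) auto
        qed auto
        finally show ?thesis unfolding S_def set_lebesgue_integral_def by simp
      qed
      \<comment> \<open>Limit and series are exchanged by Tannery's theorem: the terms are bounded
        by the measures of the disjoint pieces, independently of \<open>n\<close>.\<close>
      have "((\<lambda>n. \<Sum>i. S (f n) (A i \<inter> ?J)) \<longlongrightarrow> (\<Sum>i. S q (A i \<inter> ?J))) sequentially"
      proof (rule tannerys_theorem[THEN conjunct2, THEN conjunct2])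
        show "eventually (\<lambda>(k, n). norm (S (f n) (A k \<inter> ?J)) \<le> measure lborel (A k \<inter> ?J))
           (at_top \<times>\<^sub>F sequentially)"
          by (intro always_eventually) (auto intro!: Sbound[of _ "-N" N] f f01)
        show "summable (\<lambda>k. measure lborel (A k \<inter> ?J))" using m by (rule sums_summable)
      qed (use IH in auto)
      then show "(\<lambda>n. S (f n) ((\<Union>i. A i) \<inter> ?J)) \<longlonglongrightarrow> S q ((\<Union>i. A i) \<inter> ?J)"
        unfolding *[OF f f01] *[OF q q01] .
    qed (auto simp: S_def)
  qed
  \<comment> \<open>The bound 2 |g| is the one that \<open>integrable_induct\<close> supplies in its
    limit case; then 3 |g| dominates |s_i - g|.\<close>
  have approx: "(\<lambda>n. LBINT x. g x * f n x) \<longlonglongrightarrow> (LBINT x. g x * q x)"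
    if g: "integrable lborel g" and s: "\<And>i. integrable lborel (s i)"
      and P: "\<And>i::nat. (\<lambda>n. LBINT x. s i x * f n x) \<longlonglongrightarrow> (LBINT x. s i x * q x)"
      and sg: "\<And>x. (\<lambda>i. s i x) \<longlonglongrightarrow> g x" and bd: "\<And>i x. norm (s i x) \<le> 2 * norm (g x)"
    for g :: "real \<Rightarrow> real" and s
  proof (rule LIMSEQ_I)
    fix r :: real assume "r > 0"
    have "(\<lambda>i. LBINT x. norm (s i x - g x)) \<longlonglongrightarrow> (\<integral>x. 0 \<partial>(lborel::real measure))"
    proof (rule integral_dominated_convergence[where w = "\<lambda>x. 3 * norm (g x)"])
      show "AE x in lborel. (\<lambda>i. norm (s i x - g x)) \<longlonglongrightarrow> 0"
        by (intro AE_I2 tendsto_norm_zero LIM_zero sg)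
      show "AE x in lborel. norm (norm (s i x - g x)) \<le> 3 * norm (g x)" for i
      proof (intro AE_I2)
        fix x show "norm (norm (s i x - g x)) \<le> 3 * norm (g x)"
          using bd[of i x] norm_triangle_ineq4[of "s i x" "g x"] by simp
      qed
    qed (use g s in auto)
    from LIMSEQ_D[OF this, of "r/3"] \<open>r > 0\<close> obtain i where i: "(LBINT x. norm (s i x - g x)) < r / 3"
      by auto
    have close: "\<bar>(LBINT x. g x * h x) - (LBINT x. s i x * h x)\<bar> < r / 3"
      if h: "h \<in> borel_measurable borel" "\<And>x. h x \<in> {0..1}" for h
    proof -
      have "(LBINT x. g x * h x) - (LBINT x. s i x * h x) = (LBINT x. (g x - s i x) * h x)"
        by (simp add: intf[OF g h] intf[OF s h] left_diff_distrib)
      also have "\<bar>\<dots>\<bar> \<le> (LBINT x. \<bar>(g x - s i x) * h x\<bar>)" by (rule integral_abs_bound)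
      also have "\<dots> \<le> (LBINT x. norm (s i x - g x))"
      proof (rule integral_mono)
        have "integrable lborel (\<lambda>x. g x - s i x)" using g s by simp
        from intf[OF this h] show "integrable lborel (\<lambda>x. \<bar>(g x - s i x) * h x\<bar>)" by simp
        show "\<bar>(g x - s i x) * h x\<bar> \<le> norm (s i x - g x)" for x
          using h(2)[of x] by (auto simp: abs_mult abs_minus_commute intro!: mult_left_le)
      qed (use g s in auto)
      finally show ?thesis using i by linarith
    qed
    from LIMSEQ_D[OF P[of i], of "r/3"] \<open>r > 0\<close> obtain no where
      no: "\<And>n. n \<ge> no \<Longrightarrow> norm ((LBINT x. s i x * f n x) - (LBINT x. s i x * q x)) < r / 3" by auto
    show "\<exists>no. \<forall>n\<ge>no. norm ((LBINT x. g x * f n x) - (LBINT x. g x * q x)) < r"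
    proof (intro exI allI impI)
      fix n assume "no \<le> n"
      with no[of n] close[OF f[of n] f01] close[OF q q01]
      show "norm ((LBINT x. g x * f n x) - (LBINT x. g x * q x)) < r"
        unfolding real_norm_def by linarith
    qed
  qed
  show ?thesis using g
  proof (induction rule: integrable_induct)
    case (base A c)
    have iA: "integrable lborel (indicator A :: real \<Rightarrow> real)" using base by simp
    have [measurable]: "A \<in> sets borel" using base by simp
    have "(\<lambda>n. LBINT x. indicator A x * f n x) \<longlonglongrightarrow> (LBINT x. indicator A x * q x)"
    proof (rule approx[where s = "\<lambda>i x. indicator (A \<inter> {-real i<..real i}) x"])
      show "integrable lborel (indicator A :: real \<Rightarrow> real)" by fact
      show "integrable lborel (indicat_real (A \<inter> {- real i<..real i}))" for i
        by (rule Bochner_Integration.integrable_bound[OF iA]) (auto split: split_indicator)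
      show "(\<lambda>n. LBINT x. indicat_real (A \<inter> {- real i<..real i}) x * f n x)
         \<longlonglongrightarrow> (LBINT x. indicat_real (A \<inter> {- real i<..real i}) x * q x)" for i
        using box[of A "real i"] unfolding S_def by simp
      show "(\<lambda>i. indicat_real (A \<inter> {- real i<..real i}) x) \<longlonglongrightarrow> indicat_real A x" for x
      proof (rule tendsto_eventually)
        show "\<forall>\<^sub>F i in sequentially. indicat_real (A \<inter> {- real i<..real i}) x = indicat_real A x"
        proof (rule eventually_mono[OF eventually_gt_at_top[of "nat \<lceil>\<bar>x\<bar>\<rceil>"]])
          fix i assume "nat \<lceil>\<bar>x\<bar>\<rceil> < i"
          then have "\<bar>x\<bar> < real i" by linarith
          then show "indicat_real (A \<inter> {- real i<..real i}) x = indicat_real A x"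
            by (auto split: split_indicator)
        qed
      qed
    qed (auto split: split_indicator)
    from tendsto_mult_left[OF this, of c] show ?case
      by (simp add: mult.assoc mult.commute mult.left_commute flip: integral_mult_right_zero)
  next
    case (add g1 g2)
    have "(LBINT x. (g1 x + g2 x) * h x) = (LBINT x. g1 x * h x) + (LBINT x. g2 x * h x)"
      if h: "h \<in> borel_measurable borel" "\<And>x. h x \<in> {0..1}" for h
      unfolding ring_distribs by (intro Bochner_Integration.integral_add intf add h)
    with f f01 q q01 add show ?case by (auto intro!: tendsto_add)
  next
    case (lim g s)
    then show ?case by (intro approx[of g s]) auto
  qed
qed

text \<open>The equicontinuity half of the Arzela-Ascoli argument. It serves both the primitives in
  the weak compactness proof and the delayed solutions.\<close>

lemma convergent_of_dense:
  fixes f :: "nat \<Rightarrow> 'a::metric_space \<Rightarrow> real"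
  assumes dense: "\<And>x e. e > 0 \<Longrightarrow> \<exists>y\<in>S. dist x y < e"
    and equi: "\<And>e. e > 0 \<Longrightarrow> \<exists>d>0. \<forall>n x y. dist x y < d \<longrightarrow> \<bar>f n x - f n y\<bar> < e"
    and conv: "\<And>x. x \<in> S \<Longrightarrow> convergent (\<lambda>n. f n x)"
  shows "convergent (\<lambda>n. f n x)"
proof -
  have "Cauchy (\<lambda>n. f n x)"
  proof (rule metric_CauchyI)
    fix e :: real assume "e > 0"
    then obtain d where d: "d > 0" "\<And>n x y. dist x y < d \<Longrightarrow> \<bar>f n x - f n y\<bar> < e/3"
      using equi[of "e/3"] by auto
    obtain y where y: "y \<in> S" "dist x y < d" using dense d(1) by blast
    have "Cauchy (\<lambda>n. f n y)" using conv[OF y(1)] by (rule convergent_Cauchy)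
    with \<open>e > 0\<close> obtain M where M: "\<And>m n. m \<ge> M \<Longrightarrow> n \<ge> M \<Longrightarrow> dist (f m y) (f n y) < e/3"
      unfolding Cauchy_def by (meson divide_pos_pos zero_less_numeral)
    have "dist (f m x) (f n x) < e" if "m \<ge> M" "n \<ge> M" for m n
      using M[OF that] d(2)[OF y(2), of m] d(2)[OF y(2), of n] unfolding dist_real_def by linarith
    then show "\<exists>M. \<forall>m\<ge>M. \<forall>n\<ge>M. dist (f m x) (f n x) < e" by blast
  qed
  then show ?thesis by (rule Cauchy_convergent)
qed

text \<open>The hypothesis speaks of the primitives of \<open>f n\<close> that vanish at 0. They are
  nondecreasing and 1-Lipschitz, so they converge at every point, and the limit has both properties
  as well. The desired weak limit is its density, which a Radon-Nikodym argument provides.\<close>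

lemma weak_compactness_1d:
  fixes f :: "nat \<Rightarrow> real \<Rightarrow> real"
  assumes f[measurable]: "\<And>n. f n \<in> borel_measurable borel"
    and f01: "\<And>n x. f n x \<in> {0..1}"
    and conv: "\<And>a. a \<in> \<rat> \<Longrightarrow>
      convergent (\<lambda>n. LBINT x. (indicator {0<..a} x - indicator {a<..0} x) * f n x)"
  obtains q where "q \<in> borel_measurable borel" "\<And>x. q x \<in> {0..1}"
    "\<And>g. integrable lborel g \<Longrightarrow> (\<lambda>n. LBINT x. g x * f n x) \<longlonglongrightarrow> (LBINT x. g x * q x)"
proof -
  define J where "J n a b = (LBINT x. indicator {a<..b} x * f n x)" for n and a b :: real
  have int: "integrable lborel (\<lambda>x. indicator {a<..b} x * f n x)" for a b n
  proof (rule Bochner_Integration.integrable_bound)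
    show "integrable lborel (indicat_real {a<..b})" by (cases "a \<le> b") auto
    show "AE x in lborel. norm (indicat_real {a<..b} x * f n x) \<le> norm (indicat_real {a<..b} x)"
      using f01[of n] by (auto split: split_indicator intro!: AE_I2)
  qed simp
  have J_nonneg: "0 \<le> J n a b" for n a b
    unfolding J_def using f01[of n] by (intro Bochner_Integration.integral_nonneg) auto
  have J_le: "J n a b \<le> b - a" if "a \<le> b" for n a b
  proof -
    have "J n a b \<le> (LBINT x. indicator {a<..b} x)"
      unfolding J_def using f01[of n] that
      by (intro integral_mono int) (auto split: split_indicator)
    then show ?thesis using that by simp
  qed
  \<comment> \<open>The signed primitive based at 0; at most one of the two terms is
    nonzero.\<close>
  define T where "T n x = J n 0 x - J n x 0" for n x
  define \<Phi> where "\<Phi> x = lim (\<lambda>n. T n x)" for x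
  have T_diff: "T n b - T n a = J n a b" if "a \<le> b" for n a b
    unfolding T_def J_def
    using that by (simp flip: Bochner_Integration.integral_diff add: int)
      (auto intro!: Bochner_Integration.integral_cong split: split_indicator)
  have T_lip: "\<bar>T n x - T n y\<bar> \<le> \<bar>x - y\<bar>" for n x y
    using T_diff[of x y n] T_diff[of y x n] J_nonneg[of n x y] J_le[of x y n] J_nonneg[of n y x] J_le[of y x n]
    by linarith
  have "convergent (\<lambda>n. T n x)" for x
  proof (rule convergent_of_dense[where S = "\<rat>"])
    show "\<exists>y\<in>\<rat>. dist x y < e" if "e > 0" for x e :: real
    proof -
      obtain r where "r \<in> \<rat>" "x < r" "r < x + e"
        using Rats_dense_in_real[of x "x + e"] \<open>e > 0\<close> by auto
      then show ?thesis by (intro bexI[of _ r]) (auto simp: dist_real_def)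
    qed
    show "\<exists>d>0. \<forall>n x y. dist x y < d \<longrightarrow> \<bar>T n x - T n y\<bar> < e" if "e > 0" for e :: real
      using T_lip that by (intro exI[of _ e]) (auto simp: dist_real_def intro: le_less_trans)
    have "T n x = (LBINT y. (indicator {0<..x} y - indicator {x<..0} y) * f n y)" for n x
      unfolding T_def J_def by (simp add: left_diff_distrib int)
    then show "convergent (\<lambda>n. T n x)" if "x \<in> \<rat>" for x
      using conv[OF that] by simp
  qed
  then have T: "(\<lambda>n. T n x) \<longlonglongrightarrow> \<Phi> x" for x
    unfolding \<Phi>_def by (simp add: convergent_LIMSEQ_iff)
  have J_lim: "(\<lambda>n. J n a b) \<longlonglongrightarrow> \<Phi> b - \<Phi> a" if "a \<le> b" for a b
    unfolding T_diff[OF that, symmetric] by (intro tendsto_intros T)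
  have mono: "\<Phi> a \<le> \<Phi> b" if "a \<le> b" for a b
    using LIMSEQ_le_const[OF J_lim[OF that], of 0] J_nonneg by fastforce
  have Lip: "\<Phi> b - \<Phi> a \<le> b - a" if "a \<le> b" for a b
    using LIMSEQ_le_const2[OF J_lim[OF that], of "b - a"] J_le[OF that] by auto
  have cont: "isCont \<Phi> a" for a
  proof -
    have "1-lipschitz_on UNIV \<Phi>"
    proof (rule lipschitz_onI)
      fix x y :: real show "dist (\<Phi> x) (\<Phi> y) \<le> 1 * dist x y"
        using mono[of x y] mono[of y x] Lip[of x y] Lip[of y x] by (auto simp: dist_real_def abs_real_def)
    qed simp
    then show ?thesis
      using lipschitz_on_continuous_on continuous_on_eq_continuous_at open_UNIV by blast
  qed
  \<comment> \<open>Both \<Phi> and x - \<Phi> are nondecreasing, because \<Phi> is 1-Lipschitz.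
    Their Stieltjes measures add up to Lebesgue measure, which yields at once that \<nu>1 is
    absolutely continuous and that its density is at most 1.\<close>
  define \<nu>1 where "\<nu>1 = interval_measure \<Phi>"
  define \<nu>2 where "\<nu>2 = interval_measure (\<lambda>x. x - \<Phi> x)"
  have mono2: "x - \<Phi> x \<le> y - \<Phi> y" if "x \<le> y" for x y using Lip[OF that] by simp
  have cont1: "continuous (at_right a) \<Phi>" for a
    using cont by (simp add: continuous_at_imp_continuous_within)
  have cont2: "continuous (at_right a) (\<lambda>x. x - \<Phi> x)" for a
    by (intro continuous_intros cont1)
  have \<nu>1: "emeasure \<nu>1 {a<..b} = ennreal (\<Phi> b - \<Phi> a)" if "a \<le> b" for a b
    unfolding \<nu>1_def by (intro emeasure_interval_measure_Ioc that mono cont1)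
  have \<nu>2: "emeasure \<nu>2 {a<..b} = ennreal ((b - \<Phi> b) - (a - \<Phi> a))" if "a \<le> b" for a b
    unfolding \<nu>2_def by (intro emeasure_interval_measure_Ioc that mono2 cont2)
  have sets[simp]: "sets \<nu>1 = sets borel" "sets \<nu>2 = sets borel"
    unfolding \<nu>1_def \<nu>2_def by auto
  define M where "M = measure_of UNIV (sets borel) (\<lambda>A. emeasure \<nu>1 A + emeasure \<nu>2 A)"
  have setsM[simp]: "sets M = sets borel"
    unfolding M_def using sets.sigma_sets_eq[of borel] by (simp add: sets_measure_of)
  have emM: "emeasure M A = emeasure \<nu>1 A + emeasure \<nu>2 A" if "A \<in> sets borel" for A
  proof -
    have "countably_additive (sets M) (\<lambda>A. emeasure \<nu>1 A + emeasure \<nu>2 A)"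
      by (auto simp: countably_additive_def suminf_add[symmetric] suminf_emeasure)
    moreover have "positive (sets M) (\<lambda>A. emeasure \<nu>1 A + emeasure \<nu>2 A)"
      by (simp add: positive_def)
    ultimately show ?thesis
      using that by (intro emeasure_measure_of[OF M_def]) auto
  qed
  have M: "M = lborel"
  proof (rule measure_eqI_generator_eq)
    show "Int_stable (range (\<lambda>(a, b). {a<..b::real}))"
      by (auto simp: Int_stable_def image_iff)
    show "range (\<lambda>(a, b). {a<..b::real}) \<subseteq> Pow UNIV" by simp
    show "sets M = sigma_sets UNIV (range (\<lambda>(a, b). {a<..b::real}))"
      "sets lborel = sigma_sets UNIV (range (\<lambda>(a, b). {a<..b::real}))"
      by (subst setsM sets_lborel, subst borel_sigma_sets_Ioc, simp add: sets_measure_of)+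
    fix X assume "X \<in> range (\<lambda>(a, b). {a<..b::real})"
    then obtain a b where X: "X = {a<..b}" by auto
    show "emeasure M X = emeasure lborel X"
    proof (cases "a \<le> b")
      case True
      then show ?thesis unfolding X using mono[OF True] mono2[OF True]
        by (simp add: emM \<nu>1 \<nu>2 ennreal_plus[symmetric] del: ennreal_plus)
    qed (simp add: X)
  next
    show "range (\<lambda>i::nat. {-real i<..real i}) \<subseteq> range (\<lambda>(a, b). {a<..b::real})" by auto
    show "(\<Union>i::nat. {-real i<..real i}) = UNIV"
    proof safe
      fix x :: real
      obtain n :: nat where "\<bar>x\<bar> < real n" using reals_Archimedean2 by blast
      then show "x \<in> (\<Union>i::nat. {-real i<..real i})" by (intro UN_I[of n]) auto
    qed simp
    show "emeasure M {-real i<..real i} \<noteq> \<infinity>" for i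
      by (simp add: emM \<nu>1 \<nu>2)
  qed
  have ac: "absolutely_continuous lborel \<nu>1" "absolutely_continuous lborel \<nu>2"
    unfolding absolutely_continuous_def M[symmetric] by (auto simp: null_sets_def emM)
  obtain F1 F2 where [measurable]: "F1 \<in> borel_measurable borel" "F2 \<in> borel_measurable borel"
    and F: "density lborel F1 = \<nu>1" "density lborel F2 = \<nu>2"
    using sigma_finite_measure.Radon_Nikodym[OF sigma_finite_lborel ac(1)] sigma_finite_measure.Radon_Nikodym[OF sigma_finite_lborel ac(2)] by auto
  have "density lborel (\<lambda>x. F1 x + F2 x) = density lborel (\<lambda>_. 1)"
  proof (rule measure_eqI)
    fix A assume "A \<in> sets (density lborel (\<lambda>x. F1 x + F2 x))"
    then have [measurable]: "A \<in> sets borel" by simp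
    have "emeasure (density lborel (\<lambda>x. F1 x + F2 x)) A = emeasure (density lborel F1) A + emeasure (density lborel F2) A"
      by (simp add: emeasure_density nn_integral_add ring_distribs)
    also have "\<dots> = emeasure M A" unfolding F by (simp add: emM)
    finally show "emeasure (density lborel (\<lambda>x. F1 x + F2 x)) A = emeasure (density lborel (\<lambda>_. 1)) A"
      by (simp add: M density_1)
  qed simp
  then have "AE x in lborel. F1 x + F2 x = 1"
    by (subst (asm) sigma_finite_measure.density_unique_iff[OF sigma_finite_lborel]) auto
  then have AE_le: "AE x in lborel. F1 x \<le> 1"
    by eventually_elim (metis le_iff_add)
  \<comment> \<open>Truncation makes the bounds hold at every point; it changes the density only on
    a null set.\<close>
  define q where "q x = min 1 (enn2real (F1 x))" for x
  have q[measurable]: "q \<in> borel_measurable borel" unfolding q_def by measurable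
  have q01: "q x \<in> {0..1}" for x unfolding q_def by auto
  have AE_q: "AE x in lborel. F1 x = ennreal (q x)"
    using AE_le
  proof eventually_elim
    case (elim x)
    then have "F1 x < top" using le_less_trans ennreal_one_less_top by blast
    then have "F1 x = ennreal (enn2real (F1 x))" by simp
    moreover from this elim have "enn2real (F1 x) \<le> 1"
      by (metis ennreal_1 ennreal_le_iff zero_le_one)
    ultimately show ?case unfolding q_def by simp
  qed
  have q_int: "(LBINT x. indicator {a<..b} x * q x) = \<Phi> b - \<Phi> a" if "a \<le> b" for a b
  proof -
    have "(LBINT x. indicator {a<..b} x * q x)
        = enn2real (\<integral>\<^sup>+x. ennreal (indicator {a<..b} x * q x) \<partial>lborel)"
      using q01 by (intro integral_eq_nn_integral) auto
    also have "(\<integral>\<^sup>+x. ennreal (indicator {a<..b} x * q x) \<partial>lborel) = (\<integral>\<^sup>+x. F1 x * indicator {a<..b} x \<partial>lborel)"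
      using AE_q by (intro nn_integral_cong_AE, eventually_elim) (auto split: split_indicator)
    also have "\<dots> = emeasure \<nu>1 {a<..b}" unfolding F(1)[symmetric] by (simp add: emeasure_density)
    also have "\<dots> = ennreal (\<Phi> b - \<Phi> a)" using \<nu>1[OF that] .
    finally show ?thesis using mono[OF that] by simp
  qed
  have lim: "(\<lambda>n. LBINT x. indicator {a<..b} x * f n x) \<longlonglongrightarrow> (LBINT x. indicator {a<..b} x * q x)" for a b
    using J_lim[of a b] q_int[of a b] by (cases "a \<le> b") (auto simp: J_def)
  show thesis
    by (rule that[OF q q01 weak_limit_of_intervals[OF f f01 q q01 lim]])
qed

text \<open>The test function lives on the set where the inequality fails. The Gaussian weight is
  strictly positive and makes it integrable even if that set has infinite measure.\<close>

lemma AE_le_of_integrals_le: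
  fixes q q' :: "real \<Rightarrow> real"
  assumes [measurable]: "q \<in> borel_measurable borel" "q' \<in> borel_measurable borel"
    and q01: "\<And>x. q x \<in> {0..1}" "\<And>x. q' x \<in> {0..1}"
    and le: "\<And>g. integrable lborel g \<Longrightarrow> (\<And>x. 0 \<le> g x) \<Longrightarrow> (LBINT x. g x * q x) \<le> (LBINT x. g x * q' x)"
  shows "AE x in lborel. q x \<le> q' x"
proof -
  define g where "g x = indicator {x. q x > q' x} x * std_normal_density x" for x
  have [measurable]: "g \<in> borel_measurable borel" unfolding g_def by measurable
  have g0: "0 \<le> g x" for x by (simp add: g_def)
  have int: "integrable lborel std_normal_density"
    using integrable_normal_density[of 1 0] by simp
  have g: "integrable lborel g"
    by (rule Bochner_Integration.integrable_bound[OF int]) (auto simp: g_def split: split_indicator)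
  have bd: "integrable lborel (\<lambda>x. g x * h x)"
    if "h \<in> borel_measurable borel" "\<And>x. h x \<in> {0..1}" for h :: "real \<Rightarrow> real"
    by (rule Bochner_Integration.integrable_bound[OF g])
       (use that in \<open>auto simp: abs_mult intro!: mult_left_le\<close>)
  have i1: "integrable lborel (\<lambda>x. g x * q x)" and i2: "integrable lborel (\<lambda>x. g x * q' x)"
    by (rule bd; use q01 in simp)+
  have d: "(\<lambda>x. g x * (q x - q' x)) = (\<lambda>x. g x * q x - g x * q' x)"
    by (simp add: algebra_simps)
  have nn: "0 \<le> g x * (q x - q' x)" for x by (auto simp: g_def split: split_indicator)
  have "(LBINT x. g x * (q x - q' x)) \<le> 0"
    using le[OF g g0] i1 i2 unfolding d by simp
  moreover have "0 \<le> (LBINT x. g x * (q x - q' x))"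
    using nn by (rule Bochner_Integration.integral_nonneg)
  ultimately have "(LBINT x. g x * (q x - q' x)) = 0" by simp
  then have "AE x in lborel. g x * (q x - q' x) = 0"
    using i1 i2 nn by (subst (asm) integral_nonneg_eq_0_iff_AE) (auto simp: d)
  then show ?thesis
  proof eventually_elim
    case (elim x)
    have "std_normal_density x > 0" by (simp add: normal_density_pos)
    with elim show ?case by (auto simp: g_def split: split_indicator_asm)
  qed
qed

text \<open>Helly selection in time with weak convergence in space. A diagonal subsequence gives
  weak limits \<open>q r\<close> at all rational times \<open>r\<close>; \<open>p\<close> is the
  supremum of those before the given time. At almost every time \<open>p\<close> has no jump for
  almost every \<open>y\<close>, and there the integrals are squeezed between rational times before
  and after. Fubini and dominated convergence then give the convergence in the plane.\<close>

lemma weak_helly: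
  fixes P :: "nat \<Rightarrow> real \<times> real \<Rightarrow> real"
  assumes P[measurable]: "\<And>n. P n \<in> borel_measurable borel"
    and P01: "\<And>n z. P n z \<in> {0..1}"
    and P_mono: "\<And>n y s s'. s \<le> s' \<Longrightarrow> P n (y, s) \<le> P n (y, s')"
  obtains \<sigma> p where "strict_mono (\<sigma> :: nat \<Rightarrow> nat)" "p \<in> borel_measurable borel" "\<And>z. p z \<in> {0..1}"
    "\<And>y s s'. s \<le> s' \<Longrightarrow> p (y, s) \<le> p (y, s')"
    "\<And>g. integrable lborel g \<Longrightarrow> (\<lambda>n. LBINT z. g z * P (\<sigma> n) z) \<longlonglongrightarrow> (LBINT z. g z * p z)"
proof -
  have Pm[measurable]: "(\<lambda>y. P n (y, s)) \<in> borel_measurable borel" for n s by measurable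
  define T where "T n x r = (LBINT y. (indicator {0<..x} y - indicator {x<..0} y) * P n (y, r))" for n x r
  have T_bound: "\<bar>T n x r\<bar> \<le> 2 * \<bar>x\<bar>" for n x r
  proof -
    have "\<bar>T n x r\<bar> \<le> (LBINT y. indicator {-\<bar>x\<bar>..\<bar>x\<bar>} y)"
      unfolding T_def
    proof (rule order_trans[OF integral_abs_bound integral_mono'])
      show "\<bar>(indicator {0<..x} y - indicator {x<..0} y) * P n (y, r)\<bar> \<le> indicator {-\<bar>x\<bar>..\<bar>x\<bar>} y" for y
        using P01[of n "(y, r)"] by (auto split: split_indicator)
    qed auto
    then show ?thesis by simp
  qed
  \<comment> \<open>The division by 1 + 2 |x| only serves to give all sequences the common bound 1
    that the diagonal selection asks for.\<close>
  obtain \<sigma> where \<sigma>: "strict_mono (\<sigma> :: nat \<Rightarrow> nat)"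
    and conv: "\<And>z. z \<in> \<rat> \<times> \<rat> \<Longrightarrow> \<exists>l. (\<lambda>n. case z of (x, r) \<Rightarrow> T (\<sigma> n) x r / (1 + 2 * \<bar>x\<bar>)) \<longlonglongrightarrow> l"
  proof (rule function_convergent_subsequence[where S = "\<rat> \<times> \<rat>" and M = 1
        and f = "\<lambda>n z. case z of (x, r) \<Rightarrow> T n x r / (1 + 2 * \<bar>x\<bar>)"])
    show "countable (\<rat> \<times> \<rat> :: (real \<times> real) set)" by (simp add: countable_rat)
    show "norm (case z of (x, r) \<Rightarrow> T n x r / (1 + 2 * \<bar>x\<bar>)) \<le> 1" for n z
      using T_bound[of n "fst z" "snd z"] by (auto simp: case_prod_beta abs_mult divide_simps)
  qed blast
  have convT: "convergent (\<lambda>n. T (\<sigma> n) x r)" if "x \<in> \<rat>" "r \<in> \<rat>" for x r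
  proof -
    from conv[of "(x, r)"] that obtain l where "(\<lambda>n. T (\<sigma> n) x r / (1 + 2 * \<bar>x\<bar>)) \<longlonglongrightarrow> l" by auto
    from tendsto_mult_left[OF this, of "1 + 2 * \<bar>x\<bar>"] show ?thesis
      by (auto simp: convergent_def add_pos_nonneg[THEN less_imp_neq, symmetric])
  qed
  have "\<forall>r\<in>\<rat>. \<exists>q. q \<in> borel_measurable borel \<and> (\<forall>y. q y \<in> {0..1}) \<and>
    (\<forall>g. integrable lborel g \<longrightarrow> (\<lambda>n. LBINT y. g y * P (\<sigma> n) (y, r)) \<longlonglongrightarrow> (LBINT y. g y * q y))"
  proof
    fix r :: real assume r: "r \<in> \<rat>"
    show "\<exists>q. q \<in> borel_measurable borel \<and> (\<forall>y. q y \<in> {0..1}) \<and>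
    (\<forall>g. integrable lborel g \<longrightarrow> (\<lambda>n. LBINT y. g y * P (\<sigma> n) (y, r)) \<longlonglongrightarrow> (LBINT y. g y * q y))"
      by (rule weak_compactness_1d[of "\<lambda>n y. P (\<sigma> n) (y, r)"])
         (use convT[OF _ r] P01 in \<open>auto simp: T_def\<close>)
  qed
  from bchoice[OF this] obtain q where Q: "\<forall>r\<in>\<rat>. q r \<in> borel_measurable borel \<and> (\<forall>y. q r y \<in> {0..1}) \<and>
    (\<forall>g. integrable lborel g \<longrightarrow> (\<lambda>n. LBINT y. g y * P (\<sigma> n) (y, r)) \<longlonglongrightarrow> (LBINT y. g y * q r y))"
    by blast
  have q[measurable]: "q r \<in> borel_measurable borel"
    and q01: "q r y \<in> {0..1}"
    and q_lim: "integrable lborel g \<Longrightarrow>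
        (\<lambda>n. LBINT y. g y * P (\<sigma> n) (y, r)) \<longlonglongrightarrow> (LBINT y. g y * q r y)"
    if "r \<in> \<rat>" for r y g
    using bspec[OF Q that] by blast+
  have intP: "integrable lborel (\<lambda>y. g y * P n (y, s))" if "integrable lborel g" for g :: "real \<Rightarrow> real" and n s
    by (rule integrable_mult_unit[OF that]) (use P01 in auto)
  have q_mono: "AE y in lborel. q r y \<le> q r' y" if r: "r \<in> \<rat>" "r' \<in> \<rat>" "r \<le> r'" for r r'
  proof (rule AE_le_of_integrals_le)
    fix g :: "real \<Rightarrow> real" assume g: "integrable lborel g" and g0: "\<And>y. 0 \<le> g y"
    show "(LBINT y. g y * q r y) \<le> (LBINT y. g y * q r' y)"
      by (rule LIMSEQ_le[OF q_lim[OF r(1) g] q_lim[OF r(2) g]])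
         (auto intro!: exI[of _ 0] integral_mono intP g mult_left_mono P_mono r g0)
  qed (use q q01 r in auto)
  \<comment> \<open>The 0 changes nothing, because all \<open>q r\<close> are nonnegative; it makes the index set independent of \<open>z\<close>.\<close>
  define p where "p z = (SUP r\<in>\<rat>. if r < snd z then q r (fst z) else 0)" for z :: "real \<times> real"
  have bdd: "bdd_above ((\<lambda>r. if r < s then q r y else 0) ` \<rat>)" for y s
    using q01 by (auto intro!: bdd_aboveI[of _ 1])
  have p_ge: "q r y \<le> p (y, s)" if "r \<in> \<rat>" "r < s" for r y s
    unfolding p_def using cSUP_upper[OF that(1) bdd[of s y]] that by simp
  have p_le: "p (y, s) \<le> c" if "0 \<le> c" "\<And>r. r \<in> \<rat> \<Longrightarrow> r < s \<Longrightarrow> q r y \<le> c" for y s c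
    unfolding p_def using that by (intro cSUP_least) auto
  have p_meas[measurable]: "p \<in> borel_measurable borel"
    unfolding p_def
  proof (rule borel_measurable_cSUP)
    fix r :: real assume [measurable]: "r \<in> \<rat>"
    show "(\<lambda>z. if r < snd z then q r (fst z) else 0) \<in> borel_measurable borel"
      using q[OF \<open>r \<in> \<rat>\<close>] unfolding borel_prod[symmetric] by measurable
  qed (use bdd countable_rat in auto)
  have p01: "p z \<in> {0..1}" for z
  proof -
    obtain y s where z: "z = (y, s)" by fastforce
    obtain r where "r \<in> \<rat>" "r < s" using Rats_dense_in_real[of "s - 1" s] by auto
    then have "0 \<le> p z" unfolding z using p_ge[of r s y] q01[of r y] by auto
    moreover have "p z \<le> 1" unfolding z using q01 by (intro p_le) auto
    ultimately show ?thesis by simp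
  qed
  have p_mono: "p (y, s) \<le> p (y, s')" if "s \<le> s'" for y s s'
    using p01[of "(y, s')"] that by (intro p_le p_ge) auto
  have pm[measurable]: "(\<lambda>y. p (y, s)) \<in> borel_measurable borel" for s by measurable
  have intp: "integrable lborel (\<lambda>y. g y * p (y, s))" if "integrable lborel g" for g :: "real \<Rightarrow> real" and s
    by (rule integrable_mult_unit[OF that]) (use p01 in auto)
  have intq: "integrable lborel (\<lambda>y. g y * q r y)" if "integrable lborel g" "r \<in> \<rat>" for g :: "real \<Rightarrow> real" and r
    by (rule integrable_mult_unit[OF that(1)]) (use that q q01 in auto)
  define pp where "pp z = (INF r\<in>\<rat>. if snd z < r then p (fst z, r) else 1)" for z :: "real \<times> real"
  have bdd': "bdd_below ((\<lambda>r. if s < r then p (y, r) else 1) ` \<rat>)" for y s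
    using p01 by (auto intro!: bdd_belowI[of _ 0])
  have pp_meas[measurable]: "pp \<in> borel_measurable borel"
    unfolding pp_def
  proof (rule borel_measurable_cINF)
    fix r :: real
    show "(\<lambda>z. if snd z < r then p (fst z, r) else 1) \<in> borel_measurable borel"
      unfolding borel_prod[symmetric] by measurable
  qed (use bdd' countable_rat in auto)
  have pp_le: "pp (y, s) \<le> p (y, r)" if "r \<in> \<rat>" "s < r" for r y s
    unfolding pp_def using cINF_lower[OF bdd'[of s y] that(1)] that by simp
  have pp_ge: "c \<le> pp (y, s)" if "c \<le> 1" "\<And>r. r \<in> \<rat> \<Longrightarrow> s < r \<Longrightarrow> c \<le> p (y, r)" for c y s
    unfolding pp_def using that by (intro cINF_greatest) auto
  have pp_eq: "pp (y, s) = p (y, s)" if "isCont (\<lambda>s. p (y, s)) s" for y s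
  proof (rule antisym)
    show "p (y, s) \<le> pp (y, s)" using p01[of "(y, s)"] by (intro pp_ge p_mono) auto
    show "pp (y, s) \<le> p (y, s)"
    proof (rule field_le_epsilon)
      fix e :: real assume "e > 0"
      with that obtain d where d: "d > 0" "\<And>x. \<bar>x - s\<bar> < d \<Longrightarrow> \<bar>p (y, x) - p (y, s)\<bar> < e"
        unfolding continuous_at_eps_delta dist_real_def by blast
      obtain r where r: "r \<in> \<rat>" "s < r" "r < s + d" using Rats_dense_in_real[of s "s + d"] d(1) by auto
      have "pp (y, s) \<le> p (y, r)" using r by (intro pp_le)
      also have "\<dots> \<le> p (y, s) + e" using d(2)[of r] r by auto
      finally show "pp (y, s) \<le> p (y, s) + e" .
    qed
  qed
  \<comment> \<open>\<open>pp\<close> is the right limit of \<open>p\<close> in time; monotone functions have only countably many jumps.\<close>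
  have "AE y in lborel. AE s in lborel. pp (y, s) = p (y, s)"
  proof (rule AE_I2)
    fix y :: real
    have "countable {s. \<not> isCont (\<lambda>s. p (y, s)) s}"
      by (intro mono_ctble_discont monoI p_mono)
    then have "{s. \<not> isCont (\<lambda>s. p (y, s)) s} \<in> null_sets lborel"
      by (rule countable_imp_null_set_lborel)
    then show "AE s in lborel. pp (y, s) = p (y, s)"
      by (rule AE_I') (use pp_eq in auto)
  qed
  moreover have "Measurable.pred (lborel \<Otimes>\<^sub>M lborel) (\<lambda>x. pp (fst x, snd x) = p (fst x, snd x))"
    unfolding lborel_prod by simp
  ultimately have AE_pp: "AE s in lborel. AE y in lborel. pp (y, s) = p (y, s)"
    by (subst (asm) lborel_pair.AE_commute) (simp_all add: pred_def)
  \<comment> \<open>For nonnegative \<open>g\<close> the integrals are nondecreasing in time, which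
    the squeeze requires; general \<open>g\<close> is split into positive and negative parts
    afterwards.\<close>
  have lim_nonneg: "(\<lambda>n. LBINT y. g y * P (\<sigma> n) (y, s)) \<longlonglongrightarrow> (LBINT y. g y * p (y, s))"
    if s: "AE y in lborel. pp (y, s) = p (y, s)" and g: "integrable lborel g" and g0: "\<And>y. 0 \<le> g y"
    for s and g :: "real \<Rightarrow> real"
  proof -
    have "\<exists>r. r \<in> \<rat> \<and> s - 1 / Suc j < r \<and> r < s" for j
      using Rats_dense_in_real[of "s - 1 / Suc j" s] by auto
    then obtain R where R: "\<And>j. R j \<in> \<rat>" "\<And>j. s - 1 / Suc j < R j" "\<And>j. R j < s" by metis
    have "\<exists>r. r \<in> \<rat> \<and> s < r \<and> r < s + 1 / Suc j" for j
      using Rats_dense_in_real[of s "s + 1 / Suc j"] by auto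
    then obtain R' where R': "\<And>j. R' j \<in> \<rat>" "\<And>j. s < R' j" "\<And>j. R' j < s + 1 / Suc j" by metis
    have Rlim: "R \<longlonglongrightarrow> s"
    proof (rule real_tendsto_sandwich[where f = "\<lambda>j. s - 1 / Suc j" and h = "\<lambda>_. s"])
      have "(\<lambda>j. s - 1 / Suc j) \<longlonglongrightarrow> s - 0" by (intro tendsto_diff tendsto_const LIMSEQ_Suc[OF lim_1_over_n])
      then show "(\<lambda>j. s - 1 / Suc j) \<longlonglongrightarrow> s" by simp
    qed (use R in \<open>auto intro!: always_eventually less_imp_le\<close>)
    \<comment> \<open>The supremum in \<open>p\<close> runs over times strictly before the argument,
      so \<open>q (R' j)\<close> is bounded by \<open>p\<close> only at a time later than
      \<open>R' j\<close>; hence the extra 1 / Suc j.\<close>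
    have R'lim: "(\<lambda>j. R' j + 1 / Suc j) \<longlonglongrightarrow> s"
    proof (rule real_tendsto_sandwich[where f = "\<lambda>_. s" and h = "\<lambda>j. s + 2 * (1 / Suc j)"])
      have "(\<lambda>j. s + 2 * (1 / Suc j)) \<longlonglongrightarrow> s + 2 * 0"
        by (intro tendsto_add tendsto_mult tendsto_const LIMSEQ_Suc[OF lim_1_over_n])
      then show "(\<lambda>j. s + 2 * (1 / Suc j)) \<longlonglongrightarrow> s" by simp
      show "\<forall>\<^sub>F j in sequentially. s \<le> R' j + 1 / Suc j"
        using R'(2) by (intro always_eventually allI) (smt (verit) of_nat_0_le_iff zero_le_divide_1_iff)
      show "\<forall>\<^sub>F j in sequentially. R' j + 1 / Suc j \<le> s + 2 * (1 / Suc j)"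
        using R'(3) by (intro always_eventually allI) (smt (verit))
    qed simp
    have p_low: "(\<lambda>j. p (y, R j)) \<longlonglongrightarrow> p (y, s)" for y
    proof (rule order_tendstoI)
      fix a assume "a < p (y, s)"
      show "\<forall>\<^sub>F j in sequentially. a < p (y, R j)"
      proof (cases "a < 0")
        case True
        then have "a < p (y, R j)" for j using p01[of "(y, R j)"] by auto
        then show ?thesis by simp
      next
        case False
        then obtain r where r: "r \<in> \<rat>" "r < s" "a < q r y"
          using p_le[of a s y] \<open>a < p (y, s)\<close> by (meson linorder_not_less)
        have "\<forall>\<^sub>F j in sequentially. r < R j" using order_tendstoD(1)[OF Rlim r(2)] .
        then show ?thesis
        proof eventually_elim
          case (elim j)
          have "q r y \<le> p (y, R j)" using elim r by (intro p_ge)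
          then show ?case using r(3) by simp
        qed
      qed
    next
      fix a assume a: "p (y, s) < a"
      have "p (y, R j) < a" for j using p_mono[of "R j" s y] R(3)[of j] a by linarith
      then show "\<forall>\<^sub>F j in sequentially. p (y, R j) < a" by simp
    qed
    have p_up: "(\<lambda>j. p (y, R' j + 1 / Suc j)) \<longlonglongrightarrow> p (y, s)" if y: "pp (y, s) = p (y, s)" for y
    proof (rule order_tendstoI)
      fix a assume a: "a < p (y, s)"
      have "a < p (y, R' j + 1 / Suc j)" for j
        using p_mono[of s "R' j + 1 / Suc j" y] R'(2)[of j] a
        by (smt (verit) of_nat_0_le_iff zero_le_divide_1_iff)
      then show "\<forall>\<^sub>F j in sequentially. a < p (y, R' j + 1 / Suc j)" by simp
    next
      fix a assume a: "p (y, s) < a"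
      obtain r where r: "r \<in> \<rat>" "s < r" "p (y, r) < a"
      proof (rule ccontr)
        assume "\<not> thesis"
        then have *: "\<And>r. r \<in> \<rat> \<Longrightarrow> s < r \<Longrightarrow> a \<le> p (y, r)" using that by force
        obtain r0 where "r0 \<in> \<rat>" "s < r0" using Rats_dense_in_real[of s "s + 1"] by auto
        with * p01[of "(y, r0)"] have "a \<le> 1" by fastforce
        then have "a \<le> pp (y, s)" using * by (intro pp_ge)
        then show False using y a by simp
      qed
      have "\<forall>\<^sub>F j in sequentially. R' j + 1 / Suc j < r" using order_tendstoD(2)[OF R'lim r(2)] .
      then show "\<forall>\<^sub>F j in sequentially. p (y, R' j + 1 / Suc j) < a"
        by eventually_elim (use p_mono r(3) in \<open>meson less_imp_le le_less_trans\<close>)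
    qed
    have low: "(\<lambda>j. LBINT y. g y * p (y, R j)) \<longlonglongrightarrow> (LBINT y. g y * p (y, s))"
    proof (rule integral_dominated_convergence[where w = "\<lambda>y. \<bar>g y\<bar>"])
      show "AE y in lborel. (\<lambda>j. g y * p (y, R j)) \<longlonglongrightarrow> g y * p (y, s)"
        by (intro AE_I2 tendsto_mult tendsto_const p_low)
      show "AE y in lborel. norm (g y * p (y, R j)) \<le> \<bar>g y\<bar>" for j
        using p01 by (auto simp: abs_mult intro!: mult_left_le)
    qed (use g in auto)
    have up: "(\<lambda>j. LBINT y. g y * p (y, R' j + 1 / Suc j)) \<longlonglongrightarrow> (LBINT y. g y * p (y, s))"
    proof (rule integral_dominated_convergence[where w = "\<lambda>y. \<bar>g y\<bar>"])
      show "AE y in lborel. (\<lambda>j. g y * p (y, R' j + 1 / Suc j)) \<longlonglongrightarrow> g y * p (y, s)"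
        using s by eventually_elim (intro tendsto_mult tendsto_const p_up)
      show "AE y in lborel. norm (g y * p (y, R' j + 1 / Suc j)) \<le> \<bar>g y\<bar>" for j
        using p01 by (auto simp: abs_mult intro!: mult_left_le)
    qed (use g in auto)
    have PP: "(LBINT y. g y * P n (y, t)) \<le> (LBINT y. g y * P n (y, t'))" if "t \<le> t'" for n t t'
      by (intro integral_mono intP g mult_left_mono P_mono that g0)
    show ?thesis
    proof (rule order_tendstoI)
      fix a assume "a < (LBINT y. g y * p (y, s))"
      from order_tendstoD(1)[OF low this] obtain j where j: "a < (LBINT y. g y * p (y, R j))"
        by (auto simp: eventually_sequentially)
      \<comment> \<open>Each comparison of \<open>q r\<close> with \<open>q (R j)\<close> fails at
        most on a null set. There are countably many rational \<open>r\<close>, so one null set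
        serves the whole supremum.\<close>
      have "AE y in lborel. \<forall>r\<in>\<rat>. r < R j \<longrightarrow> q r y \<le> q (R j) y"
        by (subst AE_ball_countable) (use q_mono R in \<open>auto simp: countable_rat intro: less_imp_le\<close>)
      then have "AE y in lborel. p (y, R j) \<le> q (R j) y"
        by eventually_elim (use p_le q01 R in auto)
      then have "(LBINT y. g y * p (y, R j)) \<le> (LBINT y. g y * q (R j) y)"
        by (intro integral_mono_AE intp intq g R) (auto intro: mult_left_mono g0)
      with j have "a < (LBINT y. g y * q (R j) y)" by simp
      from order_tendstoD(1)[OF q_lim[OF R(1) g] this]
      show "\<forall>\<^sub>F n in sequentially. a < (LBINT y. g y * P (\<sigma> n) (y, s))"
        by eventually_elim (use PP R(3) in \<open>meson less_imp_le less_le_trans\<close>)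
    next
      fix a assume "(LBINT y. g y * p (y, s)) < a"
      from order_tendstoD(2)[OF up this] obtain j where j: "(LBINT y. g y * p (y, R' j + 1 / Suc j)) < a"
        by (auto simp: eventually_sequentially)
      have "(LBINT y. g y * q (R' j) y) \<le> (LBINT y. g y * p (y, R' j + 1 / Suc j))"
        by (intro integral_mono intp intq g R' mult_left_mono p_ge g0) auto
      with j have "(LBINT y. g y * q (R' j) y) < a" by simp
      from order_tendstoD(2)[OF q_lim[OF R'(1) g] this]
      show "\<forall>\<^sub>F n in sequentially. (LBINT y. g y * P (\<sigma> n) (y, s)) < a"
        by eventually_elim (use PP R'(2) in \<open>meson less_imp_le le_less_trans\<close>)
    qed
  qed
  have lim1: "(\<lambda>n. LBINT y. g y * P (\<sigma> n) (y, s)) \<longlonglongrightarrow> (LBINT y. g y * p (y, s))"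
    if s: "AE y in lborel. pp (y, s) = p (y, s)" and g: "integrable lborel g" for s and g :: "real \<Rightarrow> real"
  proof -
    have g1: "integrable lborel (\<lambda>y. max 0 (g y))" and g2: "integrable lborel (\<lambda>y. max 0 (- g y))"
      using g by auto
    have "(LBINT y. g y * h y) = (LBINT y. max 0 (g y) * h y) - (LBINT y. max 0 (- g y) * h y)"
      if h: "h \<in> borel_measurable borel" "\<And>y. h y \<in> {0..1}" for h
    proof (subst Bochner_Integration.integral_diff[symmetric])
      show "(LBINT y. g y * h y) = (LBINT y. max 0 (g y) * h y - max 0 (- g y) * h y)"
        by (rule Bochner_Integration.integral_cong) (auto simp: max_def)
    qed (use h g1 g2 in \<open>auto intro!: integrable_mult_unit\<close>)
    from this[of "\<lambda>y. P (\<sigma> n) (y, s)" for n] this[of "\<lambda>y. p (y, s)"] P01 p01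
    show ?thesis
      using tendsto_diff[OF lim_nonneg[OF s g1] lim_nonneg[OF s g2]] by simp
  qed
  have "(\<lambda>n. LBINT z. g z * P (\<sigma> n) z) \<longlonglongrightarrow> (LBINT z. g z * p z)"
    if g: "integrable lborel g" for g :: "real \<times> real \<Rightarrow> real"
  proof -
    have g': "integrable (lborel \<Otimes>\<^sub>M lborel) (case_prod (\<lambda>y s. g (y, s)))"
      using g by (simp add: lborel_prod)
    have fub: "(LBINT z. g z * h z) = (LBINT s. LBINT y. g (y, s) * h (y, s))"
      if h: "h \<in> borel_measurable borel" "\<And>y. h y \<in> {0..1}" for h
    proof -
      have "integrable lborel (\<lambda>z. g z * h z)"
        using h by (intro integrable_mult_unit g) auto
      then have "integrable (lborel \<Otimes>\<^sub>M lborel) (case_prod (\<lambda>y s. g (y, s) * h (y, s)))"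
        by (simp add: lborel_prod split_beta')
      from lborel_pair.integral_snd[OF this] show ?thesis
        by (simp add: lborel_prod split_beta')
    qed
    have [measurable]: "g \<in> borel_measurable borel" using g by auto
    have "(\<lambda>n. LBINT s. LBINT y. g (y, s) * P (\<sigma> n) (y, s))
        \<longlonglongrightarrow> (LBINT s. LBINT y. g (y, s) * p (y, s))"
    proof (rule integral_dominated_convergence[where w = "\<lambda>s. \<integral>y. norm (g (y, s)) \<partial>lborel"])
      show "integrable lborel (\<lambda>s. LBINT y. norm (g (y, s)))"
        by (rule lborel_pair.integrable_snd) (use g in \<open>simp add: lborel_prod split_beta'\<close>)
      have AE_int: "AE s in lborel. integrable lborel (\<lambda>y. g (y, s))"
        using lborel_pair.AE_integrable_snd[OF g'] .
      show "AE s in lborel. (\<lambda>n. LBINT y. g (y, s) * P (\<sigma> n) (y, s))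
             \<longlonglongrightarrow> (LBINT y. g (y, s) * p (y, s))"
        using AE_int AE_pp by eventually_elim (rule lim1)
      show "AE s in lborel. norm (LBINT y. g (y, s) * P (\<sigma> n) (y, s)) \<le> (LBINT y. norm (g (y, s)))" for n
        using AE_int
      proof eventually_elim
        case (elim s)
        show ?case
        proof (rule order_trans[OF integral_norm_bound integral_mono])
          show "norm (g (y, s) * P (\<sigma> n) (y, s)) \<le> norm (g (y, s))" for y
            using P01[of "\<sigma> n" "(y, s)"] by (auto simp: abs_mult intro!: mult_left_le)
        qed (use elim intP in auto)
      qed
    qed measurable
    then show ?thesis using fub[OF P P01] fub[OF p_meas p01] by simp
  qed
  from that[OF \<sigma> p_meas p01 p_mono this] show thesis .
qed

section \<open>Convolution with an integrable kernel\<close>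

lemma lborel_reflect_at:
  fixes c :: "'a::euclidean_space"
  shows "distr lborel borel (\<lambda>x. c - x) = lborel"
  by (subst lborel_affine[of "-1" c]) (auto simp: density_1 power_one)

lemma integral_reflect_at:
  fixes f :: "'a::euclidean_space \<Rightarrow> real"
  assumes [measurable]: "f \<in> borel_measurable borel"
  shows "(LBINT x. f (c - x)) = (LBINT x. f x)"
  by (subst (2) lborel_reflect_at[symmetric, of c]) (simp add: integral_distr)

lemma integrable_reflect_at:
  fixes f :: "'a::euclidean_space \<Rightarrow> real"
  assumes "integrable lborel f"
  shows "integrable lborel (\<lambda>x. f (c - x))"
proof -
  have "integrable (distr lborel borel (\<lambda>x. c - x)) f"
    unfolding lborel_reflect_at by fact
  then show ?thesis using assms by (subst (asm) integrable_distr_eq) auto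
qed

lemma integral_translate:
  fixes f :: "'a::euclidean_space \<Rightarrow> real"
  assumes [measurable]: "f \<in> borel_measurable borel"
  shows "(LBINT x. f (c + x)) = (LBINT x. f x)"
  by (subst (2) lborel_distr_plus[symmetric, of c]) (simp add: integral_distr)

lemma integrable_translate:
  fixes f :: "'a::euclidean_space \<Rightarrow> real"
  assumes "integrable lborel f"
  shows "integrable lborel (\<lambda>x. f (c + x))"
proof -
  have "integrable (distr lborel borel ((+) c)) f"
    unfolding lborel_distr_plus by fact
  then show ?thesis using assms by (subst (asm) integrable_distr_eq) auto
qed

definition lconv :: "('a::euclidean_space \<Rightarrow> real) \<Rightarrow> ('a \<Rightarrow> real) \<Rightarrow> 'a \<Rightarrow> real" where
  "lconv k G P = (LBINT Q. k (P - Q) * G Q)"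

lemma lconv_alt:
  assumes [measurable]: "k \<in> borel_measurable borel" "G \<in> borel_measurable borel"
  shows "lconv k G P = (LBINT Q. k Q * G (P - Q))"
  using integral_reflect_at[of "\<lambda>Q. k Q * G (P - Q)" P] by (simp add: lconv_def)

lemma lconv_translate:
  assumes [measurable]: "k \<in> borel_measurable borel" "G \<in> borel_measurable borel"
  shows "lconv k (\<lambda>Q. G (Q + c)) P = lconv k G (P + c)"
  by (simp add: lconv_alt algebra_simps)

lemma borel_measurable_lconv[measurable]:
  assumes [measurable]: "k \<in> borel_measurable borel" "G \<in> borel_measurable borel"
  shows "lconv k G \<in> borel_measurable borel"
proof -
  have "(\<lambda>P. LBINT Q. k (P - Q) * G Q) \<in> borel_measurable borel"
  proof (rule lborel.borel_measurable_lebesgue_integral)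
    show "(\<lambda>(P, Q). k (P - Q) * G Q) \<in> borel_measurable (borel \<Otimes>\<^sub>M lborel)"
      by measurable
  qed
  then show ?thesis unfolding lconv_def[abs_def] .
qed

lemma integrable_mult_bounded:
  fixes k G :: "'a::euclidean_space \<Rightarrow> real"
  assumes k: "integrable lborel k" and [measurable]: "G \<in> borel_measurable borel" and G: "\<And>Q. \<bar>G Q\<bar> \<le> C"
  shows "integrable lborel (\<lambda>Q. k Q * G Q)"
proof (rule Bochner_Integration.integrable_bound)
  show "integrable lborel (\<lambda>Q. C * k Q)" using k by simp
  have [measurable]: "k \<in> borel_measurable borel" using k by auto
  show "(\<lambda>Q. k Q * G Q) \<in> borel_measurable lborel" by measurable
  show "AE Q in lborel. norm (k Q * G Q) \<le> norm (C * k Q)"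
  proof (rule AE_I2)
    fix Q
    have "\<bar>G Q\<bar> \<le> \<bar>C\<bar>" using G[of Q] by linarith
    from mult_left_mono[OF this abs_ge_zero[of "k Q"]] show "norm (k Q * G Q) \<le> norm (C * k Q)"
      by (simp add: abs_mult mult.commute)
  qed
qed

lemma integrable_lconv:
  fixes k G :: "'a::euclidean_space \<Rightarrow> real"
  assumes "integrable lborel k" "G \<in> borel_measurable borel" "\<And>Q. \<bar>G Q\<bar> \<le> C"
  shows "integrable lborel (\<lambda>Q. k (P - Q) * G Q)"
  by (rule integrable_mult_bounded[OF integrable_reflect_at[OF assms(1)] assms(2,3)])

lemma lconv_bound:
  assumes k: "integrable lborel k" and G[measurable]: "G \<in> borel_measurable borel"
    and bd: "\<And>Q. \<bar>G Q\<bar> \<le> C"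
  shows "\<bar>lconv k G P\<bar> \<le> C * (LBINT Q. \<bar>k Q\<bar>)"
proof -
  have [measurable]: "k \<in> borel_measurable borel" using k by auto
  have "\<bar>lconv k G P\<bar> \<le> (LBINT Q. \<bar>k (P - Q) * G Q\<bar>)"
    unfolding lconv_def by (rule integral_abs_bound)
  also have "\<dots> \<le> (LBINT Q. C * \<bar>k (P - Q)\<bar>)"
  proof (rule integral_mono)
    show "integrable lborel (\<lambda>Q. \<bar>k (P - Q) * G Q\<bar>)"
      by (intro integrable_abs integrable_lconv[OF assms])
    show "integrable lborel (\<lambda>Q. C * \<bar>k (P - Q)\<bar>)"
      by (intro integrable_mult_right integrable_abs integrable_reflect_at k)
    show "\<bar>k (P - Q) * G Q\<bar> \<le> C * \<bar>k (P - Q)\<bar>" for Q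
      using bd[of Q] by (simp add: abs_mult mult.commute[of C] mult_left_mono)
  qed
  also have "\<dots> = C * (LBINT Q. \<bar>k Q\<bar>)"
    by (simp add: integral_reflect_at[of "\<lambda>Q. \<bar>k Q\<bar>"])
  finally show ?thesis .
qed

definition L1_modulus :: "('a::euclidean_space \<Rightarrow> real) \<Rightarrow> 'a \<Rightarrow> real" where
  "L1_modulus k v = (LBINT Q. \<bar>k (v + Q) - k Q\<bar>)"

text \<open>Translates of \<open>k\<close> converge to \<open>k\<close> almost everywhere by
  continuity and have the same L1 norm, so Scheffe's lemma gives convergence in L1. Approximation by
  continuous functions of compact support is thereby avoided.\<close>

lemma L1_modulus_tendsto_0:
  assumes k: "integrable lborel k" and cont: "AE Q in lborel. isCont k Q"
  shows "L1_modulus k \<midarrow>0\<rightarrow> 0"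
  unfolding tendsto_at_iff_sequentially
proof (intro allI impI)
  fix X :: "nat \<Rightarrow> 'a" assume X: "X \<longlonglongrightarrow> 0"
  have [measurable]: "k \<in> borel_measurable borel" using k by auto
  have "(\<lambda>n. \<integral>\<^sup>+ Q. ennreal (norm (k (X n + Q) - k Q)) \<partial>lborel) \<longlonglongrightarrow> 0"
  proof (rule Scheffe_lemma2)
    show "AE Q in lborel. (\<lambda>n. k (X n + Q)) \<longlonglongrightarrow> k Q"
      using cont
    proof eventually_elim
      case (elim Q)
      have "(\<lambda>n. X n + Q) \<longlonglongrightarrow> 0 + Q" by (intro tendsto_intros X)
      then show ?case using isCont_tendsto_compose[OF elim] by simp
    qed
    show "(\<integral>\<^sup>+ Q. ennreal (norm (k (X n + Q))) \<partial>lborel) \<le> (\<integral>\<^sup>+ Q. ennreal (norm (k Q)) \<partial>lborel)" for n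
      by (subst (2) lborel_distr_plus[symmetric, of "X n"]) (simp add: nn_integral_distr)
  qed (use k in auto)
  then have "(\<lambda>n. enn2real (\<integral>\<^sup>+ Q. ennreal (norm (k (X n + Q) - k Q)) \<partial>lborel)) \<longlonglongrightarrow> 0"
    by (intro tendsto_enn2real) simp_all
  moreover have "enn2real (\<integral>\<^sup>+ Q. ennreal (norm (k (X n + Q) - k Q)) \<partial>lborel) = L1_modulus k (X n)" for n
    unfolding L1_modulus_def by (subst integral_eq_nn_integral) auto
  ultimately show "(L1_modulus k \<circ> X) \<longlonglongrightarrow> 0" by (simp add: o_def)
qed

lemma lconv_diff_bound:
  assumes k: "integrable lborel k" and G[measurable]: "G \<in> borel_measurable borel"
    and bd: "\<And>Q. \<bar>G Q\<bar> \<le> C"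
  shows "\<bar>lconv k G P - lconv k G P'\<bar> \<le> C * L1_modulus k (P - P')"
proof -
  have [measurable]: "k \<in> borel_measurable borel" using k by auto
  have i: "integrable lborel (\<lambda>Q. k (P - Q) - k (P' - Q))"
    using integrable_reflect_at[OF k] by auto
  have "lconv k G P - lconv k G P' = (LBINT Q. (k (P - Q) - k (P' - Q)) * G Q)"
    unfolding lconv_def
    by (subst Bochner_Integration.integral_diff[symmetric])
       (auto intro!: integrable_lconv k bd simp: left_diff_distrib)
  also have "\<bar>\<dots>\<bar> \<le> (LBINT Q. \<bar>(k (P - Q) - k (P' - Q)) * G Q\<bar>)"
    by (rule integral_abs_bound)
  also have "\<dots> \<le> (LBINT Q. C * \<bar>k (P - Q) - k (P' - Q)\<bar>)"
  proof (rule integral_mono)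
    show "integrable lborel (\<lambda>Q. \<bar>(k (P - Q) - k (P' - Q)) * G Q\<bar>)"
      using integrable_lconv[OF k G bd, of P] integrable_lconv[OF k G bd, of P']
      by (simp add: left_diff_distrib)
  qed (use i bd in \<open>auto simp: abs_mult mult.commute[of C] intro!: mult_left_mono\<close>)
  also have "\<dots> = C * (LBINT Q. \<bar>k (P - Q) - k (P' - Q)\<bar>)" by simp
  also have "(LBINT Q. \<bar>k (P - Q) - k (P' - Q)\<bar>) = L1_modulus k (P - P')"
    using integral_reflect_at[of "\<lambda>Q. \<bar>k (P - P' + Q) - k Q\<bar>" P'] unfolding L1_modulus_def by simp
  finally show ?thesis .
qed

text \<open>The point is the order of the quantifiers: \<open>d\<close> depends on the kernel and on
  the bound \<open>C\<close>, not on \<open>G\<close>. This provides the common modulus of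
  continuity for all delays.\<close>

lemma equicontinuous_lconv:
  fixes k :: "'a::euclidean_space \<Rightarrow> real"
  assumes k: "integrable lborel k" and cont: "AE Q in lborel. isCont k Q" and "e > 0" "C > 0"
  obtains d where "d > 0"
    "\<And>(G :: 'a \<Rightarrow> real) P P'. G \<in> borel_measurable borel \<Longrightarrow> (\<And>Q. \<bar>G Q\<bar> \<le> C) \<Longrightarrow> dist P P' < d \<Longrightarrow>
       \<bar>lconv k G P - lconv k G P'\<bar> < e"
proof -
  from L1_modulus_tendsto_0[OF k cont] \<open>e > 0\<close> \<open>C > 0\<close> obtain d where d: "d > 0"
    "\<And>v. v \<noteq> 0 \<Longrightarrow> norm v < d \<Longrightarrow> \<bar>L1_modulus k v\<bar> < e / C"
    unfolding LIM_eq by (metis divide_pos_pos diff_zero real_norm_def)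
  show thesis
  proof (rule that[OF d(1)])
    fix G :: "'a \<Rightarrow> real" and P P' :: 'a assume G: "G \<in> borel_measurable borel" "\<And>Q. \<bar>G Q\<bar> \<le> C" and "dist P P' < d"
    show "\<bar>lconv k G P - lconv k G P'\<bar> < e"
    proof (cases "P = P'")
      case False
      have "\<bar>lconv k G P - lconv k G P'\<bar> \<le> C * L1_modulus k (P - P')"
        by (rule lconv_diff_bound[OF k G])
      also have "\<dots> < C * (e / C)"
        using d(2)[of "P - P'"] False \<open>dist P P' < d\<close> \<open>C > 0\<close>
        by (intro mult_strict_left_mono) (auto simp: dist_norm)
      finally show ?thesis using \<open>C > 0\<close> by simp
    qed (use \<open>e > 0\<close> in simp)
  qed
qed

lemma continuous_lconv:
  assumes k: "integrable lborel k" and cont: "AE Q in lborel. isCont k Q"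
    and G: "G \<in> borel_measurable borel" "\<And>Q. \<bar>G Q\<bar> \<le> C"
  shows "continuous_on UNIV (lconv k G)"
proof -
  \<comment> \<open>The equicontinuity lemma divides by the bound and requires it to be
    positive.\<close>
  have "\<And>Q. \<bar>G Q\<bar> \<le> max C 1" using G(2) by (meson max.coboundedI1)
  moreover have "max C 1 > 0" by simp
  ultimately have "\<exists>d>0. \<forall>P'. dist P' P < d \<longrightarrow> dist (lconv k G P') (lconv k G P) < e" if "e > 0" for P e
    using equicontinuous_lconv[OF k cont that] G(1) unfolding dist_real_def by metis
  then show ?thesis unfolding continuous_on_iff by auto
qed

section \<open>The kernel of d_t - d_xx + 1, causal by its value 0 up to time 0, and its
  x-derivative\<close>

definition hk :: "real \<times> real \<Rightarrow> real" where
  "hk Q = (if snd Q > 0 then exp (- snd Q) * normal_density 0 (sqrt (2 * snd Q)) (fst Q) else 0)"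

definition hkx :: "real \<times> real \<Rightarrow> real" where
  "hkx Q = - (fst Q / (2 * snd Q)) * hk Q"

lemma hk_nonneg: "0 \<le> hk Q" by (simp add: hk_def)

lemma hk_eq_0: "snd Q \<le> 0 \<Longrightarrow> hk Q = 0" by (simp add: hk_def)

lemma hkx_eq_0: "snd Q \<le> 0 \<Longrightarrow> hkx Q = 0" by (simp add: hkx_def hk_eq_0)

lemma hk_even: "hk (- x, t) = hk (x, t)" by (simp add: hk_def normal_density_def)

lemma hk_measurable[measurable]: "hk \<in> borel_measurable borel"
  unfolding hk_def[abs_def] normal_density_def borel_prod[symmetric] by measurable

lemma hkx_measurable[measurable]: "hkx \<in> borel_measurable borel"
  unfolding hkx_def[abs_def] borel_prod[symmetric]
  using hk_measurable unfolding borel_prod[symmetric] by measurable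

text \<open>The line of time 0 is a null set, so continuity off it is enough for the L1 continuity
  of translations.\<close>

lemma isCont_hk:
  assumes "snd Q \<noteq> 0"
  shows "isCont hk Q" "isCont hkx Q"
proof -
  have "isCont hk Q \<and> isCont hkx Q"
  proof (cases "snd Q > 0")
    case True
    have "open {Q :: real \<times> real. snd Q > 0}" by (intro open_Collect_less continuous_intros)
    with True have ev: "\<forall>\<^sub>F Q in nhds Q. snd Q > 0"
      by (auto simp: eventually_nhds intro!: exI[of _ "{Q. snd Q > 0}"])
    let ?f = "\<lambda>Q :: real \<times> real. exp (- snd Q) *
       (1 / sqrt (2 * pi * (2 * snd Q)) * exp (- (fst Q)\<^sup>2 / (2 * (2 * snd Q))))"
    have e1: "\<forall>\<^sub>F Q in nhds Q. hk Q = ?f Q"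
      using ev by eventually_elim (simp add: hk_def normal_density_def)
    have e2: "\<forall>\<^sub>F Q in nhds Q. hkx Q = - (fst Q / (2 * snd Q)) * ?f Q"
      using e1 by eventually_elim (simp add: hkx_def)
    have "isCont ?f Q" "isCont (\<lambda>Q. - (fst Q / (2 * snd Q)) * ?f Q) Q"
      using True by (intro continuous_intros; simp)+
    then show ?thesis using isCont_cong[OF e1] isCont_cong[OF e2] by simp
  next
    case False
    have "open {Q :: real \<times> real. snd Q < 0}" by (intro open_Collect_less continuous_intros)
    with False assms have ev: "\<forall>\<^sub>F Q in nhds Q. snd Q < 0"
      by (auto simp: eventually_nhds intro!: exI[of _ "{Q. snd Q < 0}"])
    have e1: "\<forall>\<^sub>F Q in nhds Q. hk Q = 0"
      using ev by eventually_elim (simp add: hk_eq_0)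
    have e2: "\<forall>\<^sub>F Q in nhds Q. hkx Q = 0"
      using ev by eventually_elim (simp add: hkx_eq_0)
    show ?thesis using isCont_cong[OF e1] isCont_cong[OF e2] by simp
  qed
  then show "isCont hk Q" "isCont hkx Q" by auto
qed

lemma AE_snd_neq_0: "AE Q in (lborel :: (real \<times> real) measure). snd Q \<noteq> 0"
proof -
  have eq: "{Q :: real \<times> real. snd Q = 0} = {Q. (0, 1) \<bullet> Q = 0}" by (auto simp: inner_prod_def)
  have "negligible {Q :: real \<times> real. snd Q = 0}"
    unfolding eq by (rule negligible_hyperplane) (simp add: zero_prod_def)
  then have "{Q :: real \<times> real. snd Q = 0} \<in> null_sets lebesgue"
    by (simp only: negligible_iff_null_sets)
  then have "AE Q in (lebesgue :: (real \<times> real) measure). Q \<notin> {Q. snd Q = 0}"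
    by (rule AE_not_in)
  then have "AE Q in (lborel :: (real \<times> real) measure). Q \<notin> {Q. snd Q = 0}"
    by (simp only: AE_completion_iff)
  then show ?thesis by simp
qed

lemma AE_isCont_hk: "AE Q in lborel. isCont hk Q" and AE_isCont_hkx: "AE Q in lborel. isCont hkx Q"
  using AE_snd_neq_0 by (eventually_elim, simp add: isCont_hk)+

lemma nn_integral_lborel_prod:
  fixes f :: "real \<times> real \<Rightarrow> ennreal"
  assumes "f \<in> borel_measurable borel"
  shows "(\<integral>\<^sup>+ Q. f Q \<partial>lborel) = (\<integral>\<^sup>+ t. (\<integral>\<^sup>+ x. f (x, t) \<partial>lborel) \<partial>lborel)"
  using lborel_pair.nn_integral_snd[of f] assms by (simp add: lborel_prod)

lemma nn_integral_hk: "(\<integral>\<^sup>+ Q. ennreal (hk Q) \<partial>lborel) = 1"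
proof -
  \<comment> \<open>The factor \<open>t ^ 0\<close> brings the integrand into the form of the known
    integral of a power times an exponential.\<close>
  have "(\<integral>\<^sup>+ x. ennreal (hk (x, t)) \<partial>lborel) = ennreal (t ^ 0 * exp (- t)) * indicator {0..} t" if "t \<noteq> 0" for t
  proof (cases "t > 0")
    case True
    have "(\<integral>\<^sup>+ x. ennreal (hk (x, t)) \<partial>lborel)
      = (\<integral>\<^sup>+ x. ennreal (exp (- t)) * ennreal (normal_density 0 (sqrt (2 * t)) x) \<partial>lborel)"
      using True by (simp add: hk_def ennreal_mult')
    also have "\<dots> = ennreal (exp (- t)) * (\<integral>\<^sup>+ x. ennreal (normal_density 0 (sqrt (2 * t)) x) \<partial>lborel)"
      by (rule nn_integral_cmult) simp
    also have "(\<integral>\<^sup>+ x. ennreal (normal_density 0 (sqrt (2 * t)) x) \<partial>lborel) = ennreal 1"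
      using True by (subst nn_integral_eq_integral) auto
    finally show ?thesis using True by simp
  qed (use that in \<open>simp add: hk_def\<close>)
  moreover have "AE t in (lborel :: real measure). t \<noteq> 0" by (rule AE_lborel_singleton)
  ultimately have "(\<integral>\<^sup>+ Q. ennreal (hk Q) \<partial>lborel)
     = (\<integral>\<^sup>+ t. ennreal (t ^ 0 * exp (- t)) * indicator {0..} t \<partial>lborel)"
    by (subst nn_integral_lborel_prod) (auto intro!: nn_integral_cong_AE)
  also have "\<dots> = 1" by (subst nn_intergal_power_times_exp_Ici) simp
  finally show ?thesis .
qed

lemma integrable_hk: "integrable lborel hk"
  by (rule integrableI_bounded) (simp_all add: hk_nonneg nn_integral_hk)

text \<open>At time t the integral of the absolute value over x is exp (- t) / sqrt (pi t), by the
  first absolute moment of the normal distribution. Dropping 1 / sqrt pi leaves the integrand of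
  Gamma (1/2), so the singularity at time 0 is integrable.\<close>

lemma integrable_hkx: "integrable lborel hkx"
proof (rule integrableI_bounded)
  have "(\<integral>\<^sup>+ x. ennreal (norm (hkx (x, t))) \<partial>lborel) \<le> ennreal (t powr (1/2 - 1) / exp t) * indicator {0..} t" if "t \<noteq> 0" for t
  proof (cases "t > 0")
    case True
    let ?s = "sqrt (2 * t)"
    have s: "?s > 0" using True by simp
    have hb: "has_bochner_integral lborel (\<lambda>x. normal_density 0 ?s x * \<bar>x\<bar>) (?s * sqrt (2 / pi))"
      using normal_moment_abs_odd[OF s, of 0 0] by simp
    have "(\<integral>\<^sup>+ x. ennreal (norm (hkx (x, t))) \<partial>lborel)
      = (\<integral>\<^sup>+ x. ennreal (exp (- t) / (2 * t)) * ennreal (normal_density 0 ?s x * \<bar>x\<bar>) \<partial>lborel)"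
      using True by (intro nn_integral_cong)
        (simp add: hkx_def hk_def abs_mult ennreal_mult'[symmetric] mult_ac)
    also have "\<dots> = ennreal (exp (- t) / (2 * t)) * (\<integral>\<^sup>+ x. ennreal (normal_density 0 ?s x * \<bar>x\<bar>) \<partial>lborel)"
      by (rule nn_integral_cmult) simp
    also have "(\<integral>\<^sup>+ x. ennreal (normal_density 0 ?s x * \<bar>x\<bar>) \<partial>lborel) = ennreal (?s * sqrt (2 / pi))"
      using hb by (subst nn_integral_eq_integral) (auto simp: has_bochner_integral_iff)
    also have "ennreal (exp (- t) / (2 * t)) * ennreal (?s * sqrt (2 / pi))
        = ennreal (exp (- t) / (2 * t) * (?s * sqrt (2 / pi)))"
      using True by (subst ennreal_mult') auto
    finally have I: "(\<integral>\<^sup>+ x. ennreal (norm (hkx (x, t))) \<partial>lborel)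
        = ennreal (exp (- t) / (2 * t) * (?s * sqrt (2 / pi)))" .
    have "exp (- t) / (2 * t) * (?s * sqrt (2 / pi)) \<le> exp (- t) / (2 * t) * (?s * sqrt 2)"
      using True pi_gt3 by (intro mult_left_mono) (auto simp: divide_simps)
    also have "\<dots> = exp (- t) * (sqrt t / t)"
      using True by (simp add: real_sqrt_mult divide_simps)
    also have "sqrt t / t = t powr (1/2 - 1)"
    proof -
      have "t powr (1/2 - 1) = inverse (sqrt t)"
        using True powr_minus[of t "1/2"] by (simp add: powr_half_sqrt)
      also have "\<dots> = sqrt t / (sqrt t * sqrt t)" using True by (simp add: divide_simps)
      finally show ?thesis using True by simp
    qed
    also have "exp (- t) * t powr (1/2 - 1) = t powr (1/2 - 1) / exp t"
      by (simp only: exp_minus divide_inverse mult.commute)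
    finally have le: "exp (- t) / (2 * t) * (?s * sqrt (2 / pi)) \<le> t powr (1/2 - 1) / exp t" .
    have "indicator {0..} t = (1 :: ennreal)" using True by simp
    then show ?thesis unfolding I by (metis ennreal_leI le mult.right_neutral)
  qed (use that in \<open>simp add: hkx_def hk_def\<close>)
  moreover have "AE t in (lborel :: real measure). t \<noteq> 0" by (rule AE_lborel_singleton)
  ultimately have "(\<integral>\<^sup>+ Q. ennreal (norm (hkx Q)) \<partial>lborel)
     \<le> (\<integral>\<^sup>+ t. ennreal (t powr (1/2 - 1) / exp t) * indicator {0..} t \<partial>lborel)"
    by (subst nn_integral_lborel_prod) (auto intro!: nn_integral_mono_AE)
  also have "\<dots> = ennreal (Gamma (1/2))"
    by (rule nn_integral_has_integral_lebesgue'[OF _ Gamma_integral_real]) auto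
  finally show "(\<integral>\<^sup>+ Q. ennreal (norm (hkx Q)) \<partial>lborel) < \<infinity>"
    by (simp add: le_less_trans)
qed measurable

section \<open>The function \<open>psi\<close>\<close>

text \<open>As a tail of the normal law of variance 2 t, \<open>erfc\<close> becomes accessible to
  the convolution rule for normal densities.\<close>

lemma erfc_eq_normal_tail:
  assumes "t > 0"
  shows "erfc (x / (2 * sqrt t)) = 2 * (LBINT y. indicator {x..} y * normal_density 0 (sqrt (2 * t)) y)"
proof -
  let ?f = "\<lambda>s. indicator {x / (2 * sqrt t)..} s * exp (- s\<^sup>2) :: real"
  have "(LINT s:{x / (2 * sqrt t)..}|lebesgue. exp (- s\<^sup>2)) = (LBINT s. ?f s)"
    unfolding set_lebesgue_integral_def real_scaleR_def by (rule integral_completion) measurable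
  also have "\<dots> = \<bar>1 / (2 * sqrt t)\<bar> *\<^sub>R (LBINT y. ?f (0 + 1 / (2 * sqrt t) * y))"
    using assms by (intro lborel_integral_real_affine) simp
  also have "(LBINT y. ?f (0 + 1 / (2 * sqrt t) * y))
     = (LBINT y. sqrt (4 * pi * t) * (indicator {x..} y * normal_density 0 (sqrt (2 * t)) y))"
  proof (rule Bochner_Integration.integral_cong)
    fix y
    have "(1 / (2 * sqrt t) * y)\<^sup>2 = y\<^sup>2 / (4 * t)"
      using assms by (simp add: power_divide power_mult_distrib)
    moreover have "x / (2 * sqrt t) \<le> 1 / (2 * sqrt t) * y \<longleftrightarrow> x \<le> y"
      using assms by (simp add: divide_simps)
    ultimately show "?f (0 + 1 / (2 * sqrt t) * y)
        = sqrt (4 * pi * t) * (indicator {x..} y * normal_density 0 (sqrt (2 * t)) y)"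
      using assms by (simp add: normal_density_def indicator_def mult_ac)
  qed simp
  finally show ?thesis
    using assms by (simp add: erfc_def real_sqrt_mult divide_simps)
qed

lemma erfc_eq_normal_tail': "erfc x = 2 * (LBINT y. indicator {x..} y * normal_density 0 (sqrt (1/2)) y)"
  using erfc_eq_normal_tail[of "1/4" x] by (simp add: real_sqrt_divide)

lemma integrable_normal_tail: "s > 0 \<Longrightarrow> integrable lborel (\<lambda>y. indicator {x..} y * normal_density 0 s y)"
  by (rule integrable_mult_indicator[of _ lborel "normal_density 0 s", unfolded real_scaleR_def]) auto

lemma erfc_nonneg: "0 \<le> erfc x"
  unfolding erfc_eq_normal_tail' by (auto intro!: Bochner_Integration.integral_nonneg)

lemma erfc_antimono: "x \<le> y \<Longrightarrow> erfc y \<le> erfc x"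
  unfolding erfc_eq_normal_tail'
  by (intro mult_left_mono integral_mono integrable_normal_tail) (auto split: split_indicator)

lemma isCont_erfc: "isCont erfc x"
  unfolding isCont_def tendsto_at_iff_sequentially
proof (intro allI impI)
  fix X :: "nat \<Rightarrow> real" assume X: "X \<longlonglongrightarrow> x"
  have "(\<lambda>n. LBINT y. indicator {X n..} y * normal_density 0 (sqrt (1/2)) y)
     \<longlonglongrightarrow> (LBINT y. indicator {x..} y * normal_density 0 (sqrt (1/2)) y)"
  proof (rule integral_dominated_convergence[where w = "normal_density 0 (sqrt (1/2))"])
    show "AE y in lborel. (\<lambda>n. indicator {X n..} y * normal_density 0 (sqrt (1/2)) y)
        \<longlonglongrightarrow> indicator {x..} y * normal_density 0 (sqrt (1/2)) y"
      using AE_lborel_singleton[of x]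
    proof eventually_elim
      case (elim y)
      have "\<forall>\<^sub>F n in sequentially. indicator {X n..} y = (indicator {x..} y :: real)"
      proof (cases "x < y")
        case True
        show ?thesis using order_tendstoD(2)[OF X True] by eventually_elim (use True in simp)
      next
        case False
        with elim have "y < x" by simp
        show ?thesis using order_tendstoD(1)[OF X \<open>y < x\<close>] by eventually_elim (use \<open>y < x\<close> in simp)
      qed
      then show ?case by (intro tendsto_mult tendsto_const tendsto_eventually)
    qed
    show "AE y in lborel. norm (indicator {X n..} y * normal_density 0 (sqrt (1/2)) y) \<le> normal_density 0 (sqrt (1/2)) y" for n
      by (auto split: split_indicator)
  qed auto
  from tendsto_mult_left[OF this, of 2] show "(erfc \<circ> X) \<longlonglongrightarrow> erfc x"
    unfolding o_def erfc_eq_normal_tail' .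
qed

text \<open>The similarity solution erfc (x / (2 sqrt s)) is propagated by the heat semigroup. After
  exchanging the integrals, the variances 2 s and 2 \<tau> add up.\<close>

lemma nn_integral_erfc_normal:
  assumes "s > 0" "\<tau> > 0"
  shows "(\<integral>\<^sup>+ z. ennreal (erfc ((x - z) / (2 * sqrt s))) * ennreal (normal_density 0 (sqrt (2 * \<tau>)) z) \<partial>lborel)
     = ennreal (erfc (x / (2 * sqrt (s + \<tau>))))"
proof -
  let ?N = "\<lambda>s. normal_density 0 (sqrt (2 * s))"
  have tail: "ennreal (erfc (x / (2 * sqrt s))) = 2 * (\<integral>\<^sup>+ y. indicator {x..} y * ennreal (?N s y) \<partial>lborel)"
    if "s > 0" for x s :: real
  proof -
    have "(\<integral>\<^sup>+ y. indicator {x..} y * ennreal (?N s y) \<partial>lborel)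
       = (\<integral>\<^sup>+ y. ennreal (indicator {x..} y * ?N s y) \<partial>lborel)"
      by (intro nn_integral_cong) (auto split: split_indicator)
    also have "\<dots> = ennreal (LBINT y. indicator {x..} y * ?N s y)"
      using that by (intro nn_integral_eq_integral integrable_normal_tail) simp_all
    finally have *: "(\<integral>\<^sup>+ y. indicator {x..} y * ennreal (?N s y) \<partial>lborel)
       = ennreal (LBINT y. indicator {x..} y * ?N s y)" .
    have "ennreal (erfc (x / (2 * sqrt s))) = ennreal 2 * ennreal (LBINT y. indicator {x..} y * ?N s y)"
      unfolding erfc_eq_normal_tail[OF that] by (rule ennreal_mult') simp
    then show ?thesis unfolding * by simp
  qed
  have shift: "(\<integral>\<^sup>+ y. indicator {x - z..} y * ennreal (?N s y) \<partial>lborel)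
      = (\<integral>\<^sup>+ y. indicator {x..} y * ennreal (?N s (y - z)) \<partial>lborel)" for z
    by (subst lborel_distr_plus[symmetric, of "- z"])
       (auto simp: nn_integral_distr indicator_def algebra_simps intro!: nn_integral_cong)
  have "(\<integral>\<^sup>+ z. ennreal (erfc ((x - z) / (2 * sqrt s))) * ennreal (?N \<tau> z) \<partial>lborel)
     = (\<integral>\<^sup>+ z. (\<integral>\<^sup>+ y. 2 * (indicator {x..} y * (ennreal (?N s (y - z)) * ennreal (?N \<tau> z))) \<partial>lborel) \<partial>lborel)"
    unfolding tail[OF assms(1)] shift
    by (intro nn_integral_cong) (simp add: nn_integral_cmult nn_integral_multc mult_ac flip: nn_integral_cmult nn_integral_multc)
  also have "\<dots> = (\<integral>\<^sup>+ y. (\<integral>\<^sup>+ z. 2 * (indicator {x..} y * (ennreal (?N s (y - z)) * ennreal (?N \<tau> z))) \<partial>lborel) \<partial>lborel)"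
    by (intro lborel_pair.Fubini') measurable
  also have "\<dots> = (\<integral>\<^sup>+ y. 2 * (indicator {x..} y * (\<integral>\<^sup>+ z. ennreal (?N s (y - z) * ?N \<tau> z) \<partial>lborel)) \<partial>lborel)"
    by (intro nn_integral_cong) (simp add: nn_integral_cmult ennreal_mult')
  also have "\<dots> = (\<integral>\<^sup>+ y. 2 * (indicator {x..} y * ennreal (?N (s + \<tau>) y)) \<partial>lborel)"
  proof -
    have "(\<integral>\<^sup>+ z. ennreal (?N s (y - z) * ?N \<tau> z) \<partial>lborel) = ennreal (?N (s + \<tau>) y)" for y
      using fun_cong[OF conv_normal_density_zero_mean[of "sqrt (2 * s)" "sqrt (2 * \<tau>)"], of y] assms
      by (simp add: algebra_simps)
    then show ?thesis by simp
  qed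
  also have "\<dots> = 2 * (\<integral>\<^sup>+ y. indicator {x..} y * ennreal (?N (s + \<tau>) y) \<partial>lborel)"
    by (rule nn_integral_cmult) simp
  also have "\<dots> = ennreal (erfc (x / (2 * sqrt (s + \<tau>))))"
    using assms by (intro tail[symmetric]) simp
  finally show ?thesis .
qed

section \<open>The barrier \<open>\<psi>\<close>: bounds, monotonicity, continuity and
  supercaloricity\<close>

locale hhmo =
  fixes \<alpha> \<beta> ustar :: real
  assumes alpha_pos: "\<alpha> > 0" and beta_pos: "\<beta> > 0" and ustar_pos: "ustar > 0"
begin

definition psi_amp :: real where "psi_amp = \<alpha> * \<beta> * sqrt pi / 2 * exp (\<alpha>\<^sup>2 / 4)"

definition psi_max :: real where "psi_max = psi_amp * erfc (\<alpha> / 2)"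

definition \<psi> :: "real \<times> real \<Rightarrow> real" where "\<psi> Q = psi \<alpha> \<beta> (fst Q) (snd Q)"

lemma psi_amp_pos: "psi_amp > 0"
  using alpha_pos beta_pos by (simp add: psi_amp_def)

lemma psi_max_nonneg: "0 \<le> psi_max"
  using psi_amp_pos by (simp add: psi_max_def erfc_nonneg)

text \<open>With the maximum moved inside the antitone function \<open>erfc\<close> there is no case
  distinction left, and monotonicity in time, continuity and the upper bound can be read
  off.\<close>

lemma \<psi>_eq: "t > 0 \<Longrightarrow> \<psi> (x, t) = psi_amp * erfc (max (\<alpha> / 2) (\<bar>x\<bar> / (2 * sqrt t)))"
proof (cases "\<bar>x\<bar> / sqrt t \<le> \<alpha>")
  case True
  then have "max (\<alpha> / 2) (\<bar>x\<bar> / (2 * sqrt t)) = \<alpha> / 2" by simp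
  moreover assume "t > 0"
  ultimately show ?thesis using True by (simp add: \<psi>_def psi_def Psi_def psi_amp_def)
next
  case False
  then have "max (\<alpha> / 2) (\<bar>x\<bar> / (2 * sqrt t)) = \<bar>x\<bar> / sqrt t / 2" by simp
  moreover assume "t > 0"
  ultimately show ?thesis using False by (simp add: \<psi>_def psi_def Psi_def psi_amp_def mult.commute)
qed

lemma \<psi>_eq_0: "t \<le> 0 \<Longrightarrow> \<psi> (x, t) = 0"
  by (simp add: \<psi>_def psi_def)

lemma \<psi>_nonneg: "0 \<le> \<psi> Q"
  using psi_amp_pos \<psi>_eq[of "snd Q" "fst Q"] \<psi>_eq_0[of "snd Q" "fst Q"]
  by (cases "snd Q > 0") (simp_all add: erfc_nonneg)

lemma \<psi>_le: "\<psi> Q \<le> psi_max"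
proof (cases "snd Q > 0")
  case True
  then show ?thesis
    using psi_amp_pos \<psi>_eq[of "snd Q" "fst Q"] by (simp add: psi_max_def erfc_antimono)
next
  case False
  then show ?thesis using \<psi>_eq_0[of "snd Q" "fst Q"] psi_max_nonneg by simp
qed

lemma \<psi>_even: "\<psi> (- x, t) = \<psi> (x, t)"
  by (simp add: \<psi>_def psi_def)

lemma \<psi>_mono: assumes "s \<le> t" shows "\<psi> (x, s) \<le> \<psi> (x, t)"
proof (cases "s > 0")
  case True
  have "\<bar>x\<bar> / (2 * sqrt t) \<le> \<bar>x\<bar> / (2 * sqrt s)"
    using assms True by (intro divide_left_mono) auto
  then have "erfc (max (\<alpha> / 2) (\<bar>x\<bar> / (2 * sqrt s))) \<le> erfc (max (\<alpha> / 2) (\<bar>x\<bar> / (2 * sqrt t)))"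
    by (intro erfc_antimono) auto
  then show ?thesis using True assms psi_amp_pos by (simp add: \<psi>_eq)
qed (use \<psi>_eq_0 \<psi>_nonneg in auto)

lemma \<psi>_const: assumes "x\<^sup>2 / \<alpha>\<^sup>2 \<le> t" "t > 0" shows "\<psi> (x, t) = psi_max"
proof -
  have "x\<^sup>2 \<le> t * \<alpha>\<^sup>2" using assms alpha_pos by (simp add: divide_simps)
  then have "\<bar>x\<bar> \<le> sqrt (t * \<alpha>\<^sup>2)" using real_le_rsqrt by fastforce
  then have "\<bar>x\<bar> / (2 * sqrt t) \<le> \<alpha> / 2"
    using assms alpha_pos by (simp add: real_sqrt_mult divide_simps mult.commute)
  then show ?thesis using assms by (simp add: \<psi>_eq psi_max_def max_absorb1)
qed

lemma isCont_\<psi>: assumes "snd Q > 0" shows "isCont \<psi> Q"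
proof -
  have "open {Q :: real \<times> real. snd Q > 0}" by (intro open_Collect_less continuous_intros)
  with assms have "\<forall>\<^sub>F Q in nhds Q. snd Q > 0"
    by (auto simp: eventually_nhds intro!: exI[of _ "{Q. snd Q > 0}"])
  then have ev: "\<forall>\<^sub>F Q in nhds Q. \<psi> Q = psi_amp * erfc (max (\<alpha> / 2) (\<bar>fst Q\<bar> / (2 * sqrt (snd Q))))"
    by eventually_elim (metis \<psi>_eq prod.collapse)
  have "isCont (\<lambda>Q :: real \<times> real. max (\<alpha> / 2) (\<bar>fst Q\<bar> / (2 * sqrt (snd Q)))) Q"
    using assms by (intro continuous_intros) auto
  then have "isCont (\<lambda>Q. erfc (max (\<alpha> / 2) (\<bar>fst Q\<bar> / (2 * sqrt (snd Q))))) Q"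
    by (rule isCont_o2) (rule isCont_erfc)
  then show ?thesis using isCont_cong[OF ev] by (simp add: continuous_intros)
qed

lemma \<psi>_measurable[measurable]: "\<psi> \<in> borel_measurable borel"
proof -
  have [measurable]: "erfc \<in> borel_measurable borel"
    by (intro borel_measurable_continuous_onI continuous_at_imp_continuous_on) (simp add: isCont_erfc)
  have "\<psi> = (\<lambda>Q. if snd Q > 0 then psi_amp * erfc (max (\<alpha> / 2) (\<bar>fst Q\<bar> / (2 * sqrt (snd Q)))) else 0)"
    using \<psi>_eq \<psi>_eq_0 by (intro ext) (metis (no_types, lifting) not_less prod.collapse)
  also have "\<dots> \<in> borel_measurable borel"
    unfolding borel_prod[symmetric] by measurable
  finally show ?thesis .
qed

text \<open>\<open>\<psi>\<close> is the minimum of three solutions of the heat equation: the constant \<open>psi_max\<close> and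
  \<open>psi_amp * erfc (\<plusminus> x / (2 * sqrt t))\<close>.\<close>

lemma \<psi>_supercaloric:
  assumes "s > 0" "\<tau> > 0"
  shows "(\<integral>\<^sup>+ z. ennreal (\<psi> (x - z, s)) * ennreal (normal_density 0 (sqrt (2 * \<tau>)) z) \<partial>lborel) \<le> ennreal (\<psi> (x, s + \<tau>))"
    (is "?I \<le> _")
proof -
  let ?N = "normal_density 0 (sqrt (2 * \<tau>))"
  have b1: "?I \<le> ennreal psi_max"
  proof -
    have "?I \<le> (\<integral>\<^sup>+ z. ennreal psi_max * ennreal (?N z) \<partial>lborel)"
      by (intro nn_integral_mono mult_right_mono ennreal_leI \<psi>_le) simp
    also have "\<dots> = ennreal psi_max * (\<integral>\<^sup>+ z. ennreal (?N z) \<partial>lborel)"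
      by (rule nn_integral_cmult) simp
    also have "(\<integral>\<^sup>+ z. ennreal (?N z) \<partial>lborel) = ennreal 1"
      using assms by (subst nn_integral_eq_integral) auto
    finally show ?thesis by simp
  qed
  have b2: "(\<integral>\<^sup>+ z. ennreal (psi_amp * erfc ((y - z) / (2 * sqrt s))) * ennreal (?N z) \<partial>lborel)
      = ennreal (psi_amp * erfc (y / (2 * sqrt (s + \<tau>))))" for y
  proof -
    have [measurable]: "erfc \<in> borel_measurable borel"
      by (intro borel_measurable_continuous_onI continuous_at_imp_continuous_on) (simp add: isCont_erfc)
    have "(\<integral>\<^sup>+ z. ennreal (psi_amp * erfc ((y - z) / (2 * sqrt s))) * ennreal (?N z) \<partial>lborel)
      = (\<integral>\<^sup>+ z. ennreal psi_amp * (ennreal (erfc ((y - z) / (2 * sqrt s))) * ennreal (?N z)) \<partial>lborel)"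
      using psi_amp_pos by (intro nn_integral_cong) (simp add: ennreal_mult' erfc_nonneg mult.assoc)
    also have "\<dots> = ennreal psi_amp * (\<integral>\<^sup>+ z. (ennreal (erfc ((y - z) / (2 * sqrt s))) * ennreal (?N z)) \<partial>lborel)"
      by (rule nn_integral_cmult) measurable
    finally show ?thesis
      using psi_amp_pos unfolding nn_integral_erfc_normal[OF assms] by (simp add: ennreal_mult' erfc_nonneg)
  qed
  have \<psi>_le_erfc: "\<psi> (y, s) \<le> psi_amp * erfc (y / (2 * sqrt s))" for y
    unfolding \<psi>_eq[OF assms(1)] using psi_amp_pos assms
    by (intro mult_left_mono erfc_antimono) (auto simp: le_max_iff_disj divide_simps)
  have b3: "?I \<le> ennreal (psi_amp * erfc (x / (2 * sqrt (s + \<tau>))))"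
    unfolding b2[symmetric] by (intro nn_integral_mono mult_right_mono ennreal_leI \<psi>_le_erfc) simp
  \<comment> \<open>The substitution z to -z with evenness of \<open>\<psi>\<close> turns the bound
    by the solution at x into the one at -x.\<close>
  have "?I = (\<integral>\<^sup>+ z. ennreal (\<psi> (- x - z, s)) * ennreal (?N z) \<partial>lborel)"
  proof -
    have "?I = (\<integral>\<^sup>+ z. ennreal (\<psi> (x - z, s)) * ennreal (?N z) \<partial>distr lborel borel uminus)"
      unfolding lborel_distr_uminus ..
    also have "\<dots> = (\<integral>\<^sup>+ z. ennreal (\<psi> (x + z, s)) * ennreal (?N (- z)) \<partial>lborel)"
      by (subst nn_integral_distr) auto
    also have "\<dots> = (\<integral>\<^sup>+ z. ennreal (\<psi> (- x - z, s)) * ennreal (?N z) \<partial>lborel)"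
      using \<psi>_even[of "x + _" s] by (simp add: normal_density_def)
    finally show ?thesis .
  qed
  also have "\<dots> \<le> ennreal (psi_amp * erfc (- x / (2 * sqrt (s + \<tau>))))"
    unfolding b2[of "- x", symmetric] by (intro nn_integral_mono mult_right_mono ennreal_leI \<psi>_le_erfc) simp
  finally have b4: "?I \<le> ennreal (psi_amp * erfc (- x / (2 * sqrt (s + \<tau>))))" .
  have "\<psi> (x, s + \<tau>) \<in> {psi_max, psi_amp * erfc (x / (2 * sqrt (s + \<tau>))), psi_amp * erfc (- x / (2 * sqrt (s + \<tau>)))}"
    using assms by (auto simp: \<psi>_eq psi_max_def max_def abs_if)
  with b1 b3 b4 show ?thesis by auto
qed

text \<open>Supercaloricity bounds the contribution of each age \<tau> by exp (- \<tau>) times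
  \<psi>, and these weights have total mass 1. Thus -\<psi> is a lower barrier for convolutions
  whose source stays above -\<psi>.\<close>

lemma lconv_hk_\<psi>_le: "lconv hk \<psi> P \<le> \<psi> P"
proof -
  obtain x t where P: "P = (x, t)" by fastforce
  have inner: "(\<integral>\<^sup>+ z. ennreal (hk (z, \<tau>) * \<psi> (x - z, t - \<tau>)) \<partial>lborel)
      \<le> ennreal (\<psi> (x, t)) * (ennreal (\<tau> ^ 0 * exp (- \<tau>)) * indicator {0..} \<tau>)" for \<tau>
  proof (cases "0 < \<tau> \<and> \<tau> < t")
    case True
    have "(\<integral>\<^sup>+ z. ennreal (hk (z, \<tau>) * \<psi> (x - z, t - \<tau>)) \<partial>lborel)
      = (\<integral>\<^sup>+ z. ennreal (exp (- \<tau>)) * (ennreal (\<psi> (x - z, t - \<tau>)) * ennreal (normal_density 0 (sqrt (2 * \<tau>)) z)) \<partial>lborel)"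
      using True by (intro nn_integral_cong) (simp add: hk_def ennreal_mult' \<psi>_nonneg mult_ac flip: ennreal_mult')
    also have "\<dots> = ennreal (exp (- \<tau>)) * (\<integral>\<^sup>+ z. ennreal (\<psi> (x - z, t - \<tau>)) * ennreal (normal_density 0 (sqrt (2 * \<tau>)) z) \<partial>lborel)"
      by (rule nn_integral_cmult) measurable
    also have "\<dots> \<le> ennreal (exp (- \<tau>)) * ennreal (\<psi> (x, (t - \<tau>) + \<tau>))"
      using True by (intro mult_left_mono \<psi>_supercaloric) auto
    finally show ?thesis using True by (simp add: mult.commute)
  next
    case False
    then have "hk (z, \<tau>) * \<psi> (x - z, t - \<tau>) = 0" for z
      using hk_eq_0[of "(z, \<tau>)"] \<psi>_eq_0[of "t - \<tau>" "x - z"] by (cases "\<tau> > 0") auto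
    then show ?thesis by (simp only: ennreal_0 nn_integral_const mult_zero_left zero_le)
  qed
  have m[measurable]: "(\<lambda>Q. ennreal (hk Q * \<psi> (P - Q))) \<in> borel_measurable borel" by measurable
  have "(\<integral>\<^sup>+ Q. ennreal (hk Q * \<psi> (P - Q)) \<partial>lborel)
      = (\<integral>\<^sup>+ \<tau>. (\<integral>\<^sup>+ z. ennreal (hk (z, \<tau>) * \<psi> (x - z, t - \<tau>)) \<partial>lborel) \<partial>lborel)"
    by (subst nn_integral_lborel_prod[OF m]) (simp add: P)
  also have "\<dots> \<le> (\<integral>\<^sup>+ \<tau>. ennreal (\<psi> (x, t)) * (ennreal (\<tau> ^ 0 * exp (- \<tau>)) * indicator {0..} \<tau>) \<partial>lborel)"
    by (intro nn_integral_mono inner)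
  also have "\<dots> = ennreal (\<psi> (x, t)) * (\<integral>\<^sup>+ \<tau>. ennreal (\<tau> ^ 0 * exp (- \<tau>)) * indicator {0..} \<tau> \<partial>lborel)"
    by (rule nn_integral_cmult) measurable
  also have "\<dots> = ennreal (\<psi> P)" by (subst nn_intergal_power_times_exp_Ici) (simp add: P)
  finally have "enn2real (\<integral>\<^sup>+ Q. ennreal (hk Q * \<psi> (P - Q)) \<partial>lborel) \<le> \<psi> P"
    by (intro enn2real_leI \<psi>_nonneg)
  then show ?thesis
    by (subst lconv_alt) (simp_all add: integral_eq_nn_integral hk_nonneg \<psi>_nonneg)
qed

end

section \<open>The delayed equation\<close>

text \<open>Causality of the kernel allows all hypotheses to be restricted to times before that of
  \<open>P\<close>; this is exactly what an induction over time steps knows.\<close>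

lemma lconv_hk_mono:
  assumes [measurable]: "G \<in> borel_measurable borel" "G' \<in> borel_measurable borel"
    and bd: "\<And>Q. snd Q < snd P \<Longrightarrow> \<bar>G Q\<bar> \<le> C" "\<And>Q. snd Q < snd P \<Longrightarrow> \<bar>G' Q\<bar> \<le> C"
    and le: "\<And>Q. snd Q < snd P \<Longrightarrow> G Q \<le> G' Q"
  shows "lconv hk G P \<le> lconv hk G' P"
proof -
  let ?I = "\<lambda>G Q. indicator {Q. snd Q < snd P} Q * G Q :: real"
  have eq: "lconv hk G P = (LBINT Q. hk (P - Q) * ?I G Q)" for G
    unfolding lconv_def
    by (intro Bochner_Integration.integral_cong) (auto simp: hk_eq_0 split: split_indicator)
  have "open {Q :: real \<times> real. snd Q < snd P}" by (intro open_Collect_less continuous_intros)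
  then have [measurable]: "{Q :: real \<times> real. snd Q < snd P} \<in> sets borel" by simp
  have C: "\<bar>?I H Q\<bar> \<le> \<bar>C\<bar>" if "\<And>Q. snd Q < snd P \<Longrightarrow> \<bar>H Q\<bar> \<le> C" for H Q
    using that[of Q] by (auto split: split_indicator)
  show ?thesis
    unfolding eq
  proof (rule integral_mono)
    show "integrable lborel (\<lambda>Q. hk (P - Q) * ?I G Q)"
      by (rule integrable_lconv[OF integrable_hk _ C[OF bd(1)]]) measurable
    show "integrable lborel (\<lambda>Q. hk (P - Q) * ?I G' Q)"
      by (rule integrable_lconv[OF integrable_hk _ C[OF bd(2)]]) measurable
    show "hk (P - Q) * ?I G Q \<le> hk (P - Q) * ?I G' Q" for Q
    proof (rule mult_left_mono[OF _ hk_nonneg])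
      show "?I G Q \<le> ?I G' Q" using le[of Q] by (auto split: split_indicator)
    qed
  qed
qed

lemma lborel_reflect_fst: "distr lborel borel (\<lambda>Q. (- fst Q, snd Q)) = (lborel :: (real \<times> real) measure)"
proof -
  have "distr lborel borel uminus \<Otimes>\<^sub>M distr lborel borel (\<lambda>x. x)
      = distr (lborel \<Otimes>\<^sub>M lborel) (borel \<Otimes>\<^sub>M borel) (\<lambda>(x, y). (- x :: real, y :: real))"
    by (rule pair_measure_distr) (auto simp: distr_id2 sigma_finite_lborel)
  then show ?thesis
    by (simp add: lborel_distr_uminus distr_id2 lborel_prod borel_prod split_beta')
qed

lemma integral_reflect_fst:
  fixes f :: "real \<times> real \<Rightarrow> real"
  assumes [measurable]: "f \<in> borel_measurable borel"
  shows "(LBINT Q. f (- fst Q, snd Q)) = (LBINT Q. f Q)"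
proof -
  have [measurable]: "(\<lambda>Q :: real \<times> real. (- fst Q, snd Q)) \<in> borel_measurable borel"
    by (intro borel_measurable_continuous_onI continuous_intros)
  show ?thesis by (subst (2) lborel_reflect_fst[symmetric]) (simp add: integral_distr)
qed

lemma lconv_hk_even:
  assumes [measurable]: "G \<in> borel_measurable borel" and even: "\<And>y s. G (- y, s) = G (y, s)"
  shows "lconv hk G (- x, t) = lconv hk G (x, t)"
proof -
  have "lconv hk G (- x, t) = (LBINT Q. hk ((- x, t) - (- fst Q, snd Q)) * G (- fst Q, snd Q))"
    unfolding lconv_def by (subst integral_reflect_fst) measurable
  also have "\<dots> = (LBINT Q. hk ((x, t) - Q) * G Q)"
  proof (intro Bochner_Integration.integral_cong refl)
    fix Q :: "real \<times> real"
    show "hk ((- x, t) - (- fst Q, snd Q)) * G (- fst Q, snd Q) = hk ((x, t) - Q) * G Q"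
      using hk_even[of "x - fst Q" "t - snd Q"] even[of "fst Q" "snd Q"]
      by (cases Q) simp
  qed
  finally show ?thesis unfolding lconv_def .
qed

section \<open>Solving the delayed equation step by step\<close>

context hhmo
begin

text \<open>Rational times make the ignited region a countable union, hence measurable for any
  measurable \<open>w\<close>. The strict inequality r < snd Q makes ignition depend on the strict
  past only, and 0 < r prevents it up to time 0.\<close>

definition ignite :: "(real \<times> real \<Rightarrow> real) \<Rightarrow> real \<times> real \<Rightarrow> real" where
  "ignite w Q = of_bool (\<exists>r\<in>\<rat>. 0 < r \<and> r < snd Q \<and> w (fst Q, r) + \<psi> (fst Q, r) > ustar)"

definition reac :: "(real \<times> real \<Rightarrow> real) \<Rightarrow> real \<times> real \<Rightarrow> real" where
  "reac w Q = w Q - ignite w Q * (w Q + \<psi> Q)"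

definition delay_step :: "real \<Rightarrow> (real \<times> real \<Rightarrow> real) \<Rightarrow> real \<times> real \<Rightarrow> real" where
  "delay_step h w = lconv hk (\<lambda>Q. reac w (Q - (0, h)))"

primrec delay_iter :: "real \<Rightarrow> nat \<Rightarrow> real \<times> real \<Rightarrow> real" where
  "delay_iter h 0 = (\<lambda>_. 0)"
| "delay_iter h (Suc n) = delay_step h (delay_iter h n)"

text \<open>The index is the least number of steps of length \<open>h\<close> that covers the time
  of \<open>Q\<close>; later iterates no longer change the value there.\<close>

definition delay_sol :: "real \<Rightarrow> real \<times> real \<Rightarrow> real" where
  "delay_sol h Q = delay_iter h (nat \<lceil>snd Q / h\<rceil>) Q"

lemma ignite_01: "ignite w Q \<in> {0..1}" and ignite_cases: "ignite w Q = 0 \<or> ignite w Q = 1"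
  by (auto simp: ignite_def)

lemma ignite_mono: "s \<le> t \<Longrightarrow> ignite w (x, s) \<le> ignite w (x, t)"
  unfolding ignite_def by fastforce

lemma ignite_eq_0: "s \<le> 0 \<Longrightarrow> ignite w (x, s) = 0"
  by (auto simp: ignite_def)

lemma ignite_cong: "(\<And>r. r < s \<Longrightarrow> w (x, r) = w' (x, r)) \<Longrightarrow> ignite w (x, s) = ignite w' (x, s)"
  by (auto simp: ignite_def)

lemma ignite_measurable[measurable]:
  assumes [measurable]: "w \<in> borel_measurable borel"
  shows "ignite w \<in> borel_measurable borel"
proof -
  let ?S = "\<lambda>r. {Q. 0 < r \<and> r < snd Q \<and> w (fst Q, r) + \<psi> (fst Q, r) > ustar}"
  have "?S r \<in> sets borel" for r
  proof -
    have "Measurable.pred borel (\<lambda>Q. 0 < r \<and> r < snd Q \<and> w (fst Q, r) + \<psi> (fst Q, r) > ustar)"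
      unfolding borel_prod[symmetric] by measurable
    then show ?thesis by (simp only: pred_def space_borel UNIV_I simp_thms)
  qed
  then have "(\<Union>r\<in>\<rat>. ?S r) \<in> sets borel"
    by (intro sets.countable_UN'' countable_rat)
  moreover have "ignite w = indicator (\<Union>r\<in>\<rat>. ?S r)"
  proof
    fix Q show "ignite w Q = indicator (\<Union>r\<in>\<rat>. ?S r) Q"
      unfolding ignite_def indicator_def by (intro arg_cong[where f = of_bool]) blast
  qed
  ultimately show ?thesis by simp
qed

lemma reac_measurable[measurable]:
  assumes [measurable]: "w \<in> borel_measurable borel"
  shows "reac w \<in> borel_measurable borel"
  unfolding reac_def[abs_def] by measurable

lemma delay_step_measurable:
  assumes [measurable]: "w \<in> borel_measurable borel"
  shows "delay_step h w \<in> borel_measurable borel"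
  unfolding delay_step_def by (intro borel_measurable_lconv) measurable

lemma delay_iter_measurable: "delay_iter h n \<in> borel_measurable borel"
  by (induction n) (auto intro: delay_step_measurable)

text \<open>Causality together with the delay: the values up to time T determine the next iterate up
  to T + h.\<close>

lemma delay_step_cong:
  assumes "\<And>x s. s \<le> T \<Longrightarrow> w (x, s) = w' (x, s)" and "t \<le> T + h"
  shows "delay_step h w (x, t) = delay_step h w' (x, t)"
  unfolding delay_step_def lconv_def
proof (intro Bochner_Integration.integral_cong refl)
  fix Q :: "real \<times> real"
  obtain y s where Q: "Q = (y, s)" by fastforce
  show "hk ((x, t) - Q) * reac w (Q - (0, h)) = hk ((x, t) - Q) * reac w' (Q - (0, h))"
  proof (cases "s < t")
    case True
    with assms(2) have s: "s - h \<le> T" by simp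
    have "reac w (y, s - h) = reac w' (y, s - h)"
      unfolding reac_def using assms(1)[OF s] ignite_cong[of "s - h" w y w'] assms(1) s by simp
    then show ?thesis by (simp add: Q)
  qed (simp add: Q hk_eq_0)
qed

lemma delay_iter_Suc:
  assumes "h > 0" "t \<le> real n * h"
  shows "delay_iter h (Suc n) (x, t) = delay_iter h n (x, t)"
  using assms(2)
proof (induction n arbitrary: x t)
  case 0
  \<comment> \<open>Even for w = 0 the source is -\<psi> once ignited; here the delayed time is at
    most 0, so there is no ignition.\<close>
  have "hk ((x, t) - Q) * reac (\<lambda>_. 0) (Q - (0, h)) = 0" for Q
  proof (cases "snd Q < t")
    case True
    with 0 \<open>h > 0\<close> have "snd Q - h \<le> 0" by simp
    then show ?thesis by (cases Q) (simp add: reac_def ignite_eq_0)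
  qed (simp add: hk_eq_0)
  then have "(LBINT Q. hk ((x, t) - Q) * reac (\<lambda>_. 0) (Q - (0, h))) = (\<integral>Q. 0 \<partial>(lborel :: (real \<times> real) measure))"
    by (intro Bochner_Integration.integral_cong refl)
  then show ?case by (simp add: delay_step_def lconv_def)
next
  case (Suc n)
  have "delay_step h (delay_iter h (Suc n)) (x, t) = delay_step h (delay_iter h n) (x, t)"
    by (rule delay_step_cong[where T = "real n * h"]) (use Suc in \<open>auto simp: algebra_simps\<close>)
  then show ?case by simp
qed

lemma delay_iter_eq:
  assumes "h > 0" "n \<le> m" "t \<le> real n * h"
  shows "delay_iter h m (x, t) = delay_iter h n (x, t)"
  using assms(2)
proof (induction m rule: dec_induct)
  case (step m)
  have "t \<le> real m * h"
    using assms step by (meson mult_right_mono of_nat_mono less_imp_le order_trans)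
  with step show ?case using delay_iter_Suc[OF \<open>h > 0\<close>] by simp
qed simp

lemma delay_sol_eq_iter:
  assumes "h > 0" "t \<le> real n * h"
  shows "delay_sol h (x, t) = delay_iter h n (x, t)"
proof -
  have "t / h \<le> real n" using assms by (simp add: divide_simps)
  then have le: "nat \<lceil>t / h\<rceil> \<le> n" by (simp add: ceiling_le_iff)
  have "t / h \<le> real (nat \<lceil>t / h\<rceil>)" by linarith
  then have "t \<le> real (nat \<lceil>t / h\<rceil>) * h" using assms by (simp add: divide_simps)
  from delay_iter_eq[OF \<open>h > 0\<close> le this, of x] show ?thesis
    by (simp add: delay_sol_def)
qed

lemma ex_time_step: "h > 0 \<Longrightarrow> \<exists>n. t \<le> real n * h" for h :: real
  by (meson real_arch_simple mult_imp_div_pos_le pos_divide_le_eq)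

lemma delay_sol_fixed_point:
  assumes "h > 0"
  shows "delay_sol h P = lconv hk (\<lambda>Q. reac (delay_sol h) (Q - (0, h))) P"
proof -
  obtain x t where P: "P = (x, t)" by fastforce
  obtain n where n: "t \<le> real n * h" using ex_time_step[OF assms] by blast
  have "delay_sol h P = delay_iter h (Suc n) (x, t)"
    unfolding P using n assms by (intro delay_sol_eq_iter) (auto simp: algebra_simps)
  also have "\<dots> = delay_step h (delay_iter h n) (x, t)" by simp
  also have "\<dots> = delay_step h (delay_sol h) (x, t)"
    by (rule delay_step_cong[where T = "real n * h"]) (use n assms delay_sol_eq_iter in auto)
  finally show ?thesis by (simp add: P delay_step_def)
qed

lemma delay_sol_measurable[measurable]: "h > 0 \<Longrightarrow> delay_sol h \<in> borel_measurable borel"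
proof (rule borel_measurable_LIMSEQ_real)
  assume h: "h > 0"
  show "(\<lambda>n. delay_iter h n Q) \<longlonglongrightarrow> delay_sol h Q" for Q
  proof (rule tendsto_eventually)
    obtain n where n: "snd Q \<le> real n * h" using ex_time_step[OF h] by blast
    show "\<forall>\<^sub>F m in sequentially. delay_iter h m Q = delay_sol h Q"
      using eventually_ge_at_top[of n]
    proof eventually_elim
      case (elim m)
      show ?case
        using delay_iter_eq[OF h elim n, of "fst Q"] delay_sol_eq_iter[OF h n, of "fst Q"]
        by (simp only: prod.collapse)
    qed
  qed
qed (rule delay_iter_measurable)

text \<open>The source is \<open>w\<close> without ignition and -\<psi> with it, since absorption
  and damping have the same rate. Both values lie between -\<psi> and 0.\<close>

lemma reac_bounds:
  assumes "w Q \<le> 0" "0 \<le> w Q + \<psi> Q"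
  shows "reac w Q \<le> 0" "- \<psi> Q \<le> reac w Q"
  using ignite_cases[of w Q] assms \<psi>_nonneg[of Q] by (auto simp: reac_def)

text \<open>Inductively the delayed source lies between minus the delayed barrier and 0. As \<psi>
  is nondecreasing in time, the undelayed -\<psi> is a lower bound too, and convolution with the
  kernel preserves it by \<open>lconv_hk_\<psi>_le\<close>.\<close>

lemma delay_sol_bounds_upto:
  assumes h: "h > 0"
  shows "t \<le> real n * h \<Longrightarrow> delay_sol h (x, t) \<le> 0 \<and> 0 \<le> delay_sol h (x, t) + \<psi> (x, t)"
proof (induction n arbitrary: x t)
  case 0
  have "delay_sol h (x, t) = 0" using delay_sol_eq_iter[OF h, of t 0 x] 0 by simp
  then show ?case by (simp add: \<psi>_nonneg)
next
  case (Suc n)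
  let ?G = "\<lambda>Q. reac (delay_sol h) (Q - (0, h))"
  have [measurable]: "?G \<in> borel_measurable borel" using h by measurable
  have G: "?G Q \<le> 0" "- \<psi> Q \<le> ?G Q" if "snd Q < t" for Q
  proof -
    obtain y s where Q: "Q = (y, s)" by fastforce
    have "s - h \<le> real n * h" using Suc.prems that Q by (simp add: algebra_simps)
    from Suc.IH[OF this, of y] reac_bounds[of "delay_sol h" "(y, s - h)"]
    have "reac (delay_sol h) (y, s - h) \<le> 0" "- \<psi> (y, s - h) \<le> reac (delay_sol h) (y, s - h)"
      by auto
    moreover have "\<psi> (y, s - h) \<le> \<psi> (y, s)" using h by (intro \<psi>_mono) simp
    ultimately show "?G Q \<le> 0" "- \<psi> Q \<le> ?G Q" by (auto simp: Q)
  qed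
  have Gbd: "\<bar>?G Q\<bar> \<le> psi_max" if "snd Q < t" for Q
    using G[OF that] \<psi>_le[of Q] by linarith
  have \<psi>bd: "\<bar>- \<psi> Q\<bar> \<le> psi_max" for Q using \<psi>_le[of Q] \<psi>_nonneg[of Q] by simp
  have "delay_sol h (x, t) = lconv hk ?G (x, t)" by (rule delay_sol_fixed_point[OF h])
  moreover have "lconv hk ?G (x, t) \<le> lconv hk (\<lambda>_. 0) (x, t)"
    by (rule lconv_hk_mono[where C = psi_max]) (use Gbd G psi_max_nonneg in auto)
  moreover have "lconv hk (\<lambda>Q. - \<psi> Q) (x, t) \<le> lconv hk ?G (x, t)"
    by (rule lconv_hk_mono[where C = psi_max]) (use Gbd G \<psi>bd in auto)
  moreover have "lconv hk (\<lambda>Q. - \<psi> Q) (x, t) = - lconv hk \<psi> (x, t)" by (simp add: lconv_def)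
  moreover have "lconv hk \<psi> (x, t) \<le> \<psi> (x, t)" by (rule lconv_hk_\<psi>_le)
  moreover have "lconv hk (\<lambda>_. 0) (x, t) = 0" by (simp add: lconv_def)
  ultimately show ?case by linarith
qed

lemma delay_sol_bounds:
  assumes "h > 0"
  shows "delay_sol h Q \<le> 0" "0 \<le> delay_sol h Q + \<psi> Q"
proof -
  obtain n where "snd Q \<le> real n * h" using ex_time_step[OF assms] by blast
  from delay_sol_bounds_upto[OF assms this, of "fst Q"]
  show "delay_sol h Q \<le> 0" "0 \<le> delay_sol h Q + \<psi> Q" by simp_all
qed

lemma delay_source_bound:
  assumes "h > 0" shows "\<bar>reac (delay_sol h) Q\<bar> \<le> psi_max"
  using reac_bounds[of "delay_sol h" Q, OF delay_sol_bounds[OF assms]] \<psi>_le[of Q] by linarith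

text \<open>Translation in time commutes with the convolution, so it suffices to compare the sources
  at times \<open>c\<close> apart, which is where the induction hypothesis and the lower bound
  -\<psi> enter.\<close>

lemma delay_sol_antimono_upto:
  assumes h: "h > 0" and "c \<ge> 0"
  shows "t \<le> real n * h \<Longrightarrow> delay_sol h (x, t + c) \<le> delay_sol h (x, t)"
proof (induction n arbitrary: x t)
  case 0
  have "delay_sol h (x, t) = 0" using delay_sol_eq_iter[OF h, of t 0 x] 0 by simp
  then show ?case using delay_sol_bounds[OF h] by simp
next
  case (Suc n)
  let ?F = "reac (delay_sol h)"
  let ?G = "\<lambda>Q. ?F (Q - (0, h))"
  have [measurable]: "?G \<in> borel_measurable borel" using h by measurable
  have le: "?G (Q + (0, c)) \<le> ?G Q" if "snd Q < t" for Q
  proof -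
    obtain y s where Q: "Q = (y, s)" by fastforce
    define \<sigma> where "\<sigma> = s - h"
    have "\<sigma> \<le> real n * h" using Suc.prems that Q by (simp add: algebra_simps \<sigma>_def)
    from Suc.IH[OF this] have w: "delay_sol h (y, \<sigma> + c) \<le> delay_sol h (y, \<sigma>)" .
    have i: "ignite (delay_sol h) (y, \<sigma>) \<le> ignite (delay_sol h) (y, \<sigma> + c)"
      using \<open>c \<ge> 0\<close> by (intro ignite_mono) simp
    have "\<psi> (y, \<sigma>) \<le> \<psi> (y, \<sigma> + c)" using \<open>c \<ge> 0\<close> by (intro \<psi>_mono) simp
    moreover have "- \<psi> (y, \<sigma>) \<le> ?F (y, \<sigma>)"
      by (rule reac_bounds(2)[OF delay_sol_bounds[OF h]])
    \<comment> \<open>If the later time is not ignited, neither is the earlier one, and both sources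
      equal the solution. If it is ignited, the later source is -\<psi> at \<sigma> + c, which lies
      below -\<psi> at \<sigma> and hence below any admissible earlier source.\<close>
    ultimately have "?F (y, \<sigma> + c) \<le> ?F (y, \<sigma>)"
      using ignite_cases[of "delay_sol h" "(y, \<sigma> + c)"]
    proof (elim disjE)
      assume "ignite (delay_sol h) (y, \<sigma> + c) = 0"
      moreover from this i ignite_01[of "delay_sol h" "(y, \<sigma>)"] have "ignite (delay_sol h) (y, \<sigma>) = 0" by simp
      ultimately show ?thesis using w by (simp add: reac_def)
    qed (simp add: reac_def)
    then show ?thesis by (simp add: Q \<sigma>_def algebra_simps)
  qed
  have "delay_sol h (x, t + c) = lconv hk ?G ((x, t) + (0, c))"
    by (subst delay_sol_fixed_point[OF h]) simp
  also have "\<dots> = lconv hk (\<lambda>Q. ?G (Q + (0, c))) (x, t)"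
    by (rule lconv_translate[symmetric]) measurable
  also have "\<dots> \<le> lconv hk ?G (x, t)"
    by (rule lconv_hk_mono[where C = psi_max]) (use le delay_source_bound[OF h] in auto)
  also have "\<dots> = delay_sol h (x, t)" by (rule delay_sol_fixed_point[OF h, symmetric])
  finally show ?case .
qed

lemma delay_sol_antimono:
  assumes "h > 0" "s \<le> t"
  shows "delay_sol h (x, t) \<le> delay_sol h (x, s)"
proof -
  obtain n where "s \<le> real n * h" using ex_time_step[OF assms(1)] by blast
  from delay_sol_antimono_upto[OF assms(1) _ this, of "t - s" x] assms(2) show ?thesis by simp
qed

lemma delay_sol_continuous: assumes "h > 0" shows "continuous_on UNIV (delay_sol h)"
proof -
  have "continuous_on UNIV (lconv hk (\<lambda>Q. reac (delay_sol h) (Q - (0, h))))"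
    by (rule continuous_lconv[OF integrable_hk AE_isCont_hk, where C = psi_max])
       (use delay_source_bound assms in auto)
  moreover have "lconv hk (\<lambda>Q. reac (delay_sol h) (Q - (0, h))) = delay_sol h"
    using delay_sol_fixed_point[OF assms] by auto
  ultimately show ?thesis by simp
qed

lemma delay_sol_eq_0: "h > 0 \<Longrightarrow> t \<le> 0 \<Longrightarrow> delay_sol h (x, t) = 0"
  using delay_sol_eq_iter[of h t 0 x] by simp

lemma delay_sol_even: assumes "h > 0" shows "delay_sol h (- x, t) = delay_sol h (x, t)"
proof -
  have "delay_iter h n (- y, s) = delay_iter h n (y, s)" for n y s
  proof (induction n arbitrary: y s)
    case (Suc n)
    have [measurable]: "delay_iter h n \<in> borel_measurable borel" by (rule delay_iter_measurable)
    show ?case unfolding delay_iter.simps delay_step_def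
    proof (rule lconv_hk_even)
      show "(\<lambda>Q. reac (delay_iter h n) (Q - (0, h))) \<in> borel_measurable borel" by measurable
      show "reac (delay_iter h n) ((- y, s) - (0, h)) = reac (delay_iter h n) ((y, s) - (0, h))" for y s
        by (simp add: reac_def ignite_def Suc \<psi>_even)
    qed
  qed simp
  then show ?thesis by (simp add: delay_sol_def)
qed

text \<open>Behind the parabola \<psi> is constant and the solution nonincreasing, so a threshold
  passed at a later time is already passed on the parabola itself. As \<open>s\<close> and
  \<open>s'\<close> are interchangeable, the two values are in fact equal.\<close>

lemma ignite_delay_sol_const:
  assumes h: "h > 0" and "x \<noteq> 0" and s: "s > x\<^sup>2 / \<alpha>\<^sup>2" "s' > x\<^sup>2 / \<alpha>\<^sup>2"
  shows "ignite (delay_sol h) (x, s) \<le> ignite (delay_sol h) (x, s')"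
proof (cases "ignite (delay_sol h) (x, s) = 0")
  case True
  then show ?thesis using ignite_01[of "delay_sol h" "(x, s')"] by simp
next
  case False
  define \<theta> where "\<theta> = x\<^sup>2 / \<alpha>\<^sup>2"
  have \<theta>: "\<theta> > 0" using \<open>x \<noteq> 0\<close> alpha_pos by (simp add: \<theta>_def)
  let ?u = "\<lambda>r. delay_sol h (x, r) + \<psi> (x, r)"
  from False obtain r where r: "r \<in> \<rat>" "0 < r" "r < s" "?u r > ustar"
    by (auto simp: ignite_def)
  have "\<exists>r\<in>\<rat>. 0 < r \<and> r < s' \<and> ?u r > ustar"
  proof (cases "r \<le> \<theta>")
    case True
    then show ?thesis using r s(2) by (intro bexI[of _ r]) (auto simp: \<theta>_def)
  next
    case False
    have "?u r \<le> ?u \<theta>"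
      using delay_sol_antimono[OF h, of \<theta> r x] \<psi>_const[of x \<theta>] \<psi>_const[of x r] False \<theta> r
      by (simp add: \<theta>_def)
    with r have gt: "?u \<theta> > ustar" by simp
    \<comment> \<open>The time \<theta> may be irrational and is then invisible to
      \<open>ignite\<close>. Continuity supplies a rational time just after it and before
      \<open>s'\<close>; it is available because x \<noteq> 0 makes \<theta> positive.\<close>
    have "isCont ?u \<theta>"
    proof (intro continuous_intros)
      have "isCont (delay_sol h) (x, \<theta>)"
        using delay_sol_continuous[OF h] by (simp add: continuous_on_eq_continuous_at)
      then show "isCont (\<lambda>r. delay_sol h (x, r)) \<theta>"
        by (rule isCont_o2[rotated]) (intro continuous_intros)
      have "isCont \<psi> (x, \<theta>)" using \<theta> by (intro isCont_\<psi>) simp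
      then show "isCont (\<lambda>r. \<psi> (x, r)) \<theta>"
        by (rule isCont_o2[rotated]) (intro continuous_intros)
    qed
    then have "?u \<midarrow>\<theta>\<rightarrow> ?u \<theta>" by (simp add: isCont_def)
    from order_tendstoD(1)[OF this gt] obtain d where d: "d > 0"
      "\<And>r. r \<noteq> \<theta> \<Longrightarrow> dist r \<theta> < d \<Longrightarrow> ?u r > ustar"
      unfolding eventually_at by auto
    obtain r' where r': "r' \<in> \<rat>" "\<theta> < r'" "r' < min s' (\<theta> + d)"
      using Rats_dense_in_real[of \<theta> "min s' (\<theta> + d)"] d(1) s(2) by (auto simp: \<theta>_def)
    then show ?thesis using d(2)[of r'] \<theta> by (intro bexI[of _ r']) (auto simp: dist_real_def)
  qed
  then have "ignite (delay_sol h) (x, s') = 1" by (simp add: ignite_def)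
  then show ?thesis using ignite_01[of "delay_sol h" "(x, s)"] by simp
qed

end

section \<open>The limit of vanishing delay\<close>

text \<open>A weak limit agrees with a pointwise limit. Testing with (f - L) restricted to a bounded
  part of \<open>A\<close>, dominated convergence and weak convergence give the same integral
  against \<open>L\<close> and \<open>f\<close>, so (f - L) squared integrates to 0.\<close>

lemma AE_eq_of_weak_limit:
  fixes f L :: "'a::euclidean_space \<Rightarrow> real" and F :: "nat \<Rightarrow> 'a \<Rightarrow> real"
  assumes [measurable]: "\<And>n. F n \<in> borel_measurable borel" "f \<in> borel_measurable borel"
      "L \<in> borel_measurable borel" "A \<in> sets borel"
    and bd: "\<And>n Q. \<bar>F n Q\<bar> \<le> 1" "\<And>Q. \<bar>f Q\<bar> \<le> 1" "\<And>Q. \<bar>L Q\<bar> \<le> 1"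
    and weak: "\<And>g. integrable lborel g \<Longrightarrow> (\<lambda>n. LBINT Q. g Q * F n Q) \<longlonglongrightarrow> (LBINT Q. g Q * f Q)"
    and lim: "\<And>Q. Q \<in> A \<Longrightarrow> (\<lambda>n. F n Q) \<longlonglongrightarrow> L Q"
  shows "AE Q in lborel. Q \<in> A \<longrightarrow> f Q = L Q"
proof -
  have "AE Q in lborel. Q \<in> A \<inter> cball 0 (real N) \<longrightarrow> f Q = L Q" for N
  proof -
    let ?B = "A \<inter> cball 0 (real N)"
    let ?g = "\<lambda>Q. indicator ?B Q * (f Q - L Q)"
    have [measurable]: "cball (0::'a) (real N) \<in> sets borel" by simp
    have intB: "integrable lborel (indicator ?B :: 'a \<Rightarrow> real)"
    proof -
      have "emeasure lborel ?B \<le> emeasure lborel (cball (0::'a) (real N))"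
        by (intro emeasure_mono) auto
      also have "\<dots> < \<infinity>" by (rule emeasure_bounded_finite) simp
      finally show ?thesis by simp
    qed
    have intH: "integrable lborel (\<lambda>Q. indicator ?B Q * (f Q - L Q) * H Q)"
      if [measurable]: "H \<in> borel_measurable borel" and H: "\<And>Q. \<bar>H Q\<bar> \<le> 1" for H :: "'a \<Rightarrow> real"
    proof (rule Bochner_Integration.integrable_bound)
      show "integrable lborel (\<lambda>Q. 2 * indicator ?B Q :: real)" using intB by simp
      show "AE Q in lborel. norm (indicator ?B Q * (f Q - L Q) * H Q) \<le> norm (2 * indicator ?B Q :: real)"
      proof (rule AE_I2)
        fix Q
        have "\<bar>f Q - L Q\<bar> * \<bar>H Q\<bar> \<le> 2 * 1"
          using bd(2)[of Q] bd(3)[of Q] H[of Q] by (intro mult_mono) auto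
        then show "norm (indicator ?B Q * (f Q - L Q) * H Q) \<le> norm (2 * indicator ?B Q :: real)"
          by (auto simp: abs_mult split: split_indicator)
      qed
    qed measurable
    have g: "integrable lborel ?g" using intH[of "\<lambda>_. 1"] by simp
    have iL: "integrable lborel (\<lambda>Q. ?g Q * L Q)" by (rule intH) (use bd in auto)
    have iF: "integrable lborel (\<lambda>Q. ?g Q * f Q)" by (rule intH) (use bd in auto)
    have "(\<lambda>n. LBINT Q. ?g Q * F n Q) \<longlonglongrightarrow> (LBINT Q. ?g Q * L Q)"
    proof (rule integral_dominated_convergence[where w = "\<lambda>Q. \<bar>?g Q\<bar>"])
      show "integrable lborel (\<lambda>Q. \<bar>?g Q\<bar>)" using g by (rule integrable_abs)
      show "AE Q in lborel. (\<lambda>n. ?g Q * F n Q) \<longlonglongrightarrow> ?g Q * L Q"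
      proof (rule AE_I2)
        fix Q show "(\<lambda>n. ?g Q * F n Q) \<longlonglongrightarrow> ?g Q * L Q"
          by (cases "Q \<in> A") (auto intro!: tendsto_mult_left lim)
      qed
      show "AE Q in lborel. norm (?g Q * F n Q) \<le> \<bar>?g Q\<bar>" for n
      proof (rule AE_I2)
        fix Q show "norm (?g Q * F n Q) \<le> \<bar>?g Q\<bar>"
          unfolding real_norm_def abs_mult[of "?g Q"] by (intro mult_left_le bd abs_ge_zero)
      qed
    qed measurable
    with weak[OF g] have eq: "(LBINT Q. ?g Q * L Q) = (LBINT Q. ?g Q * f Q)"
      by (rule LIMSEQ_unique[rotated])
    have sq: "indicator ?B Q * (f Q - L Q)\<^sup>2 = ?g Q * f Q - ?g Q * L Q" for Q
      by (simp add: power2_eq_square algebra_simps)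
    have "(LBINT Q. indicator ?B Q * (f Q - L Q)\<^sup>2) = 0"
      unfolding sq using eq iL iF by simp
    moreover have "integrable lborel (\<lambda>Q. indicator ?B Q * (f Q - L Q)\<^sup>2)"
      unfolding sq using iL iF by (rule Bochner_Integration.integrable_diff[rotated])
    ultimately have "AE Q in lborel. indicator ?B Q * (f Q - L Q)\<^sup>2 = 0"
      by (subst (asm) integral_nonneg_eq_0_iff_AE) auto
    then show ?thesis by eventually_elim (auto split: split_indicator_asm)
  qed
  then have "AE Q in lborel. \<forall>N. Q \<in> A \<inter> cball 0 (real N) \<longrightarrow> f Q = L Q"
    by (simp only: AE_all_countable) simp
  then show ?thesis
  proof eventually_elim
    case (elim Q)
    obtain N where "norm Q \<le> real N" using real_arch_simple by blast
    with elim show ?case by auto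
  qed
qed

context hhmo
begin

text \<open>Both threshold statements keep a strict margin: either the threshold is exceeded at some
  rational time, or some rational c < ustar bounds all earlier ones. Such situations are stable
  under the convergence, whereas equality is not. The last statement uses a countable family of
  shifts so that it survives as one almost-everywhere statement.\<close>

theorem limit_pair:
  obtains w p :: "real \<times> real \<Rightarrow> real" where
    "continuous_on UNIV w"
    "\<And>Q. - psi_max \<le> w Q \<and> w Q \<le> 0"
    "\<And>x t. t \<le> 0 \<Longrightarrow> w (x, t) = 0"
    "\<And>x t. w (- x, t) = w (x, t)"
    "\<And>x s t. s \<le> t \<Longrightarrow> w (x, t) \<le> w (x, s)"
    "p \<in> borel_measurable borel"
    "\<And>Q. p Q \<in> {0..1}"
    "\<And>x t. p (- x, t) = p (x, t)"
    "\<And>x s t. s \<le> t \<Longrightarrow> p (x, s) \<le> p (x, t)"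
    "\<And>P. w P = lconv hk (\<lambda>Q. w Q - p Q * (w Q + \<psi> Q)) P"
    "AE Q in lborel. ignite w Q = 1 \<longrightarrow> p Q = 1"
    "AE Q in lborel. (\<exists>c\<in>\<rat>. c < ustar \<and> (\<forall>r\<in>\<rat>. 0 < r \<and> r < snd Q \<longrightarrow> w (fst Q, r) + \<psi> (fst Q, r) \<le> c)) \<longrightarrow> p Q = 0"
    "\<And>n :: nat. AE Q in lborel. snd Q > (fst Q)\<^sup>2 / \<alpha>\<^sup>2 \<longrightarrow> p Q = p (Q + (0, real n))"
proof -
  define h where "h n = 1 / real (Suc n)" for n
  have h: "h n > 0" for n by (simp add: h_def)
  have h_lim: "h \<longlonglongrightarrow> 0" unfolding h_def[abs_def] by (rule LIMSEQ_Suc[OF lim_1_over_n])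
  define W where "W n = delay_sol (h n)" for n
  define P where "P n Q = ignite (W n) (Q - (0, h n))" for n Q
  define G where "G n Q = reac (W n) (Q - (0, h n))" for n Q
  have W_meas[measurable]: "W n \<in> borel_measurable borel" for n
    unfolding W_def by (rule delay_sol_measurable[OF h])
  have P_meas[measurable]: "P n \<in> borel_measurable borel" for n unfolding P_def[abs_def] by measurable
  have G_meas[measurable]: "G n \<in> borel_measurable borel" for n unfolding G_def[abs_def] by measurable
  have P01: "P n Q \<in> {0..1}" for n Q unfolding P_def by (rule ignite_01)
  have P_mono: "P n (y, s) \<le> P n (y, s')" if "s \<le> s'" for n y s s'
    unfolding P_def using ignite_mono[of "s - h n" "s' - h n" "W n" y] that by simp
  have G_bd: "\<bar>G n Q\<bar> \<le> psi_max + 1" for n Q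
    unfolding G_def W_def using delay_source_bound[OF h, of n "Q - (0, h n)"] by linarith
  have W_conv: "W n Q = lconv hk (G n) Q" for n Q
    unfolding W_def G_def[abs_def] by (rule delay_sol_fixed_point[OF h])
  have W_le: "W n Q \<le> 0" and W_ge: "- psi_max \<le> W n Q" for n Q
    using delay_sol_bounds[OF h, of n Q] \<psi>_le[of Q] unfolding W_def by linarith+
  have W_0: "W n (x, t) = 0" if "t \<le> 0" for n x t
    unfolding W_def using delay_sol_eq_0[OF h that] .
  have equi: "\<exists>d>0. \<forall>n Q Q'. dist Q Q' < d \<longrightarrow> \<bar>W n Q - W n Q'\<bar> < e" if "e > 0" for e
  proof -
    have "psi_max + 1 > 0" using psi_max_nonneg by simp
    from equicontinuous_lconv[OF integrable_hk AE_isCont_hk that this] obtain d where "d > 0"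
      and d: "\<And>G Q Q'. G \<in> borel_measurable borel \<Longrightarrow> (\<And>Q. \<bar>G Q\<bar> \<le> psi_max + 1) \<Longrightarrow> dist Q Q' < d \<Longrightarrow>
       \<bar>lconv hk G Q - lconv hk G Q'\<bar> < e" by blast
    have "\<bar>W n Q - W n Q'\<bar> < e" if "dist Q Q' < d" for n Q Q'
      unfolding W_conv by (rule d[OF G_meas G_bd that])
    with \<open>d > 0\<close> show ?thesis by blast
  qed
  obtain k where k: "strict_mono (k :: nat \<Rightarrow> nat)"
    and k_conv: "\<And>Q. Q \<in> \<rat> \<times> \<rat> \<Longrightarrow> \<exists>l. (\<lambda>n. W (k n) Q) \<longlonglongrightarrow> l"
  proof (rule function_convergent_subsequence[where S = "\<rat> \<times> \<rat>" and f = W and M = psi_max])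
    show "countable (\<rat> \<times> \<rat> :: (real \<times> real) set)" by (simp add: countable_rat)
    show "norm (W n Q) \<le> psi_max" for n Q
      using W_le[of n Q] W_ge[of n Q] by simp
  qed blast
  have W_convergent: "convergent (\<lambda>n. W (k n) Q)" for Q
  proof (rule convergent_of_dense[where S = "\<rat> \<times> \<rat>"])
    show "\<exists>Q'\<in>\<rat> \<times> \<rat>. dist Q Q' < e" if "e > 0" for Q :: "real \<times> real" and e
    proof -
      obtain a b where a: "a \<in> \<rat>" "fst Q < a" "a < fst Q + e/2" and b: "b \<in> \<rat>" "snd Q < b" "b < snd Q + e/2"
        using Rats_dense_in_real[of "fst Q" "fst Q + e/2"] Rats_dense_in_real[of "snd Q" "snd Q + e/2"] \<open>e > 0\<close>
        by auto
      have "dist Q (a, b) \<le> dist (fst Q) a + dist (snd Q) b"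
        unfolding dist_prod_def by (simp add: sqrt_sum_squares_le_sum)
      also have "\<dots> < e" using a b by (simp add: dist_real_def)
      finally show ?thesis using a b by (intro bexI[of _ "(a, b)"]) auto
    qed
    show "\<exists>d>0. \<forall>n Q Q'. dist Q Q' < d \<longrightarrow> \<bar>W (k n) Q - W (k n) Q'\<bar> < e" if "e > 0" for e
      using equi[OF that] by blast
    show "convergent (\<lambda>n. W (k n) Q)" if "Q \<in> \<rat> \<times> \<rat>" for Q
      using k_conv[OF that] by (simp add: convergent_def)
  qed
  define w where "w Q = lim (\<lambda>n. W (k n) Q)" for Q
  obtain \<sigma> p0 where \<sigma>: "strict_mono (\<sigma> :: nat \<Rightarrow> nat)" and p0_meas[measurable]: "p0 \<in> borel_measurable borel"
    and p0_01: "\<And>Q. p0 Q \<in> {0..1}"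
    and p0_mono: "\<And>y s s'. s \<le> s' \<Longrightarrow> p0 (y, s) \<le> p0 (y, s')"
    and p0_weak: "\<And>g. integrable lborel g \<Longrightarrow> (\<lambda>n. LBINT Q. g Q * P (k (\<sigma> n)) Q) \<longlonglongrightarrow> (LBINT Q. g Q * p0 Q)"
    using weak_helly[of "\<lambda>n. P (k n)"] P_meas P01 P_mono by blast
  define m where "m n = k (\<sigma> n)" for n
  have m: "strict_mono m" unfolding m_def using k \<sigma> by (simp add: strict_mono_def)
  have hm: "(\<lambda>n. h (m n)) \<longlonglongrightarrow> 0"
    using LIMSEQ_subseq_LIMSEQ[OF h_lim m] by (simp add: o_def)
  have w_lim: "(\<lambda>n. W (m n) Q) \<longlonglongrightarrow> w Q" for Q
    using LIMSEQ_subseq_LIMSEQ[OF _ \<sigma>, of "\<lambda>n. W (k n) Q" "w Q"] W_convergent[of Q]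
    by (simp add: o_def m_def w_def convergent_LIMSEQ_iff)
  have w_equi: "\<exists>d>0. \<forall>Q Q'. dist Q Q' < d \<longrightarrow> \<bar>w Q - w Q'\<bar> \<le> e" if "e > 0" for e
  proof -
    obtain d where "d > 0" and d: "\<And>n Q Q'. dist Q Q' < d \<Longrightarrow> \<bar>W n Q - W n Q'\<bar> < e"
      using equi[OF \<open>e > 0\<close>] by blast
    have "\<bar>w Q - w Q'\<bar> \<le> e" if "dist Q Q' < d" for Q Q'
    proof (rule LIMSEQ_le_const2)
      show "(\<lambda>n. \<bar>W (m n) Q - W (m n) Q'\<bar>) \<longlonglongrightarrow> \<bar>w Q - w Q'\<bar>"
        by (intro tendsto_intros w_lim)
      show "\<exists>N. \<forall>n\<ge>N. \<bar>W (m n) Q - W (m n) Q'\<bar> \<le> e"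
        using d[OF that] by (auto intro: less_imp_le)
    qed
    with \<open>d > 0\<close> show ?thesis by blast
  qed
  have w_cont: "continuous_on UNIV w"
    unfolding continuous_on_iff dist_real_def
  proof (intro ballI allI impI)
    fix Q and e :: real assume "e > 0"
    then obtain d where "d > 0" "\<And>Q Q'. dist Q Q' < d \<Longrightarrow> \<bar>w Q - w Q'\<bar> \<le> e/2"
      using w_equi[of "e/2"] by auto
    then show "\<exists>d>0. \<forall>Q'\<in>UNIV. dist Q' Q < d \<longrightarrow> \<bar>w Q' - w Q\<bar> < e"
      using \<open>e > 0\<close> by (intro exI[of _ d]) (smt (verit) field_sum_of_halves)
  qed
  have [measurable]: "w \<in> borel_measurable borel"
    by (rule borel_measurable_continuous_onI[OF w_cont])
  have w_le: "w Q \<le> 0" for Q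
    by (rule LIMSEQ_le_const2[OF w_lim]) (use W_le in auto)
  have w_ge: "- psi_max \<le> w Q" for Q
    by (rule LIMSEQ_le_const[OF w_lim]) (use W_ge in auto)
  have w_0: "w (x, t) = 0" if "t \<le> 0" for x t
    using LIMSEQ_unique[OF w_lim[of "(x, t)"]] W_0[OF that] by simp
  have w_even: "w (- x, t) = w (x, t)" for x t
    using LIMSEQ_unique[OF w_lim[of "(- x, t)"], of "w (x, t)"] w_lim[of "(x, t)"] delay_sol_even[OF h]
    by (simp add: W_def)
  have w_anti: "w (x, t) \<le> w (x, s)" if "s \<le> t" for x s t
    by (rule LIMSEQ_le[OF w_lim w_lim]) (use delay_sol_antimono[OF h that] in \<open>auto simp: W_def\<close>)
  have P_even: "P n (- x, t) = P n (x, t)" for n x t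
    by (simp add: P_def ignite_def W_def delay_sol_even[OF h] \<psi>_even)
  \<comment> \<open>The weak limit inherits evenness only almost everywhere. Averaging with the
    reflection gives it everywhere and keeps the weak limit, because all \<open>P n\<close> are
    even.\<close>
  define p where "p Q = (p0 Q + p0 (- fst Q, snd Q)) / 2" for Q
  have refl_meas[measurable]: "(\<lambda>Q :: real \<times> real. (- fst Q, snd Q)) \<in> borel_measurable borel"
    by (intro borel_measurable_continuous_onI continuous_intros)
  have p_meas[measurable]: "p \<in> borel_measurable borel" unfolding p_def[abs_def] by measurable
  have p01: "p Q \<in> {0..1}" for Q
    using p0_01[of Q] p0_01[of "(- fst Q, snd Q)"] by (simp add: p_def)
  have p_even: "p (- x, t) = p (x, t)" for x t by (simp add: p_def)
  have p_mono: "p (x, s) \<le> p (x, t)" if "s \<le> t" for x s t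
    using p0_mono[OF that, of x] p0_mono[OF that, of "- x"] by (simp add: p_def)
  have p_weak: "(\<lambda>n. LBINT Q. g Q * P (m n) Q) \<longlonglongrightarrow> (LBINT Q. g Q * p Q)"
    if g: "integrable lborel g" for g
  proof -
    have [measurable]: "g \<in> borel_measurable borel" using g by auto
    let ?g' = "\<lambda>Q :: real \<times> real. g (- fst Q, snd Q)"
    have g': "integrable lborel ?g'"
    proof -
      have "integrable (distr lborel borel (\<lambda>Q. (- fst Q, snd Q))) g" unfolding lborel_reflect_fst by (rule g)
      then show ?thesis by (subst (asm) integrable_distr_eq) auto
    qed
    have r1: "(LBINT Q. ?g' Q * P n Q) = (LBINT Q. g Q * P n Q)" for n
      using integral_reflect_fst[of "\<lambda>Q. g Q * P n Q"] P_even by simp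
    have r2: "(LBINT Q. ?g' Q * p0 Q) = (LBINT Q. g Q * p0 (- fst Q, snd Q))"
      using integral_reflect_fst[of "\<lambda>Q. g Q * p0 (- fst Q, snd Q)"] by simp
    have i1: "integrable lborel (\<lambda>Q. g Q * p0 Q)"
      by (rule integrable_mult_unit[OF g _ p0_01]) simp
    have i2: "integrable lborel (\<lambda>Q. g Q * p0 (- fst Q, snd Q))"
      by (rule integrable_mult_unit[OF g _ p0_01]) simp
    have "(LBINT Q. g Q * p Q) = (LBINT Q. (g Q * p0 Q + g Q * p0 (- fst Q, snd Q)) / 2)"
      by (simp add: p_def algebra_simps)
    also have "\<dots> = ((LBINT Q. g Q * p0 Q) + (LBINT Q. g Q * p0 (- fst Q, snd Q))) / 2"
      using i1 i2 by simp
    finally have eq: "(LBINT Q. g Q * p Q) = ((LBINT Q. g Q * p0 Q) + (LBINT Q. ?g' Q * p0 Q)) / 2"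
      unfolding r2 .
    have "(\<lambda>n. ((LBINT Q. g Q * P (m n) Q) + (LBINT Q. ?g' Q * P (m n) Q)) / 2) \<longlonglongrightarrow> (LBINT Q. g Q * p Q)"
      unfolding eq m_def by (intro tendsto_divide tendsto_add p0_weak g g' tendsto_const) simp
    then show ?thesis unfolding r1 by simp
  qed
  let ?A = "\<lambda>n Q. W (m n) (Q - (0, h (m n)))"
  let ?\<psi> = "\<lambda>n Q. \<psi> (Q - (0, h (m n)))"
  \<comment> \<open>The vanishing delay does not affect the limit, thanks to the common modulus of
    continuity.\<close>
  have A_lim: "(\<lambda>n. ?A n Q) \<longlonglongrightarrow> w Q" for Q
  proof -
    have "(\<lambda>n. ?A n Q - W (m n) Q) \<longlonglongrightarrow> 0"
    proof (rule LIMSEQ_I)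
      fix e :: real assume "e > 0"
      then obtain d where "d > 0" and d: "\<And>n Q Q'. dist Q Q' < d \<Longrightarrow> \<bar>W n Q - W n Q'\<bar> < e"
        using equi by blast
      obtain N where N: "\<And>n. n \<ge> N \<Longrightarrow> \<bar>h (m n)\<bar> < d"
        using LIMSEQ_D[OF hm \<open>d > 0\<close>] by auto
      have "dist (Q - (0, h (m n))) Q = \<bar>h (m n)\<bar>" for n
        by (cases Q) (simp add: dist_norm)
      with N d show "\<exists>N. \<forall>n\<ge>N. norm (?A n Q - W (m n) Q - 0) < e"
        by (intro exI[of _ N]) auto
    qed
    from tendsto_add[OF this w_lim[of Q]] show ?thesis by simp
  qed
  have \<psi>_lim: "(\<lambda>n. ?\<psi> n Q) \<longlonglongrightarrow> \<psi> Q" for Q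
  proof (cases "snd Q > 0")
    case True
    have "(\<lambda>n. Q - (0, h (m n))) \<longlonglongrightarrow> Q - (0, 0)" by (intro tendsto_intros hm)
    then show ?thesis using isCont_tendsto_compose[OF isCont_\<psi>[OF True]] by (simp flip: zero_prod_def)
  next
    case False
    have "?\<psi> n Q = 0" for n
      using False h[of "m n"] \<psi>_eq_0[of "snd Q - h (m n)" "fst Q"] by (cases Q) simp
    moreover have "\<psi> Q = 0" using False \<psi>_eq_0[of "snd Q" "fst Q"] by simp
    ultimately show ?thesis by simp
  qed
  have fix_eq: "w R = lconv hk (\<lambda>Q. w Q - p Q * (w Q + \<psi> Q)) R" for R
  proof -
    define u where "u Q = w Q + \<psi> Q" for Q
    have [measurable]: "u \<in> borel_measurable borel" unfolding u_def[abs_def] by measurable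
    have u_bd: "\<bar>u Q\<bar> \<le> psi_max" for Q
      using w_le[of Q] w_ge[of Q] \<psi>_le[of Q] \<psi>_nonneg[of Q] unfolding u_def by linarith
    have hkR: "integrable lborel (\<lambda>Q. hk (R - Q))" by (rule integrable_reflect_at[OF integrable_hk])
    have int_u: "integrable lborel (\<lambda>Q. hk (R - Q) * u Q)"
      by (rule integrable_lconv[OF integrable_hk _ u_bd]) measurable
    have int_w: "integrable lborel (\<lambda>Q. hk (R - Q) * w Q)"
    proof (rule integrable_lconv[OF integrable_hk, where C = psi_max])
      show "\<bar>w Q\<bar> \<le> psi_max" for Q using w_le[of Q] w_ge[of Q] by linarith
    qed measurable
    \<comment> \<open>The source contains a product of two sequences. It is split so that
      \<open>V n\<close> converges pointwise with a fixed bound, while the weakly convergent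
      \<open>P (m n)\<close> is multiplied by the fixed function \<open>u\<close>.\<close>
    define V where "V n Q = ?A n Q - P (m n) Q * (?A n Q + ?\<psi> n Q - u Q)" for n Q
    have GV: "G (m n) Q = V n Q - P (m n) Q * u Q" for n Q
      by (simp add: G_def V_def P_def reac_def algebra_simps)
    have V_meas[measurable]: "V n \<in> borel_measurable borel" for n unfolding V_def[abs_def] by measurable
    have PU: "\<bar>P n Q * x\<bar> \<le> \<bar>x\<bar>" for n Q x
      using P01[of n Q] by (auto simp: abs_mult intro!: mult_left_le_one_le)
    have V_bd: "\<bar>V n Q\<bar> \<le> 3 * psi_max + 1" for n Q
      using GV[of n Q] G_bd[of "m n" Q] PU[of "m n" Q "u Q"] u_bd[of Q] psi_max_nonneg by linarith
    have V_lim: "(\<lambda>n. V n Q) \<longlonglongrightarrow> w Q" for Q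
    proof -
      have "(\<lambda>n. \<bar>?A n Q + ?\<psi> n Q - u Q\<bar>) \<longlonglongrightarrow> \<bar>w Q + \<psi> Q - u Q\<bar>"
        by (intro tendsto_intros A_lim \<psi>_lim)
      then have *: "(\<lambda>n. \<bar>?A n Q + ?\<psi> n Q - u Q\<bar>) \<longlonglongrightarrow> 0" by (simp add: u_def)
      have "(\<lambda>n. P (m n) Q * (?A n Q + ?\<psi> n Q - u Q)) \<longlonglongrightarrow> 0"
        by (rule Lim_null_comparison[OF _ *]) (use PU in \<open>auto intro!: always_eventually\<close>)
      from tendsto_diff[OF A_lim[of Q] this] show ?thesis by (simp add: V_def)
    qed
    have int_V: "integrable lborel (\<lambda>Q. hk (R - Q) * V n Q)" for n
      by (rule integrable_lconv[OF integrable_hk _ V_bd]) measurable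
    have int_uP: "integrable lborel (\<lambda>Q. hk (R - Q) * u Q * P (m n) Q)" for n
      by (rule integrable_mult_unit[OF int_u _ P01]) measurable
    have int_up: "integrable lborel (\<lambda>Q. hk (R - Q) * u Q * p Q)"
      by (rule integrable_mult_unit[OF int_u _ p01]) measurable
    have l1: "(\<lambda>n. LBINT Q. hk (R - Q) * V n Q) \<longlonglongrightarrow> (LBINT Q. hk (R - Q) * w Q)"
    proof (rule integral_dominated_convergence[where w = "\<lambda>Q. (3 * psi_max + 1) * hk (R - Q)"])
      show "integrable lborel (\<lambda>Q. (3 * psi_max + 1) * hk (R - Q))" using hkR by simp
      show "AE Q in lborel. (\<lambda>n. hk (R - Q) * V n Q) \<longlonglongrightarrow> hk (R - Q) * w Q"
        by (intro AE_I2 tendsto_mult_left V_lim)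
      show "AE Q in lborel. norm (hk (R - Q) * V n Q) \<le> (3 * psi_max + 1) * hk (R - Q)" for n
      proof (rule AE_I2)
        fix Q show "norm (hk (R - Q) * V n Q) \<le> (3 * psi_max + 1) * hk (R - Q)"
          using mult_left_mono[OF V_bd[of n Q] hk_nonneg[of "R - Q"]] hk_nonneg[of "R - Q"]
          by (simp add: abs_mult mult.commute)
      qed
    qed measurable
    have l2: "(\<lambda>n. LBINT Q. hk (R - Q) * u Q * P (m n) Q) \<longlonglongrightarrow> (LBINT Q. hk (R - Q) * u Q * p Q)"
      by (rule p_weak[OF int_u])
    have "W (m n) R = (LBINT Q. hk (R - Q) * V n Q) - (LBINT Q. hk (R - Q) * u Q * P (m n) Q)" for n
    proof -
      have "W (m n) R = (LBINT Q. hk (R - Q) * V n Q - hk (R - Q) * u Q * P (m n) Q)"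
        unfolding W_conv lconv_def GV by (simp add: algebra_simps)
      then show ?thesis using int_V int_uP by simp
    qed
    then have "(\<lambda>n. W (m n) R) \<longlonglongrightarrow> (LBINT Q. hk (R - Q) * w Q) - (LBINT Q. hk (R - Q) * u Q * p Q)"
      using tendsto_diff[OF l1 l2] by simp
    then have "w R = (LBINT Q. hk (R - Q) * w Q) - (LBINT Q. hk (R - Q) * u Q * p Q)"
      by (rule LIMSEQ_unique[OF w_lim])
    also have "\<dots> = (LBINT Q. hk (R - Q) * w Q - hk (R - Q) * u Q * p Q)"
      using int_w int_up by simp
    also have "\<dots> = lconv hk (\<lambda>Q. w Q - p Q * (w Q + \<psi> Q)) R"
      unfolding lconv_def u_def by (simp add: algebra_simps)
    finally show ?thesis .
  qed
  \<comment> \<open>Absence of ignition is a statement about all earlier times at once, so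
    convergence must be uniform on time intervals. A finite net and equicontinuity give
    this.\<close>
  have unif: "\<forall>\<^sub>F n in sequentially. \<forall>r\<in>{0..t}. \<bar>W (m n) (x, r) - w (x, r)\<bar> < e" if "e > 0" for e t x
  proof -
    obtain d1 where "d1 > 0" and d1: "\<And>n Q Q'. dist Q Q' < d1 \<Longrightarrow> \<bar>W n Q - W n Q'\<bar> < e/3"
      using equi[of "e/3"] \<open>e > 0\<close> by auto
    obtain d2 where "d2 > 0" and d2: "\<And>Q Q'. dist Q Q' < d2 \<Longrightarrow> \<bar>w Q - w Q'\<bar> \<le> e/3"
      using w_equi[of "e/3"] \<open>e > 0\<close> by auto
    define d where "d = min d1 d2"
    have "d > 0" using \<open>d1 > 0\<close> \<open>d2 > 0\<close> by (simp add: d_def)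
    have "compact {0..t}" by simp
    from seq_compact_imp_totally_bounded[OF this[unfolded compact_eq_seq_compact_metric]] \<open>d > 0\<close>
    obtain K where K: "finite K" "{0..t} \<subseteq> (\<Union>s\<in>K. ball s d)" by blast
    have "\<forall>\<^sub>F n in sequentially. \<forall>s\<in>K. \<bar>W (m n) (x, s) - w (x, s)\<bar> < e/3"
    proof (rule eventually_ball_finite[OF K(1)], rule ballI)
      fix s
      from LIMSEQ_D[OF w_lim[of "(x, s)"], of "e/3"] \<open>e > 0\<close>
      show "\<forall>\<^sub>F n in sequentially. \<bar>W (m n) (x, s) - w (x, s)\<bar> < e/3"
        by (auto simp: eventually_sequentially)
    qed
    then show ?thesis
    proof eventually_elim
      case (elim n)
      show ?case
      proof
        fix r assume "r \<in> {0..t}"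
        with K obtain s where s: "s \<in> K" "dist s r < d" by (auto simp: subset_iff)
        then have "dist (x, r) (x, s) < d1" "dist (x, r) (x, s) < d2"
          by (simp_all add: dist_prod_def dist_commute d_def)
        from d1[OF this(1), of "m n"] d2[OF this(2)] bspec[OF elim s(1)]
        show "\<bar>W (m n) (x, r) - w (x, r)\<bar> < e" by linarith
      qed
    qed
  qed
  have AE1: "AE Q in lborel. ignite w Q = 1 \<longrightarrow> p Q = 1"
  proof -
    have "AE Q in lborel. Q \<in> {Q. ignite w Q = 1} \<longrightarrow> p Q = 1"
    \<comment> \<open>One rational time above the threshold suffices: it stays above for large
      \<open>n\<close>, and before the delayed time as soon as the delay is small.\<close>
    proof (rule AE_eq_of_weak_limit[where F = "\<lambda>n. P (m n)"])
      have "Measurable.pred borel (\<lambda>Q. ignite w Q = 1)" by measurable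
      then show "{Q. ignite w Q = 1} \<in> sets borel" by (simp only: pred_def space_borel UNIV_I simp_thms)
      fix Q assume "Q \<in> {Q. ignite w Q = 1}"
      then obtain r where r: "r \<in> \<rat>" "0 < r" "r < snd Q" "w (fst Q, r) + \<psi> (fst Q, r) > ustar"
        by (auto simp: ignite_def)
      have "(\<lambda>n. W (m n) (fst Q, r) + \<psi> (fst Q, r)) \<longlonglongrightarrow> w (fst Q, r) + \<psi> (fst Q, r)"
        by (intro tendsto_intros w_lim)
      from order_tendstoD(1)[OF this r(4)]
      have e1: "\<forall>\<^sub>F n in sequentially. W (m n) (fst Q, r) + \<psi> (fst Q, r) > ustar" .
      have "0 < snd Q - r" using r by simp
      from order_tendstoD(2)[OF hm this] have e2: "\<forall>\<^sub>F n in sequentially. h (m n) < snd Q - r" .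
      have "\<forall>\<^sub>F n in sequentially. P (m n) Q = 1"
        using e1 e2
      proof eventually_elim
        case (elim n)
        then show ?case unfolding P_def ignite_def using r by (auto intro!: bexI[of _ r])
      qed
      then show "(\<lambda>n. P (m n) Q) \<longlonglongrightarrow> 1" by (rule tendsto_eventually)
    qed (use P01 p01 p_weak in auto)
    then show ?thesis by simp
  qed
  have AE0: "AE Q in lborel. (\<exists>c\<in>\<rat>. c < ustar \<and> (\<forall>r\<in>\<rat>. 0 < r \<and> r < snd Q \<longrightarrow> w (fst Q, r) + \<psi> (fst Q, r) \<le> c)) \<longrightarrow> p Q = 0"
  proof -
    let ?B = "\<lambda>c r. {Q. 0 < r \<and> r < snd Q \<longrightarrow> w (fst Q, r) + \<psi> (fst Q, r) \<le> c}"
    have "AE Q in lborel. Q \<in> (\<Union>c\<in>{c\<in>\<rat>. c < ustar}. \<Inter>r\<in>\<rat>. ?B c r) \<longrightarrow> p Q = 0"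
    proof (rule AE_eq_of_weak_limit[where F = "\<lambda>n. P (m n)"])
      have B: "?B c r \<in> sets borel" for c r
      proof -
        have "Measurable.pred borel (\<lambda>Q. 0 < r \<and> r < snd Q \<longrightarrow> w (fst Q, r) + \<psi> (fst Q, r) \<le> c)"
          unfolding borel_prod[symmetric] by measurable
        then show ?thesis by (simp only: pred_def space_borel UNIV_I simp_thms)
      qed
      have U: "UNIV \<in> sets (borel :: (real \<times> real) measure)" by simp
      have "(\<Inter>r\<in>\<rat>. ?B c r) \<in> sets borel" for c
        by (rule sets.countable_INT''[OF U countable_rat B])
      moreover have "countable {c \<in> \<rat>. c < ustar}"
        by (rule countable_subset[OF _ countable_rat]) blast
      ultimately show "(\<Union>c\<in>{c\<in>\<rat>. c < ustar}. \<Inter>r\<in>\<rat>. ?B c r) \<in> sets borel"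
        by (intro sets.countable_UN'')
      fix Q assume "Q \<in> (\<Union>c\<in>{c\<in>\<rat>. c < ustar}. \<Inter>r\<in>\<rat>. ?B c r)"
      then obtain c where c: "c < ustar" "\<And>r. r \<in> \<rat> \<Longrightarrow> 0 < r \<Longrightarrow> r < snd Q \<Longrightarrow> w (fst Q, r) + \<psi> (fst Q, r) \<le> c"
        by blast
      \<comment> \<open>The margin ustar - c is the accuracy at which uniform convergence excludes
        ignition for large \<open>n\<close>.\<close>
      from c(1) have "ustar - c > 0" by simp
      from unif[OF this, of "snd Q" "fst Q"]
      have "\<forall>\<^sub>F n in sequentially. P (m n) Q = 0"
      proof eventually_elim
        case (elim n)
        have "\<not> (\<exists>r\<in>\<rat>. 0 < r \<and> r < snd Q - h (m n) \<and> W (m n) (fst Q, r) + \<psi> (fst Q, r) > ustar)"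
        proof
          assume "\<exists>r\<in>\<rat>. 0 < r \<and> r < snd Q - h (m n) \<and> W (m n) (fst Q, r) + \<psi> (fst Q, r) > ustar"
          then obtain r where r: "r \<in> \<rat>" "0 < r" "r < snd Q - h (m n)" "W (m n) (fst Q, r) + \<psi> (fst Q, r) > ustar" by blast
          with h[of "m n"] have "r < snd Q" by linarith
          with c(2)[OF r(1,2)] bspec[OF elim, of r] r show False by auto
        qed
        then show ?case by (simp add: P_def ignite_def)
      qed
      then show "(\<lambda>n. P (m n) Q) \<longlonglongrightarrow> 0" by (rule tendsto_eventually)
    qed (use P01 p01 p_weak in auto)
    then show ?thesis by eventually_elim blast
  qed
  have AEs: "AE Q in lborel. snd Q > (fst Q)\<^sup>2 / \<alpha>\<^sup>2 \<longrightarrow> p Q = p (Q + (0, real n))" for n :: nat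
  proof -
    let ?c = "(0, real n) :: real \<times> real"
    \<comment> \<open>The axis x = 0 is left out because there the parabola degenerates to time 0,
      where \<psi> is not continuous; it is a null set and is discarded at the end.\<close>
    let ?A = "{Q. snd Q > (fst Q)\<^sup>2 / \<alpha>\<^sup>2 \<and> fst Q \<noteq> 0}"
    have "AE Q in lborel. Q \<in> ?A \<longrightarrow> p Q - p (Q + ?c) = 0"
    proof (rule AE_eq_of_weak_limit[where F = "\<lambda>j Q. P (m j) Q - P (m j) (Q + ?c)"])
      have "open ?A"
        using alpha_pos by (intro open_Collect_conj open_Collect_less open_Collect_neq continuous_intros) auto
      then show "?A \<in> sets borel" by simp
      show "\<bar>P (m j) Q - P (m j) (Q + ?c)\<bar> \<le> 1" for j Q
        using P01[of "m j" Q] P01[of "m j" "Q + ?c"] unfolding atLeastAtMost_iff by linarith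
      show "\<bar>p Q - p (Q + ?c)\<bar> \<le> 1" for Q
        using p01[of Q] p01[of "Q + ?c"] unfolding atLeastAtMost_iff by linarith
    next
      fix g :: "real \<times> real \<Rightarrow> real" assume g: "integrable lborel g"
      have [measurable]: "g \<in> borel_measurable borel" using g by auto
      have g': "integrable lborel (\<lambda>Q. g (- ?c + Q))" by (rule integrable_translate[OF g])
      have shift: "(LBINT Q. g Q * H (Q + ?c)) = (LBINT Q. g (- ?c + Q) * H Q)"
        if [measurable]: "H \<in> borel_measurable borel" for H :: "real \<times> real \<Rightarrow> real"
      proof -
        have "g Q * H (Q + ?c) = g (- ?c + (?c + Q)) * H (?c + Q)" for Q
          by (simp only: minus_add_cancel add.commute[of Q])
        then show ?thesis
          using integral_translate[of "\<lambda>Q. g (- ?c + Q) * H Q" ?c] by simp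
      qed
      have diff: "(LBINT Q. g Q * (H Q - H (Q + ?c))) = (LBINT Q. g Q * H Q) - (LBINT Q. g (- ?c + Q) * H Q)"
        if H: "H \<in> borel_measurable borel" "\<And>Q. H Q \<in> {0..1}" for H :: "real \<times> real \<Rightarrow> real"
      proof -
        have [measurable]: "H \<in> borel_measurable borel" by fact
        have "integrable lborel (\<lambda>Q. g Q * H Q)" by (rule integrable_mult_unit[OF g _ H(2)]) measurable
        moreover have "integrable lborel (\<lambda>Q. g Q * H (Q + ?c))" by (rule integrable_mult_unit[OF g _ H(2)]) measurable
        ultimately show ?thesis unfolding shift[OF H(1), symmetric] by (simp add: right_diff_distrib)
      qed
      show "(\<lambda>j. LBINT Q. g Q * (P (m j) Q - P (m j) (Q + ?c))) \<longlonglongrightarrow> (LBINT Q. g Q * (p Q - p (Q + ?c)))"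
        unfolding diff[OF P_meas P01] diff[OF p_meas p01] by (intro tendsto_diff p_weak g g')
    next
      fix Q assume "Q \<in> ?A"
      then have Q: "snd Q > (fst Q)\<^sup>2 / \<alpha>\<^sup>2" "fst Q \<noteq> 0" by auto
      then have "0 < snd Q - (fst Q)\<^sup>2 / \<alpha>\<^sup>2" by simp
      \<comment> \<open>For small delay the delayed times still lie behind the parabola, so ignition
        already takes its final value there.\<close>
      from order_tendstoD(2)[OF hm this]
      have "\<forall>\<^sub>F j in sequentially. P (m j) Q - P (m j) (Q + ?c) = 0"
      proof eventually_elim
        case (elim j)
        then have "snd Q - h (m j) > (fst Q)\<^sup>2 / \<alpha>\<^sup>2" "snd Q + real n - h (m j) > (fst Q)\<^sup>2 / \<alpha>\<^sup>2" by auto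
        then have "ignite (W (m j)) (fst Q, snd Q - h (m j)) = ignite (W (m j)) (fst Q, snd Q + real n - h (m j))"
          unfolding W_def by (intro antisym ignite_delay_sol_const[OF h Q(2)])
        then show ?case by (cases Q) (simp add: P_def)
      qed
      then show "(\<lambda>j. P (m j) Q - P (m j) (Q + ?c)) \<longlonglongrightarrow> 0" by (rule tendsto_eventually)
    qed auto
    moreover have "AE Q in (lborel :: (real \<times> real) measure). fst Q \<noteq> 0"
    proof -
      have "{Q :: real \<times> real. fst Q = 0} = {0} \<times> UNIV" by auto
      then have "{Q :: real \<times> real. fst Q = 0} \<in> null_sets lborel"
        by (simp add: null_sets_def lborel_prod[symmetric] lborel.emeasure_pair_measure_Times)
      from AE_not_in[OF this] show ?thesis by simp
    qed
    ultimately show ?thesis by eventually_elim auto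
  qed
  show thesis
    by (rule that[OF w_cont _ w_0 w_even w_anti p_meas p01 p_even p_mono fix_eq AE1 AE0 AEs]) (use w_le w_ge in simp)
qed

end

section \<open>Derivative and weak form of the potential\<close>

text \<open>Joint integrability for Fubini, from the bound C |f| times the L1 norm of
  \<open>k\<close>. The map \<open>c\<close> covers two uses: horizontal lines of fixed time for the
  x-derivative, and the identity of the plane for the weak form.\<close>

lemma integrable_weighted_lconv:
  fixes f :: "'b::euclidean_space \<Rightarrow> real" and c :: "'b \<Rightarrow> 'a::euclidean_space"
  assumes f: "integrable lborel f" and c[measurable]: "c \<in> borel_measurable borel"
    and k: "integrable lborel k" and G[measurable]: "G \<in> borel_measurable borel" and bd: "\<And>Q. \<bar>G Q\<bar> \<le> C"
  shows "integrable (lborel \<Otimes>\<^sub>M lborel) (\<lambda>(x, Q). f x * (k (c x - Q) * G Q))"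
proof (rule lborel_pair.Fubini_integrable)
  have [measurable]: "f \<in> borel_measurable borel" "k \<in> borel_measurable borel" using f k by auto
  show m: "(\<lambda>(x, Q). f x * (k (c x - Q) * G Q)) \<in> borel_measurable (lborel \<Otimes>\<^sub>M lborel)" by measurable
  have int: "integrable lborel (\<lambda>Q. f x * (k (c x - Q) * G Q))" for x
    by (intro integrable_mult_right integrable_lconv[OF k G bd])
  then show "AE x in lborel. integrable lborel (\<lambda>Q. case (x, Q) of (x, Q) \<Rightarrow> f x * (k (c x - Q) * G Q))" by simp
  show "integrable lborel (\<lambda>x. LBINT Q. norm (case (x, Q) of (x, Q) \<Rightarrow> f x * (k (c x - Q) * G Q)))"
  proof (rule Bochner_Integration.integrable_bound)
    show "integrable lborel (\<lambda>x. f x * (C * (LBINT Q. \<bar>k Q\<bar>)))" using f by simp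
    show "(\<lambda>x. LBINT Q. norm (case (x, Q) of (x, Q) \<Rightarrow> f x * (k (c x - Q) * G Q))) \<in> borel_measurable lborel"
      by measurable
    show "AE x in lborel. norm (LBINT Q. norm (case (x, Q) of (x, Q) \<Rightarrow> f x * (k (c x - Q) * G Q)))
        \<le> norm (f x * (C * (LBINT Q. \<bar>k Q\<bar>)))"
    proof (rule AE_I2)
      fix x
      have "0 \<le> C" using bd[of 0] by linarith
      have "(LBINT Q. \<bar>f x * (k (c x - Q) * G Q)\<bar>) \<le> (LBINT Q. \<bar>f x\<bar> * (C * \<bar>k (c x - Q)\<bar>))"
      proof (rule integral_mono)
        show "integrable lborel (\<lambda>Q. \<bar>f x * (k (c x - Q) * G Q)\<bar>)" by (intro integrable_abs int)
        show "integrable lborel (\<lambda>Q. \<bar>f x\<bar> * (C * \<bar>k (c x - Q)\<bar>))"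
          by (intro integrable_mult_right integrable_abs integrable_reflect_at k)
        fix Q
        have "\<bar>k (c x - Q)\<bar> * \<bar>G Q\<bar> \<le> C * \<bar>k (c x - Q)\<bar>"
          using mult_left_mono[OF bd[of Q] abs_ge_zero[of "k (c x - Q)"]] by (simp add: mult.commute)
        then show "\<bar>f x * (k (c x - Q) * G Q)\<bar> \<le> \<bar>f x\<bar> * (C * \<bar>k (c x - Q)\<bar>)"
          by (simp add: abs_mult mult_left_mono)
      qed
      also have "\<dots> = \<bar>f x\<bar> * (C * (LBINT Q. \<bar>k Q\<bar>))"
        using integral_reflect_at[of "\<lambda>Q. \<bar>k Q\<bar>" "c x"] by simp
      finally have "(LBINT Q. \<bar>f x * (k (c x - Q) * G Q)\<bar>) \<le> \<bar>f x\<bar> * (C * (LBINT Q. \<bar>k Q\<bar>))" .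
      moreover have "0 \<le> (LBINT Q. \<bar>f x * (k (c x - Q) * G Q)\<bar>)" by simp
      ultimately show "norm (LBINT Q. norm (case (x, Q) of (x, Q) \<Rightarrow> f x * (k (c x - Q) * G Q)))
        \<le> norm (f x * (C * (LBINT Q. \<bar>k Q\<bar>)))"
        using \<open>0 \<le> C\<close> by (simp add: abs_mult)
    qed
  qed
qed

lemma integral_weighted_lconv:
  fixes f :: "'b::euclidean_space \<Rightarrow> real" and c :: "'b \<Rightarrow> 'a::euclidean_space"
  assumes f: "integrable lborel f" and c[measurable]: "c \<in> borel_measurable borel"
    and k: "integrable lborel k" and G[measurable]: "G \<in> borel_measurable borel" and bd: "\<And>Q. \<bar>G Q\<bar> \<le> C"
  shows "integrable lborel (\<lambda>x. f x * lconv k G (c x))"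
    and "integrable lborel (\<lambda>Q. (LBINT x. f x * k (c x - Q)) * G Q)"
    and "(LBINT x. f x * lconv k G (c x)) = (LBINT Q. (LBINT x. f x * k (c x - Q)) * G Q)"
proof -
  note int = integrable_weighted_lconv[OF assms]
  have e1: "(LBINT Q. f x * (k (c x - Q) * G Q)) = f x * lconv k G (c x)" for x
    by (simp add: lconv_def)
  have e2: "(LBINT x. f x * (k (c x - Q) * G Q)) = (LBINT x. f x * k (c x - Q)) * G Q" for Q
    by (simp add: mult.assoc[symmetric])
  show "integrable lborel (\<lambda>x. f x * lconv k G (c x))"
    using lborel_pair.integrable_fst[OF int] unfolding e1 .
  show "integrable lborel (\<lambda>Q. (LBINT x. f x * k (c x - Q)) * G Q)"
    using lborel_pair.integrable_snd[OF int] unfolding e2 .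
  show "(LBINT x. f x * lconv k G (c x)) = (LBINT Q. (LBINT x. f x * k (c x - Q)) * G Q)"
    using lborel_pair.Fubini_integral[OF int] unfolding e1 e2 by simp
qed

lemma hk_has_derivative: "((\<lambda>x. hk (x, t)) has_real_derivative hkx (x, t)) (at x)"
proof (cases "t > 0")
  case True
  define K where "K = exp (- t) * (1 / sqrt (2 * pi * (2 * t)))"
  have eq: "(\<lambda>x. hk (x, t)) = (\<lambda>x. K * exp (- x\<^sup>2 / (2 * (2 * t))))"
    using True by (simp add: hk_def normal_density_def K_def)
  have "((\<lambda>x. K * exp (- x\<^sup>2 / (2 * (2 * t)))) has_real_derivative
     - (x / (2 * t)) * (K * exp (- x\<^sup>2 / (2 * (2 * t))))) (at x)"
    using True by (auto intro!: derivative_eq_intros)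
  then show ?thesis
    using fun_cong[OF eq, of x] unfolding eq by (simp add: hkx_def)
qed (simp add: hk_eq_0 hkx_eq_0)

lemma continuous_hkx_fst: "continuous_on A (\<lambda>x. hkx (x, t))"
proof (cases "t > 0")
  case True
  define K where "K = exp (- t) * (1 / sqrt (2 * pi * (2 * t)))"
  have eq: "(\<lambda>x. hkx (x, t)) = (\<lambda>x. - (x / (2 * t)) * (K * exp (- x\<^sup>2 / (2 * (2 * t)))))"
    using True by (simp add: hkx_def hk_def normal_density_def K_def)
  show ?thesis unfolding eq using True by (intro continuous_intros) auto
qed (simp add: hkx_eq_0)

text \<open>The singularity at time 0 makes differentiation under the integral awkward. Instead the
  convolution with \<open>hkx\<close> is integrated in x: Fubini and the fundamental theorem for the
  kernel give the increment of the convolution with \<open>hk\<close>, and the continuous integrand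
  is then the derivative.\<close>

lemma lconv_hk_has_derivative:
  assumes G[measurable]: "G \<in> borel_measurable borel" and bd: "\<And>Q. \<bar>G Q\<bar> \<le> C"
  shows "((\<lambda>x. lconv hk G (x, t)) has_real_derivative lconv hkx G (x, t)) (at x)"
proof -
  have ctm: "(\<lambda>x. (x, t)) \<in> borel_measurable (borel :: real measure)"
    by (intro borel_measurable_continuous_onI continuous_intros)
  have cont: "continuous_on A (\<lambda>x. lconv hkx G (x, t))" for A
    using continuous_on_compose2[OF continuous_lconv[OF integrable_hkx AE_isCont_hkx G bd], of A "\<lambda>x. (x, t)"]
    by (simp add: continuous_intros)
  \<comment> \<open>The base point x - 1 makes x an interior point of the interval of integration,
    so that a two-sided derivative results.\<close>
  define a where "a = x - 1"
  have FTC: "lconv hk G (y, t) = lconv hk G (a, t) + integral {a..y} (\<lambda>x. lconv hkx G (x, t))" if "a \<le> y" for y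
  proof -
    have ind: "integrable lborel (indicator {a..y} :: real \<Rightarrow> real)"
      using that by (intro integrable_real_indicator) simp_all
    have k: "(LBINT x. indicator {a..y} x * hkx ((x, t) - Q)) = hk ((y, t) - Q) - hk ((a, t) - Q)" for Q
    proof -
      obtain q s where Q: "Q = (q, s)" by fastforce
      have "((\<lambda>x. hk (x - q, t - s)) has_real_derivative hkx (x - q, t - s)) (at x)" for x
      proof -
        have d: "((\<lambda>x. x - q) has_real_derivative 1) (at x)" by (auto intro!: derivative_eq_intros)
        show ?thesis
          using DERIV_chain2[where f = "\<lambda>x. hk (x, t - s)" and g = "\<lambda>x. x - q" and Db = 1 and s = UNIV,
            OF hk_has_derivative[of "t - s" "x - q"] d] by simp
      qed
      then have "(LBINT x. indicator {a..y} x *\<^sub>R hkx (x - q, t - s)) = hk (y - q, t - s) - hk (a - q, t - s)"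
        using that
        by (intro integral_FTC_atLeastAtMost)
           (auto simp: has_real_derivative_iff_has_vector_derivative[symmetric] intro: DERIV_subset
             intro!: continuous_on_compose2[OF continuous_hkx_fst[of UNIV "t - s"]] continuous_intros)
      then show ?thesis by (simp add: Q)
    qed
    have "integral {a..y} (\<lambda>x. lconv hkx G (x, t)) = (LBINT x. indicator {a..y} x * lconv hkx G (x, t))"
      using set_borel_integral_eq_integral(2)[OF borel_integrable_atLeastAtMost'[OF cont[of "{a..y}"]]]
      unfolding set_lebesgue_integral_def by simp
    also have "\<dots> = (LBINT Q. (LBINT x. indicator {a..y} x * hkx ((x, t) - Q)) * G Q)"
      by (rule integral_weighted_lconv(3)[OF ind ctm integrable_hkx G bd])
    also have "\<dots> = (LBINT Q. hk ((y, t) - Q) * G Q - hk ((a, t) - Q) * G Q)"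
      unfolding k by (simp add: left_diff_distrib)
    also have "\<dots> = lconv hk G (y, t) - lconv hk G (a, t)"
      unfolding lconv_def
      by (intro Bochner_Integration.integral_diff integrable_lconv[OF integrable_hk G bd])
    finally show ?thesis by simp
  qed
  have "((\<lambda>y. integral {a..y} (\<lambda>x. lconv hkx G (x, t))) has_real_derivative lconv hkx G (x, t)) (at x within {a..x + 1})"
    by (rule integral_has_real_derivative[OF cont]) (simp add: a_def)
  from DERIV_add[OF DERIV_const[of "lconv hk G (a, t)"] this]
  have "((\<lambda>y. lconv hk G (a, t) + integral {a..y} (\<lambda>x. lconv hkx G (x, t))) has_real_derivative lconv hkx G (x, t)) (at x within {a..x + 1})"
    by simp
  then have "((\<lambda>y. lconv hk G (y, t)) has_real_derivative lconv hkx G (x, t)) (at x within {a..x + 1})"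
  proof (rule has_field_derivative_transform_within[OF _ zero_less_one])
    show "x \<in> {a..x + 1}" by (simp add: a_def)
    show "lconv hk G (a, t) + integral {a..y} (\<lambda>x. lconv hkx G (x, t)) = lconv hk G (y, t)" if "y \<in> {a..x + 1}" for y
      using FTC[symmetric] that by (simp only: atLeastAtMost_iff)
  qed
  moreover have "at x within {a..x + 1} = at x"
    by (rule at_within_interior) (simp add: a_def)
  ultimately show ?thesis by simp
qed

text \<open>The kernel is the law of \<open>(\<surd>(2 \<tau>) z, \<tau>)\<close> for a standard normal \<open>z\<close> and an exponential \<open>\<tau>\<close>.\<close>

definition seed :: "real \<times> real \<Rightarrow> real" where
  "seed Q = std_normal_density (fst Q) * (indicator {0<..} (snd Q) * exp (- snd Q))"

definition spread :: "real \<times> real \<Rightarrow> real \<times> real" where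
  "spread Q = (sqrt (2 * snd Q) * fst Q, snd Q)"

lemma spread_measurable[measurable]: "spread \<in> borel_measurable borel"
  unfolding spread_def[abs_def] by (intro borel_measurable_continuous_onI continuous_intros)

lemma seed_measurable[measurable]: "seed \<in> borel_measurable borel"
  unfolding seed_def[abs_def] borel_prod[symmetric] by measurable

lemma seed_nonneg: "0 \<le> seed Q" by (simp add: seed_def)

lemma scale_normal_density: "s > 0 \<Longrightarrow> s * normal_density 0 s (s * z) = std_normal_density z"
  by (simp add: normal_density_def real_sqrt_mult power_mult_distrib)

text \<open>Substitution of sqrt (2 \<tau>) z for x in each time slice. In the new variables a fixed
  z describes a curve along which a test function can be differentiated once.\<close>

lemma density_hk_eq_distr: "density lborel hk = distr (density lborel seed) borel spread"
proof (rule measure_eqI)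
  fix A :: "(real \<times> real) set" assume "A \<in> sets (density lborel hk)"
  then have [measurable]: "A \<in> sets borel" by simp
  have fib[measurable]: "{x. (x, \<tau>) \<in> A} \<in> sets borel" for \<tau>
  proof -
    have "(\<lambda>x. (x, \<tau>)) -` A \<inter> space borel \<in> sets (borel :: real measure)"
      by (rule measurable_sets[OF borel_measurable_continuous_onI]) (auto intro!: continuous_intros)
    then show ?thesis by (simp add: vimage_def)
  qed
  have inner: "(\<integral>\<^sup>+ x. ennreal (hk (x, \<tau>)) * indicator A (x, \<tau>) \<partial>lborel)
      = (\<integral>\<^sup>+ z. ennreal (seed (z, \<tau>)) * indicator A (spread (z, \<tau>)) \<partial>lborel)" for \<tau>
  proof (cases "\<tau> > 0")
    case True
    let ?c = "sqrt (2 * \<tau>)"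
    have c: "?c > 0" using True by simp
    have m: "(\<lambda>x. ennreal (hk (x, \<tau>)) * indicator A (x, \<tau>)) \<in> borel_measurable borel"
      by (rule measurable_compose[where g = "\<lambda>Q. ennreal (hk Q) * indicator A Q", of "\<lambda>x. (x, \<tau>)" borel borel])
         (auto intro!: borel_measurable_continuous_onI continuous_intros)
    have "(\<integral>\<^sup>+ x. ennreal (hk (x, \<tau>)) * indicator A (x, \<tau>) \<partial>lborel)
      = ennreal \<bar>?c\<bar> * (\<integral>\<^sup>+ z. ennreal (hk (0 + ?c * z, \<tau>)) * indicator A (0 + ?c * z, \<tau>) \<partial>lborel)"
      using c by (intro nn_integral_real_affine m) simp
    also have "\<dots> = (\<integral>\<^sup>+ z. ennreal \<bar>?c\<bar> * (ennreal (hk (0 + ?c * z, \<tau>)) * indicator A (0 + ?c * z, \<tau>)) \<partial>lborel)"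
    proof (rule nn_integral_cmult[symmetric])
      show "(\<lambda>z. ennreal (hk (0 + ?c * z, \<tau>)) * indicator A (0 + ?c * z, \<tau>)) \<in> borel_measurable lborel"
        using measurable_compose[OF _ m, of "\<lambda>z. 0 + ?c * z" lborel] by simp
    qed
    also have "\<dots> = (\<integral>\<^sup>+ z. ennreal (seed (z, \<tau>)) * indicator A (spread (z, \<tau>)) \<partial>lborel)"
    proof (intro nn_integral_cong)
      fix z
      have "?c * hk (?c * z, \<tau>) = seed (z, \<tau>)"
        using True scale_normal_density[OF c, of z] by (simp add: hk_def seed_def)
      then have "ennreal \<bar>?c\<bar> * ennreal (hk (?c * z, \<tau>)) = ennreal (seed (z, \<tau>))"
        using c by (simp add: ennreal_mult'[symmetric] del: real_sqrt_mult)
      then show "ennreal \<bar>?c\<bar> * (ennreal (hk (0 + ?c * z, \<tau>)) * indicator A (0 + ?c * z, \<tau>))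
          = ennreal (seed (z, \<tau>)) * indicator A (spread (z, \<tau>))"
        by (simp add: spread_def mult.assoc[symmetric])
    qed
    finally show ?thesis .
  next
    case False
    then have "hk (x, \<tau>) = 0" "seed (x, \<tau>) = 0" for x by (simp_all add: hk_eq_0 seed_def)
    then show ?thesis by simp
  qed
  have "emeasure (density lborel hk) A = (\<integral>\<^sup>+ Q. ennreal (hk Q) * indicator A Q \<partial>lborel)"
    by (simp add: emeasure_density)
  also have "\<dots> = (\<integral>\<^sup>+ Q. ennreal (seed Q) * indicator A (spread Q) \<partial>lborel)"
    by (subst (1 2) nn_integral_lborel_prod) (simp_all add: inner)
  also have "\<dots> = emeasure (density lborel seed) (spread -` A)"
  proof -
    have "spread -` A \<in> sets borel"
      using measurable_sets[OF spread_measurable, of A] by simp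
    then show ?thesis by (simp add: emeasure_density indicator_def)
  qed
  also have "\<dots> = emeasure (distr (density lborel seed) borel spread) A"
    by (subst emeasure_distr) simp_all
  finally show "emeasure (density lborel hk) A = emeasure (distr (density lborel seed) borel spread) A" .
qed simp

lemma integral_hk_eq:
  fixes g :: "real \<times> real \<Rightarrow> real"
  assumes [measurable]: "g \<in> borel_measurable borel" and int: "integrable lborel (\<lambda>Q. hk Q * g Q)"
  shows "integrable lborel (\<lambda>Q. seed Q * g (spread Q))"
    and "(LBINT Q. hk Q * g Q) = (LBINT Q. seed Q * g (spread Q))"
proof -
  have "integrable (density lborel hk) g"
    using int by (subst integrable_density) (auto simp: hk_nonneg)
  then have "integrable (density lborel seed) (\<lambda>Q. g (spread Q))"
    unfolding density_hk_eq_distr by (subst (asm) integrable_distr_eq) auto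
  then show "integrable lborel (\<lambda>Q. seed Q * g (spread Q))"
    by (subst (asm) integrable_density) (auto simp: seed_nonneg)
  have "(LBINT Q. hk Q * g Q) = (\<integral>Q. g Q \<partial>density lborel hk)"
    by (subst integral_density) (auto simp: hk_nonneg)
  also have "\<dots> = (\<integral>Q. g (spread Q) \<partial>density lborel seed)"
    unfolding density_hk_eq_distr by (subst integral_distr) auto
  also have "\<dots> = (LBINT Q. seed Q * g (spread Q))"
    by (subst integral_density) (auto simp: seed_nonneg)
  finally show "(LBINT Q. hk Q * g Q) = (LBINT Q. seed Q * g (spread Q))" .
qed

text \<open>Extension by 0 turns strip integrals into integrals over the plane, where Fubini and the
  convolution lemmas apply.\<close>

definition on_strip :: "real \<Rightarrow> (real \<Rightarrow> real \<Rightarrow> real) \<Rightarrow> real \<times> real \<Rightarrow> real" where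
  "on_strip T f Q = (if snd Q \<in> {0..T} then f (fst Q) (snd Q) else 0)"

lemma on_strip_props:
  assumes cont: "continuous_on (UNIV \<times> {0..T}) (\<lambda>(x, t). f x t)"
    and supp: "\<And>x t. t \<in> {0..T} \<Longrightarrow> \<bar>x\<bar> > R \<Longrightarrow> f x t = 0"
  shows "on_strip T f \<in> borel_measurable borel"
    and "\<exists>B. \<forall>Q. \<bar>on_strip T f Q\<bar> \<le> B"
    and "integrable lborel (on_strip T f)"
proof -
  have eq: "on_strip T f = (\<lambda>Q. indicator (UNIV \<times> {0..T}) Q *\<^sub>R (\<lambda>(x, t). f x t) Q)"
    by (auto simp: on_strip_def fun_eq_iff indicator_def)
  have "closed (UNIV \<times> {0..T} :: (real \<times> real) set)" by (intro closed_Times) auto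
  then show m[measurable]: "on_strip T f \<in> borel_measurable borel"
    unfolding eq by (intro borel_measurable_continuous_on_indicator cont) simp
  define K where "K = {-R..R} \<times> {0..T}"
  have "compact K" unfolding K_def by (intro compact_Times) auto
  have "compact ((\<lambda>(x, t). f x t) ` K)"
    by (rule compact_continuous_image[OF continuous_on_subset[OF cont] \<open>compact K\<close>]) (auto simp: K_def)
  from compact_imp_bounded[OF this] obtain B where "\<forall>y\<in>(\<lambda>(x, t). f x t) ` K. norm y \<le> B"
    unfolding bounded_iff by blast
  then have B: "\<bar>(\<lambda>(x, t). f x t) Q\<bar> \<le> B" if "Q \<in> K" for Q
    using that by (auto simp: real_norm_def)
  have le: "\<bar>on_strip T f Q\<bar> \<le> \<bar>B\<bar> * indicator K Q" for Q
  proof (cases "Q \<in> K")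
    case True
    then show ?thesis using B[OF True] by (auto simp: on_strip_def K_def)
  next
    case False
    then have "on_strip T f Q = 0"
      using supp[of "snd Q" "fst Q"] by (cases Q) (auto simp: on_strip_def K_def)
    then show ?thesis by simp
  qed
  then have "\<bar>on_strip T f Q\<bar> \<le> \<bar>B\<bar>" for Q
    using le[of Q] by (cases "Q \<in> K") auto
  then show "\<exists>B. \<forall>Q. \<bar>on_strip T f Q\<bar> \<le> B" by blast
  have "K \<in> sets borel" using \<open>compact K\<close> by (simp add: borel_compact)
  moreover have "emeasure lborel K < \<infinity>"
    using \<open>compact K\<close> by (intro emeasure_bounded_finite compact_imp_bounded)
  ultimately have "integrable lborel (\<lambda>Q. \<bar>B\<bar> * indicator K Q :: real)" by simp
  then show "integrable lborel (on_strip T f)"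
    by (rule Bochner_Integration.integrable_bound) (use le in \<open>auto simp: abs_mult\<close>)
qed

section \<open>The kernel against test functions\<close>

locale test_function =
  fixes T R :: real and \<phi> \<phi>x \<phi>t :: "real \<Rightarrow> real \<Rightarrow> real"
  assumes T_pos: "T > 0"
    and C11: "C11_deriv T \<phi> \<phi>x \<phi>t"
    and supp: "\<And>x t. t \<in> {0..T} \<Longrightarrow> \<bar>x\<bar> > R \<Longrightarrow> \<phi> x t = 0"
    and final: "\<And>x. \<phi> x T = 0"
begin

lemma cont: "continuous_on (UNIV \<times> {0..T}) (\<lambda>(x, t). \<phi> x t)"
    "continuous_on (UNIV \<times> {0..T}) (\<lambda>(x, t). \<phi>x x t)"
    "continuous_on (UNIV \<times> {0..T}) (\<lambda>(x, t). \<phi>t x t)"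
  and deriv_x: "t \<in> {0..T} \<Longrightarrow> ((\<lambda>y. \<phi> y t) has_real_derivative \<phi>x x t) (at x)"
  and deriv_t: "t \<in> {0..T} \<Longrightarrow> (\<phi> x has_real_derivative \<phi>t x t) (at t within {0..T})"
  using C11 by (auto simp: C11_deriv_def C10_deriv_def)

lemma supp_x: assumes t: "t \<in> {0..T}" and x: "\<bar>x\<bar> > R" shows "\<phi>x x t = 0"
proof -
  have "open {x. \<bar>x\<bar> > R}" by (intro open_Collect_less continuous_intros)
  then have "((\<lambda>_. 0) has_real_derivative \<phi>x x t) (at x)"
    using x by (intro has_field_derivative_transform_within_open[OF deriv_x[OF t]]) (auto simp: supp[OF t])
  then show ?thesis using DERIV_const DERIV_unique by blast
qed

lemma supp_t: assumes t: "t \<in> {0..T}" and x: "\<bar>x\<bar> > R" shows "\<phi>t x t = 0"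
proof -
  have "((\<lambda>_. 0) has_real_derivative \<phi>t x t) (at t within {0..T})"
    by (rule has_field_derivative_transform_within[OF deriv_t[OF t], where d = 1]) (use supp x t in auto)
  then have "((\<lambda>_. 0 :: real) has_vector_derivative \<phi>t x t) (at t within cbox 0 T)"
    by (simp add: has_real_derivative_iff_has_vector_derivative)
  moreover have "((\<lambda>_. 0 :: real) has_vector_derivative 0) (at t within cbox 0 T)" by simp
  ultimately show ?thesis
    by (rule vector_derivative_unique_within_closed_interval[OF T_pos, rotated]) (use t in simp)
qed

text \<open>Continuous partial derivatives give total differentiability, which the chain rule along
  slanted paths needs.\<close>

lemma deriv_joint:
  assumes "0 < t" "t < T"
  shows "((\<lambda>(x, t). \<phi> x t) has_derivative (\<lambda>(a, b). \<phi>x x t * a + \<phi>t x t * b)) (at (x, t))"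
proof -
  have "((\<lambda>(x, t). \<phi> x t) has_derivative (\<lambda>(a, b). \<phi>x x t * a + blinfun_mult_left (\<phi>t x t) b)) (at (x, t) within UNIV \<times> {0..T})"
  proof (rule has_derivative_partialsI)
    show "((\<lambda>x. \<phi> x t) has_derivative (*) (\<phi>x x t)) (at x)"
      using deriv_x[of t x] assms by (simp add: has_field_derivative_def)
    show "(\<phi> x has_derivative blinfun_apply (blinfun_mult_left (\<phi>t x t))) (at t within {0..T})"
      if "t \<in> {0..T}" for x t
      using deriv_t[OF that, of x] by (simp add: has_field_derivative_def mult.commute[of _ "\<phi>t x t"])
    have "continuous_on (UNIV \<times> {0..T}) (\<lambda>Q. blinfun_mult_left ((\<lambda>(x, t). \<phi>t x t) Q))"
      by (rule bounded_linear.continuous_on[OF bounded_linear_blinfun_mult_left cont(3)])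
    then show "continuous (at (x, t) within UNIV \<times> {0..T}) (\<lambda>(x, t). blinfun_mult_left (\<phi>t x t))"
      using assms by (simp add: continuous_on_eq_continuous_within split_beta')
  qed (use assms in auto)
  moreover have "at (x, t) within UNIV \<times> {0..T} = at (x, t)"
    by (rule at_within_interior) (use assms in \<open>simp add: interior_Times\<close>)
  ultimately show ?thesis by (simp add: mult.commute)
qed

text \<open>\<open>D\<close> is the derivative of exp (- \<tau>) \<phi> along the parabolic path
  starting at (y, s), and \<phi> vanishes at time T. The last summand is left uncancelled so that it
  matches the factor x / (2 t) in \<open>hkx\<close>. As the square root is not differentiable at 0,
  the fundamental theorem is used in the form that needs derivatives only in the interior.\<close>

lemma path_integral:
  fixes y z s :: real
  assumes s: "0 \<le> s" "s < T"
  defines "D \<equiv> \<lambda>\<tau>. exp (- \<tau>) * ((\<phi>t (y + sqrt (2 * \<tau>) * z) (s + \<tau>) - \<phi> (y + sqrt (2 * \<tau>) * z) (s + \<tau>))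
      + (sqrt (2 * \<tau>) * z) / (2 * \<tau>) * \<phi>x (y + sqrt (2 * \<tau>) * z) (s + \<tau>))"
  shows "(D has_integral - \<phi> y s) {0..T - s}"
proof -
  define F where "F \<tau> = exp (- \<tau>) * (\<lambda>(x, t). \<phi> x t) (y + sqrt (2 * \<tau>) * z, s + \<tau>)" for \<tau>
  have "(D has_integral F (T - s) - F 0) {0..T - s}"
  proof (rule fundamental_theorem_of_calculus_interior)
    show "continuous_on {0..T - s} F"
      unfolding F_def using s
      by (intro continuous_intros continuous_on_compose2[OF cont(1), of _ "\<lambda>\<tau>. (y + sqrt (2 * \<tau>) * z, s + \<tau>)"]) auto
    fix \<tau> assume \<tau>: "\<tau> \<in> {0<..<T - s}"
    let ?c = "\<lambda>\<tau>. (y + sqrt (2 * \<tau>) * z, s + \<tau>)"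
    let ?x = "y + sqrt (2 * \<tau>) * z"
    have d1: "((\<lambda>\<tau>. y + sqrt (2 * \<tau>) * z) has_real_derivative z / sqrt (2 * \<tau>)) (at \<tau>)"
      using \<tau> by (auto intro!: derivative_eq_intros simp: divide_simps)
    have d2: "((\<lambda>\<tau>. s + \<tau>) has_real_derivative 1) (at \<tau>)" by (auto intro!: derivative_eq_intros)
    have c: "(?c has_derivative (\<lambda>h. (z / sqrt (2 * \<tau>) * h, 1 * h))) (at \<tau>)"
      using d1 d2 unfolding has_field_derivative_def by (rule has_derivative_Pair)
    have "((\<lambda>(x, t). \<phi> x t) has_derivative (\<lambda>(a, b). \<phi>x ?x (s + \<tau>) * a + \<phi>t ?x (s + \<tau>) * b)) (at (?c \<tau>))"
      using \<tau> s by (intro deriv_joint) auto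
    from has_derivative_compose[OF c this]
    have "((\<lambda>\<tau>. (\<lambda>(x, t). \<phi> x t) (?c \<tau>)) has_real_derivative \<phi>x ?x (s + \<tau>) * (z / sqrt (2 * \<tau>)) + \<phi>t ?x (s + \<tau>)) (at \<tau>)"
      unfolding has_field_derivative_def
      by (rule has_derivative_eq_rhs) (auto simp: fun_eq_iff algebra_simps)
    moreover have "((\<lambda>\<tau>. exp (- \<tau>)) has_real_derivative - exp (- \<tau>)) (at \<tau>)"
      by (auto intro!: derivative_eq_intros)
    ultimately have "(F has_real_derivative - exp (- \<tau>) * \<phi> ?x (s + \<tau>)
        + (\<phi>x ?x (s + \<tau>) * (z / sqrt (2 * \<tau>)) + \<phi>t ?x (s + \<tau>)) * exp (- \<tau>)) (at \<tau>)"
      unfolding F_def by (auto dest: DERIV_mult)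
    moreover have "sqrt (2 * \<tau>) * z / (2 * \<tau>) = z / sqrt (2 * \<tau>)"
    proof -
      have "sqrt (2 * \<tau>) * z / (sqrt (2 * \<tau>) * sqrt (2 * \<tau>)) = z / sqrt (2 * \<tau>)"
        using \<tau> by (intro nonzero_mult_divide_mult_cancel_left) simp
      moreover have "sqrt (2 * \<tau>) * sqrt (2 * \<tau>) = 2 * \<tau>" using \<tau> by simp
      ultimately show ?thesis by (simp only:)
    qed
    ultimately show "(F has_vector_derivative D \<tau>) (at \<tau>)"
      unfolding D_def has_real_derivative_iff_has_vector_derivative[symmetric] by (simp add: algebra_simps)
  qed (use s in auto)
  then show ?thesis by (simp add: F_def final)
qed

text \<open>The summand -\<phi> is the adjoint of the damping in the kernel.\<close>

definition time_test :: "real \<times> real \<Rightarrow> real" where "time_test = on_strip T (\<lambda>x t. \<phi>t x t - \<phi> x t)"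

definition space_test :: "real \<times> real \<Rightarrow> real" where "space_test = on_strip T \<phi>x"

lemma time_test_props: "time_test \<in> borel_measurable borel" "\<exists>B. \<forall>Q. \<bar>time_test Q\<bar> \<le> B" "integrable lborel time_test"
proof -
  have c: "continuous_on (UNIV \<times> {0..T}) (\<lambda>(x, t). \<phi>t x t - \<phi> x t)"
    using continuous_on_diff[OF cont(3) cont(1)] by (simp add: split_beta')
  show "time_test \<in> borel_measurable borel" "\<exists>B. \<forall>Q. \<bar>time_test Q\<bar> \<le> B" "integrable lborel time_test"
    unfolding time_test_def by (rule on_strip_props[OF c, of R]; simp add: supp supp_t)+
qed

lemma space_test_props: "space_test \<in> borel_measurable borel" "\<exists>B. \<forall>Q. \<bar>space_test Q\<bar> \<le> B" "integrable lborel space_test"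
  unfolding space_test_def by (rule on_strip_props[OF cont(2), of R]; simp add: supp_x)+

lemmas test_measurable[measurable] = time_test_props(1) space_test_props(1)

text \<open>\<open>hk\<close> is a fundamental solution, stated with only first derivatives on the
  test function: in the path variables the left side is the Gaussian average over z of the path
  integrals, all equal to -\<phi> (y, s).\<close>

lemma kernel_identity:
  assumes s: "0 \<le> s" "s < T"
  shows "(LBINT Q. time_test Q * hk (Q - (y, s))) - (LBINT Q. space_test Q * hkx (Q - (y, s))) = - \<phi> y s"
proof -
  obtain B1 B2 where B: "\<And>Q. \<bar>time_test Q\<bar> \<le> B1" "\<And>Q. \<bar>space_test Q\<bar> \<le> B2" using time_test_props(2) space_test_props(2) by blast
  let ?P = "(y, s)"
  \<comment> \<open>Since \<open>hkx\<close> is -x / (2 t) times \<open>hk\<close>, both integrals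
    combine into the single integral of \<open>hk\<close> times \<open>g\<close>.\<close>
  define g where "g Q = time_test (?P + Q) + fst Q / (2 * snd Q) * space_test (?P + Q)" for Q
  have g_meas[measurable]: "g \<in> borel_measurable borel"
  proof -
    have [measurable]: "(\<lambda>Q :: real \<times> real. fst Q / (2 * snd Q)) \<in> borel_measurable borel"
      unfolding borel_prod[symmetric] by measurable
    show ?thesis unfolding g_def[abs_def] by measurable
  qed
  have i1: "integrable lborel (\<lambda>Q. hk Q * time_test (?P + Q))"
    by (rule integrable_mult_bounded[OF integrable_hk _ B(1)]) measurable
  have i2: "integrable lborel (\<lambda>Q. hkx Q * space_test (?P + Q))"
    by (rule integrable_mult_bounded[OF integrable_hkx _ B(2)]) measurable
  have g_eq: "hk Q * g Q = hk Q * time_test (?P + Q) - hkx Q * space_test (?P + Q)" for Q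
    by (simp add: g_def hkx_def algebra_simps)
  have ig: "integrable lborel (\<lambda>Q. hk Q * g Q)" unfolding g_eq using i1 i2 by simp
  have t1: "(LBINT Q. time_test Q * hk (Q - ?P)) = (LBINT Q. hk Q * time_test (?P + Q))"
    using integral_translate[of "\<lambda>Q. time_test Q * hk (Q - ?P)" ?P] by (simp add: mult.commute)
  have t2: "(LBINT Q. space_test Q * hkx (Q - ?P)) = (LBINT Q. hkx Q * space_test (?P + Q))"
    using integral_translate[of "\<lambda>Q. space_test Q * hkx (Q - ?P)" ?P] by (simp add: mult.commute)
  note seed_g = integral_hk_eq[OF g_meas ig]
  have int2: "integrable (lborel \<Otimes>\<^sub>M lborel) (\<lambda>Q. seed Q * g (spread Q))"
    using seed_g(1) by (simp add: lborel_prod)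
  have "(LBINT Q. seed Q * g (spread Q)) = (LBINT z. (LBINT \<tau>. seed (z, \<tau>) * g (spread (z, \<tau>))))"
    using lborel_pair.integral_fst'[OF int2] by (simp add: lborel_prod)
  also have "\<dots> = (LBINT z. std_normal_density z * (- \<phi> y s))"
  proof (rule integral_cong_AE)
    show "(\<lambda>z. LBINT \<tau>. seed (z, \<tau>) * g (spread (z, \<tau>))) \<in> borel_measurable lborel"
      using borel_measurable_integrable[OF lborel_pair.integrable_fst'[OF int2]] .
    show "(\<lambda>z. std_normal_density z * (- \<phi> y s)) \<in> borel_measurable lborel" by measurable
    show "AE z in lborel. (LBINT \<tau>. seed (z, \<tau>) * g (spread (z, \<tau>))) = std_normal_density z * (- \<phi> y s)"
      using lborel_pair.AE_integrable_fst'[OF int2]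
    proof eventually_elim
      case (elim z)
      define D where "D \<tau> = exp (- \<tau>) * ((\<phi>t (y + sqrt (2 * \<tau>) * z) (s + \<tau>) - \<phi> (y + sqrt (2 * \<tau>) * z) (s + \<tau>))
      + (sqrt (2 * \<tau>) * z) / (2 * \<tau>) * \<phi>x (y + sqrt (2 * \<tau>) * z) (s + \<tau>))" for \<tau>
      have "(D has_integral - \<phi> y s) {0..T - s}"
        unfolding D_def by (rule path_integral[OF s])
      then have "((\<lambda>\<tau>. if \<tau> \<in> {0..T - s} then D \<tau> else 0) has_integral - \<phi> y s) UNIV"
        by (subst has_integral_restrict_UNIV)
      then have "((\<lambda>\<tau>. std_normal_density z * (if \<tau> \<in> {0..T - s} then D \<tau> else 0)) has_integral std_normal_density z * (- \<phi> y s)) UNIV"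
        by (rule has_integral_mult_right)
      then have "((\<lambda>\<tau>. seed (z, \<tau>) * g (spread (z, \<tau>))) has_integral std_normal_density z * (- \<phi> y s)) UNIV"
      \<comment> \<open>At \<tau> = 0 the seed is 0 by its open indicator, whereas
        \<open>D 0\<close> may be nonzero.\<close>
      proof (rule has_integral_spike_finite[of "{0}", rotated 2])
        fix \<tau> :: real assume "\<tau> \<in> UNIV - {0}"
        then consider "\<tau> < 0" | "0 < \<tau>" "\<tau> \<le> T - s" | "0 < \<tau>" "T - s < \<tau>" by fastforce
        then show "seed (z, \<tau>) * g (spread (z, \<tau>)) = std_normal_density z * (if \<tau> \<in> {0..T - s} then D \<tau> else 0)"
        proof cases
          case 2
          then have "time_test ((y, s) + spread (z, \<tau>)) = \<phi>t (y + sqrt (2 * \<tau>) * z) (s + \<tau>) - \<phi> (y + sqrt (2 * \<tau>) * z) (s + \<tau>)"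
            "space_test ((y, s) + spread (z, \<tau>)) = \<phi>x (y + sqrt (2 * \<tau>) * z) (s + \<tau>)"
            using s by (auto simp: time_test_def space_test_def on_strip_def spread_def)
          then show ?thesis using 2 by (simp add: g_def seed_def D_def spread_def)
        next
          case 3
          then have "time_test ((y, s) + spread (z, \<tau>)) = 0" "space_test ((y, s) + spread (z, \<tau>)) = 0"
            by (auto simp: time_test_def space_test_def on_strip_def spread_def)
          then show ?thesis using 3 by (simp add: g_def)
        qed (simp add: seed_def)
      qed simp
      \<comment> \<open>The fundamental theorem yields a gauge integral; integrability of almost
        every path, known from Fubini, identifies it with the Lebesgue integral.\<close>
      with has_integral_integral_lborel[OF elim] show ?case by (rule has_integral_unique)
    qed
  qed
  also have "\<dots> = - \<phi> y s" by simp
  finally have "(LBINT Q. hk Q * g Q) = - \<phi> y s" unfolding seed_g(2) .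
  then show ?thesis unfolding t1 t2 g_eq using i1 i2 by simp
qed

text \<open>Fubini moves the test function onto the kernel. Sources at times from 0 to T are then
  handled by \<open>kernel_identity\<close>; those before 0 vanish by hypothesis, and those from T
  on have no effect inside the strip.\<close>

lemma weak_identity:
  assumes G[measurable]: "G \<in> borel_measurable borel" and bd: "\<And>Q. \<bar>G Q\<bar> \<le> C"
    and G0: "\<And>Q. snd Q < 0 \<Longrightarrow> G Q = 0"
  shows "(LBINT Q. time_test Q * lconv hk G Q) - (LBINT Q. space_test Q * lconv hkx G Q)
     = - (LBINT Q. on_strip T \<phi> Q * G Q)"
proof -
  note w1 = integral_weighted_lconv[OF time_test_props(3) measurable_ident integrable_hk G bd, unfolded id_def]
  note w2 = integral_weighted_lconv[OF space_test_props(3) measurable_ident integrable_hkx G bd, unfolded id_def]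
  have "(LBINT Q. time_test Q * lconv hk G Q) - (LBINT Q. space_test Q * lconv hkx G Q)
    = (LBINT P. (LBINT Q. time_test Q * hk (Q - P)) * G P - (LBINT Q. space_test Q * hkx (Q - P)) * G P)"
    unfolding w1(3) w2(3) using w1(2) w2(2) by simp
  also have "\<dots> = (LBINT P. - (on_strip T \<phi> P * G P))"
  proof (intro Bochner_Integration.integral_cong refl)
    fix P :: "real \<times> real"
    obtain y s where P: "P = (y, s)" by fastforce
    consider "s < 0" | "0 \<le> s" "s < T" | "T \<le> s" by linarith
    then have "((LBINT Q. time_test Q * hk (Q - P)) - (LBINT Q. space_test Q * hkx (Q - P))) * G P = - (on_strip T \<phi> P * G P)"
    proof cases
      case 1
      then show ?thesis by (simp add: G0 P)
    next
      case 2
      then show ?thesis unfolding P kernel_identity[OF 2] by (simp add: on_strip_def)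
    next
      case 3
      have z: "time_test Q * hk (Q - P) = 0" "space_test Q * hkx (Q - P) = 0" for Q
        using 3 hk_eq_0[of "Q - P"] hkx_eq_0[of "Q - P"]
        by (auto simp: time_test_def space_test_def on_strip_def P)
      have "on_strip T \<phi> P = 0" using 3 final by (auto simp: on_strip_def P)
      then show ?thesis by (simp add: z)
    qed
    then show "(LBINT Q. time_test Q * hk (Q - P)) * G P - (LBINT Q. space_test Q * hkx (Q - P)) * G P = - (on_strip T \<phi> P * G P)"
      by (simp add: left_diff_distrib)
  qed
  also have "\<dots> = - (LBINT Q. on_strip T \<phi> Q * G Q)" by simp
  finally show ?thesis .
qed

end

section \<open>Existence\<close>

text \<open>This puts the running supremum into the form of \<open>ignite\<close>, with rational
  times strictly before t. It works for the strict inequality only, which is an open condition. Time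
  0 contributes nothing, as u x 0 = 0 \<le> c.\<close>

lemma running_sup_gt_iff:
  assumes t: "t > 0" and c: "c \<ge> 0" and u0: "u x 0 = 0"
    and cont: "\<And>s. s > 0 \<Longrightarrow> isCont (u x) s" and bd: "\<And>s. u x s \<le> B"
  shows "running_sup u x t > c \<longleftrightarrow> (\<exists>r\<in>\<rat>. 0 < r \<and> r < t \<and> u x r > c)"
proof -
  let ?S = "{s \<in> {0..t}. (x, s) \<noteq> (0, 0)}"
  have ne: "t \<in> ?S" using t by simp
  have bdd: "bdd_above (u x ` ?S)" by (rule bdd_aboveI[of _ B]) (use bd in auto)
  have "running_sup u x t > c \<longleftrightarrow> (\<exists>s\<in>?S. c < u x s)"
    unfolding running_sup_def by (rule less_cSUP_iff[OF _ bdd]) (use ne in blast)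
  also have "\<dots> \<longleftrightarrow> (\<exists>r\<in>\<rat>. 0 < r \<and> r < t \<and> u x r > c)"
  proof
    assume "\<exists>s\<in>?S. c < u x s"
    then obtain s where s: "0 \<le> s" "s \<le> t" "c < u x s" by auto
    with c u0 have "s > 0" by (cases "s = 0") auto
    from cont[OF this] have "u x \<midarrow>s\<rightarrow> u x s" by (simp add: isCont_def)
    from order_tendstoD(1)[OF this s(3)] obtain d where d: "d > 0"
      "\<And>r. r \<noteq> s \<Longrightarrow> dist r s < d \<Longrightarrow> c < u x r"
      unfolding eventually_at by auto
    \<comment> \<open>The rational time is taken to the left of \<open>s\<close>, so that r < t also
      if s = t.\<close>
    obtain r where r: "r \<in> \<rat>" "max 0 (s - d) < r" "r < s"
      using Rats_dense_in_real[of "max 0 (s - d)" s] d(1) \<open>s > 0\<close> by auto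
    then show "\<exists>r\<in>\<rat>. 0 < r \<and> r < t \<and> u x r > c"
      using d(2)[of r] s by (intro bexI[of _ r]) (auto simp: dist_real_def)
  next
    assume "\<exists>r\<in>\<rat>. 0 < r \<and> r < t \<and> u x r > c"
    then obtain r where "0 < r" "r < t" "u x r > c" by blast
    then show "\<exists>s\<in>?S. c < u x s" by (intro bexI[of _ r]) auto
  qed
  finally show ?thesis .
qed

lemma running_sup_mono:
  assumes "s \<le> t" "0 \<le> s" "(x, s) \<noteq> (0, 0)" and bd: "\<And>s. u x s \<le> B"
  shows "running_sup u x s \<le> running_sup u x t"
  unfolding running_sup_def
proof (rule cSUP_subset_mono)
  show "bdd_above (u x ` {s \<in> {0..t}. (x, s) \<noteq> (0, 0)})" by (rule bdd_aboveI[of _ B]) (use bd in auto)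
qed (use assms in auto)

lemma running_sup_eq_at_max:
  assumes "0 < \<theta>" "\<theta> \<le> t" and max: "\<And>s. \<theta> \<le> s \<Longrightarrow> u x s \<le> u x \<theta>" and bd: "\<And>s. u x s \<le> B"
  shows "running_sup u x t = running_sup u x \<theta>"
proof (rule antisym)
  have bdd: "bdd_above (u x ` {s \<in> {0..\<theta>}. (x, s) \<noteq> (0, 0)})" by (rule bdd_aboveI[of _ B]) (use bd in auto)
  show "running_sup u x t \<le> running_sup u x \<theta>"
    unfolding running_sup_def[of u x t]
  proof (rule cSUP_least)
    fix s assume s: "s \<in> {s \<in> {0..t}. (x, s) \<noteq> (0, 0)}"
    show "u x s \<le> running_sup u x \<theta>"
    proof (cases "s \<le> \<theta>")
      case True
      then show ?thesis unfolding running_sup_def by (intro cSUP_upper bdd) (use s in auto)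
    next
      case False
      have "u x \<theta> \<le> running_sup u x \<theta>"
        unfolding running_sup_def by (intro cSUP_upper bdd) (use assms(1) in auto)
      then show ?thesis using max[of s] False by simp
    qed
  qed (use assms in \<open>auto intro!: exI[of _ t]\<close>)
  show "running_sup u x \<theta> \<le> running_sup u x t"
    by (rule running_sup_mono[where u = u and B = B]) (use assms in auto)
qed

text \<open>Translates the iterated Lebesgue integrals of the weak form into one integral over the
  plane; the sections of \<open>H\<close> are Borel, so completion does not change them.\<close>

lemma strip_integral:
  fixes H :: "real \<times> real \<Rightarrow> real"
  assumes H: "integrable lborel H" and out: "\<And>y s. s \<notin> {0..T} \<Longrightarrow> H (y, s) = 0"
    and eq: "\<And>y s. s \<in> {0..T} \<Longrightarrow> h y s = H (y, s)"
  shows "(LINT s:{0..T}|lebesgue. (LINT y|lebesgue. h y s)) = (LBINT Q. H Q)"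
proof -
  have [measurable]: "H \<in> borel_measurable borel" using H by auto
  have sec[measurable]: "(\<lambda>y. H (y, s)) \<in> borel_measurable borel" for s by measurable
  have int: "integrable (lborel \<Otimes>\<^sub>M lborel) (case_prod (\<lambda>y s. H (y, s)))"
    using H by (simp add: lborel_prod)
  have "indicator {0..T} s *\<^sub>R (LINT y|lebesgue. h y s) = (LBINT y. H (y, s))" for s
  proof (cases "s \<in> {0..T}")
    case True
    have "(LINT y|lebesgue. h y s) = (LINT y|lebesgue. H (y, s))" using eq[OF True] by simp
    also have "\<dots> = (LBINT y. H (y, s))" by (rule integral_completion) simp
    finally show ?thesis using True by simp
  qed (simp add: out)
  then have "(LINT s:{0..T}|lebesgue. (LINT y|lebesgue. h y s)) = (LINT s|lebesgue. (LBINT y. H (y, s)))"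
    unfolding set_lebesgue_integral_def by simp
  also have "\<dots> = (LBINT s. (LBINT y. H (y, s)))"
    by (rule integral_completion) measurable
  also have "\<dots> = (LBINT Q. H Q)"
    using lborel_pair.integral_snd[OF int] by (simp add: lborel_prod)
  finally show ?thesis .
qed

section \<open>Correction of the limit on a null set, the weak solution and property (P)\<close>

context hhmo
begin

theorem existence: "\<exists>u p. weak_solution \<alpha> \<beta> ustar u p \<and> property_P \<alpha> p"
proof (rule limit_pair)
  fix w q :: "real \<times> real \<Rightarrow> real"
  assume w_cont: "continuous_on UNIV w"
    and w_bd: "\<And>Q. - psi_max \<le> w Q \<and> w Q \<le> 0"
    and w_0: "\<And>x t. t \<le> 0 \<Longrightarrow> w (x, t) = 0"
    and w_even: "\<And>x t. w (- x, t) = w (x, t)"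
    and w_anti: "\<And>x s t. s \<le> t \<Longrightarrow> w (x, t) \<le> w (x, s)"
    and q_meas[measurable]: "q \<in> borel_measurable borel"
    and q01: "\<And>Q. q Q \<in> {0..1}"
    and q_even: "\<And>x t. q (- x, t) = q (x, t)"
    and q_mono: "\<And>x s t. s \<le> t \<Longrightarrow> q (x, s) \<le> q (x, t)"
    and w_eq: "\<And>P. w P = lconv hk (\<lambda>Q. w Q - q Q * (w Q + \<psi> Q)) P"
    and AE1: "AE Q in lborel. ignite w Q = 1 \<longrightarrow> q Q = 1"
    and AE0: "AE Q in lborel. (\<exists>c\<in>\<rat>. c < ustar \<and> (\<forall>r\<in>\<rat>. 0 < r \<and> r < snd Q \<longrightarrow> w (fst Q, r) + \<psi> (fst Q, r) \<le> c)) \<longrightarrow> q Q = 0"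
    and AEs: "\<And>n :: nat. AE Q in lborel. snd Q > (fst Q)\<^sup>2 / \<alpha>\<^sup>2 \<longrightarrow> q Q = q (Q + (0, real n))"
  have [measurable]: "w \<in> borel_measurable borel" by (rule borel_measurable_continuous_onI[OF w_cont])
  define u where "u x t = w (x, t) + \<psi> (x, t)" for x t
  have u_bd: "u x t \<le> psi_max" for x t
    using w_bd[of "(x, t)"] \<psi>_le[of "(x, t)"] by (simp add: u_def)
  have u_abs: "\<bar>u x t\<bar> \<le> psi_max" for x t
    using w_bd[of "(x, t)"] \<psi>_le[of "(x, t)"] \<psi>_nonneg[of "(x, t)"] unfolding u_def by linarith
  have pu_abs: "\<bar>r * u x t\<bar> \<le> psi_max" if "r \<in> {0..1}" for r x t
  proof -
    have "\<bar>r\<bar> * \<bar>u x t\<bar> \<le> 1 * psi_max" using that u_abs[of x t] by (intro mult_mono) auto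
    then show ?thesis by (simp add: abs_mult)
  qed
  have u_0: "u x t = 0" if "t \<le> 0" for x t using w_0[OF that] \<psi>_eq_0[OF that] by (simp add: u_def)
  have u_cont: "isCont (u x) s" if "s > 0" for x s
  proof -
    have pair: "isCont (\<lambda>t. (x, t)) s" by (intro continuous_intros)
    have "isCont w (x, s)" using w_cont by (simp add: continuous_on_eq_continuous_at)
    with pair have "isCont (\<lambda>t. w (x, t)) s" by (rule isCont_o2)
    moreover have "isCont \<psi> (x, s)" using that by (intro isCont_\<psi>) simp
    with pair have "isCont (\<lambda>t. \<psi> (x, t)) s" by (rule isCont_o2)
    ultimately show ?thesis unfolding u_def[abs_def] by (rule isCont_add)
  qed
  define M where "M x t = running_sup u x t" for x t
  have M_gt: "M x t > c \<longleftrightarrow> (\<exists>r\<in>\<rat>. 0 < r \<and> r < t \<and> u x r > c)" if "t > 0" "c \<ge> 0" for x t c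
    unfolding M_def by (rule running_sup_gt_iff[OF that]) (use u_0 u_cont u_bd in auto)
  have M_mono: "M x s \<le> M x t" if "s \<le> t" "0 \<le> s" "(x, s) \<noteq> (0, 0)" for x s t
    unfolding M_def by (rule running_sup_mono[where u = u and B = psi_max, OF that]) (rule u_bd)
  have M_0: "M x 0 = 0" if "x \<noteq> 0" for x
    using that by (simp add: M_def running_sup_def u_0)
  \<comment> \<open>Away from equality the threshold dictates the value; \<open>q\<close> survives
    only where the running supremum equals \<open>ustar\<close>. At time 0 the value 0 is forced for
    x \<noteq> 0, where the supremum is 0; at the origin, where the supremum runs over the empty
    set, 0 keeps \<open>p\<close> monotone.\<close>
  define p where "p x t = (if t \<le> 0 then 0 else if M x t < ustar then 0 else if M x t > ustar then 1 else q (x, t))" for x t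
  have u_even: "u (- x) t = u x t" for x t by (simp add: u_def w_even \<psi>_even)
  have M_even: "M (- x) t = M x t" for x t
    by (simp add: M_def running_sup_def u_even)
  have p_even: "p (- x) t = p x t" for x t by (simp add: p_def M_even q_even)
  have p01: "p x t \<in> {0..1}" for x t using q01[of "(x, t)"] by (auto simp: p_def)
  have p_mono: "p x s \<le> p x t" if "0 \<le> s" "s \<le> t" for x s t
  proof (cases "s = 0")
    case True
    then show ?thesis using p01[of x t] by (simp add: p_def)
  next
    case False
    with that M_mono[OF that(2,1), of x] q_mono[OF that(2), of x] q01[of "(x, s)"] q01[of "(x, t)"]
    show ?thesis by (auto simp: p_def)
  qed
  have p_cases: "(M x t < ustar \<longrightarrow> p x t = 0) \<and> (M x t = ustar \<longrightarrow> p x t \<in> {0..1}) \<and> (M x t > ustar \<longrightarrow> p x t = 1)"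
    if "t \<ge> 0" "(x, t) \<noteq> (0, 0)" for x t
  proof (cases "t = 0")
    case True
    then show ?thesis using that ustar_pos M_0[of x] by (auto simp: p_def)
  next
    case False
    then show ?thesis using that q01[of "(x, t)"] by (auto simp: p_def)
  qed
  have u_meas[measurable]: "(\<lambda>Q. u (fst Q) (snd Q)) \<in> borel_measurable borel"
    by (simp add: u_def)
  have gt_meas: "{Q. snd Q > 0 \<and> M (fst Q) (snd Q) > c} \<in> sets borel" if "c \<ge> 0" for c
  proof -
    have eq: "{Q. snd Q > 0 \<and> M (fst Q) (snd Q) > c} = (\<Union>r\<in>\<rat>. {Q. 0 < r \<and> r < snd Q \<and> u (fst Q) r > c})"
      using M_gt[OF _ that] by auto
    have m: "{Q. 0 < r \<and> r < snd Q \<and> u (fst Q) r > c} \<in> sets borel" for r :: real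
    proof -
      have "Measurable.pred borel (\<lambda>Q :: real \<times> real. 0 < r \<and> r < snd Q \<and> w (fst Q, r) + \<psi> (fst Q, r) > c)"
        unfolding borel_prod[symmetric] by measurable
      then show ?thesis unfolding u_def by (simp only: pred_def space_borel UNIV_I simp_thms)
    qed
    show ?thesis unfolding eq by (rule sets.countable_UN''[OF countable_rat m])
  qed
  define A where "A = {Q. snd Q > 0 \<and> M (fst Q) (snd Q) > ustar}"
  \<comment> \<open>For positive times this is the set where the running supremum is below
    \<open>ustar\<close>, written with rational levels; they are nonnegative because
    \<open>M_gt\<close> requires it.\<close>
  define B where "B = (\<Union>c\<in>{c\<in>\<rat>. 0 \<le> c \<and> c < ustar}. - {Q. snd Q > 0 \<and> M (fst Q) (snd Q) > c})"
  have [measurable]: "A \<in> sets borel" unfolding A_def using ustar_pos by (intro gt_meas) simp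
  have [measurable]: "B \<in> sets borel"
    unfolding B_def
  proof (rule sets.countable_UN'')
    show "countable {c \<in> \<rat>. 0 \<le> c \<and> c < ustar}" by (rule countable_subset[OF _ countable_rat]) blast
    show "- {Q. snd Q > 0 \<and> M (fst Q) (snd Q) > c} \<in> sets borel" if "c \<in> {c \<in> \<rat>. 0 \<le> c \<and> c < ustar}" for c
      using gt_meas[of c] that by (intro borel_comp) simp
  qed
  have B_iff: "(x, t) \<in> B \<longleftrightarrow> M x t < ustar" if "t > 0" for x t
  proof
    assume "(x, t) \<in> B"
    then show "M x t < ustar" using that by (auto simp: B_def)
  next
    assume "M x t < ustar"
    then obtain c where "c \<in> \<rat>" "max 0 (M x t) < c" "c < ustar"
      using Rats_dense_in_real[of "max 0 (M x t)" ustar] ustar_pos by auto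
    then show "(x, t) \<in> B" unfolding B_def by (intro UN_I[of c]) auto
  qed
  have p_alt: "p (fst Q) (snd Q) = (if Q \<in> {Q. snd Q \<le> 0} then 0 else if Q \<in> B then 0 else if Q \<in> A then 1 else q Q)" for Q
    using B_iff[of "snd Q" "fst Q"] by (auto simp: p_def A_def)
  have [measurable]: "{Q :: real \<times> real. snd Q \<le> 0} \<in> sets borel"
    by (intro borel_closed closed_Collect_le continuous_intros)
  have p_meas[measurable]: "(\<lambda>Q. p (fst Q) (snd Q)) \<in> borel_measurable borel"
    unfolding p_alt by measurable
  \<comment> \<open>The correction changes \<open>q\<close> only on a null set, so the integral
    equation for \<open>w\<close> is preserved.\<close>
  have AE_p: "AE Q in lborel. snd Q > 0 \<longrightarrow> p (fst Q) (snd Q) = q Q"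
    using AE0 AE1
  proof eventually_elim
    case (elim Q)
    show ?case
    proof
      assume t: "snd Q > 0"
      have q1: "q Q = 1" if "M (fst Q) (snd Q) > ustar"
      proof -
        have "\<exists>r\<in>\<rat>. 0 < r \<and> r < snd Q \<and> u (fst Q) r > ustar" using M_gt[OF t, of ustar] ustar_pos that by simp
        then have "ignite w Q = 1" by (simp add: ignite_def u_def)
        with elim show ?thesis by simp
      qed
      have q0: "q Q = 0" if "M (fst Q) (snd Q) < ustar"
      proof -
        obtain c where c: "c \<in> \<rat>" "max 0 (M (fst Q) (snd Q)) < c" "c < ustar"
          using Rats_dense_in_real[of "max 0 (M (fst Q) (snd Q))" ustar] ustar_pos \<open>M (fst Q) (snd Q) < ustar\<close> by auto
        have "\<not> (M (fst Q) (snd Q) > c)" "c \<ge> 0" using c by auto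
        with M_gt[OF t, of c] have "\<forall>r\<in>\<rat>. 0 < r \<and> r < snd Q \<longrightarrow> w (fst Q, r) + \<psi> (fst Q, r) \<le> c"
          unfolding u_def by (meson not_less)
        with c elim show ?thesis by blast
      qed
      show "p (fst Q) (snd Q) = q Q" using t q0 q1 by (auto simp: p_def)
    qed
  qed
  define G where "G Q = (if Q \<in> {Q. snd Q \<le> 0} then 0 else w Q - p (fst Q) (snd Q) * u (fst Q) (snd Q))" for Q
  have G_meas[measurable]: "G \<in> borel_measurable borel"
    unfolding G_def[abs_def] by measurable
  have G_bd: "\<bar>G Q\<bar> \<le> 2 * psi_max" for Q
  proof -
    obtain x t where Q: "Q = (x, t)" by fastforce
    have "\<bar>p x t * u x t\<bar> \<le> psi_max" by (rule pu_abs[OF p01])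
    moreover have "\<bar>w Q\<bar> \<le> psi_max" using w_bd[of Q] by auto
    ultimately have "\<bar>w Q - p x t * u x t\<bar> \<le> 2 * psi_max" by linarith
    then show ?thesis using psi_max_nonneg by (simp add: G_def Q)
  qed
  have w_conv: "w P = lconv hk G P" for P
    unfolding w_eq[of P] lconv_def
  proof (rule integral_cong_AE)
    show "AE Q in lborel. hk (P - Q) * (w Q - q Q * (w Q + \<psi> Q)) = hk (P - Q) * G Q"
      using AE_p
    proof eventually_elim
      case (elim Q)
      show ?case
      proof (cases "snd Q > 0")
        case True
        then show ?thesis using elim by (simp add: G_def u_def)
      next
        case False
        then show ?thesis using w_0[of "snd Q" "fst Q"] \<psi>_eq_0[of "snd Q" "fst Q"] by (simp add: G_def)
      qed
    qed
  qed measurable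
  define wx where "wx P = lconv hkx G P" for P
  have wx_meas[measurable]: "wx \<in> borel_measurable borel" unfolding wx_def[abs_def] by measurable
  have C10: "C10_deriv T (\<lambda>x t. w (x, t)) (\<lambda>x t. wx (x, t))" for T
    unfolding C10_deriv_def
  proof (intro conjI allI ballI)
    show "continuous_on (UNIV \<times> {0..T}) (\<lambda>(x, t). w (x, t))"
      using continuous_on_subset[OF w_cont] by simp
    have "continuous_on UNIV wx"
      unfolding wx_def[abs_def] by (rule continuous_lconv[OF integrable_hkx AE_isCont_hkx G_meas G_bd])
    then show "continuous_on (UNIV \<times> {0..T}) (\<lambda>(x, t). wx (x, t))"
      using continuous_on_subset by simp blast
    show "((\<lambda>y. w (y, t)) has_real_derivative wx (x, t)) (at x)" for x t
      unfolding wx_def w_conv by (rule lconv_hk_has_derivative[OF G_meas G_bd])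
  qed
  have wx_bd: "\<bar>wx Q\<bar> \<le> 2 * psi_max * (LBINT Q. \<bar>hkx Q\<bar>)" for Q
    unfolding wx_def by (rule lconv_bound[OF integrable_hkx G_meas G_bd])
  have weak: "(LINT s:{0..T}|lebesgue. (LINT y|lebesgue. \<phi>t y s * w (y, s))) =
      (LINT s:{0..T}|lebesgue. (LINT y|lebesgue. \<phi>x y s * wx (y, s) + p y s * u y s * \<phi> y s))"
    if "T > 0" "C11_deriv T \<phi> \<phi>x \<phi>t" "\<exists>R. \<forall>x. \<forall>t\<in>{0..T}. \<bar>x\<bar> > R \<longrightarrow> \<phi> x t = 0" "\<And>x. \<phi> x T = 0"
    for T \<phi> \<phi>x \<phi>t
  proof -
    from that(3) obtain R where R: "\<And>x t. t \<in> {0..T} \<Longrightarrow> \<bar>x\<bar> > R \<Longrightarrow> \<phi> x t = 0" by blast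
    interpret test_function T R \<phi> \<phi>x \<phi>t using that R by unfold_locales auto
    let ?\<phi> = "on_strip T \<phi>" and ?\<phi>t = "on_strip T \<phi>t"
    note \<phi>_props = on_strip_props[OF cont(1) supp]
    note \<phi>t_props = on_strip_props[OF cont(3) supp_t]
    have w_abs: "\<bar>w Q\<bar> \<le> psi_max" for Q using w_bd[of Q] by auto
    have pu_abs': "\<bar>p (fst Q) (snd Q) * u (fst Q) (snd Q)\<bar> \<le> psi_max" for Q
      by (rule pu_abs[OF p01])
    have i1: "integrable lborel (\<lambda>Q. ?\<phi>t Q * w Q)"
      by (rule integrable_mult_bounded[OF \<phi>t_props(3) _ w_abs]) measurable
    have i2: "integrable lborel (\<lambda>Q. ?\<phi> Q * w Q)"
      by (rule integrable_mult_bounded[OF \<phi>_props(3) _ w_abs]) measurable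
    have i3: "integrable lborel (\<lambda>Q. space_test Q * wx Q)"
      by (rule integrable_mult_bounded[OF space_test_props(3) _ wx_bd]) measurable
    have i4: "integrable lborel (\<lambda>Q. ?\<phi> Q * (p (fst Q) (snd Q) * u (fst Q) (snd Q)))"
      by (rule integrable_mult_bounded[OF \<phi>_props(3) _ pu_abs']) measurable
    have i5: "integrable lborel (\<lambda>Q. ?\<phi> Q * G Q)"
      by (rule integrable_mult_bounded[OF \<phi>_props(3) _ G_bd]) measurable
    have L: "(LINT s:{0..T}|lebesgue. (LINT y|lebesgue. \<phi>t y s * w (y, s))) = (LBINT Q. ?\<phi>t Q * w Q)"
      by (rule strip_integral[OF i1]) (auto simp: on_strip_def)
    have i34: "integrable lborel (\<lambda>Q. space_test Q * wx Q + ?\<phi> Q * (p (fst Q) (snd Q) * u (fst Q) (snd Q)))"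
      using i3 i4 by simp
    have "(LINT s:{0..T}|lebesgue. (LINT y|lebesgue. \<phi>x y s * wx (y, s) + p y s * u y s * \<phi> y s))
       = (LBINT Q. space_test Q * wx Q + ?\<phi> Q * (p (fst Q) (snd Q) * u (fst Q) (snd Q)))"
      by (rule strip_integral[OF i34]) (auto simp: on_strip_def space_test_def)
    also have "\<dots> = (LBINT Q. space_test Q * wx Q) + (LBINT Q. ?\<phi> Q * (p (fst Q) (snd Q) * u (fst Q) (snd Q)))"
      using i3 i4 by simp
    \<comment> \<open>The absorption term is w - G. Its part \<open>w\<close> is matched by the
      summand -\<phi> in \<open>time_test\<close>, which undoes the damping.\<close>
    also have "(LBINT Q. ?\<phi> Q * (p (fst Q) (snd Q) * u (fst Q) (snd Q))) = (LBINT Q. ?\<phi> Q * w Q - ?\<phi> Q * G Q)"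
    proof (intro Bochner_Integration.integral_cong refl)
      fix Q
      show "?\<phi> Q * (p (fst Q) (snd Q) * u (fst Q) (snd Q)) = ?\<phi> Q * w Q - ?\<phi> Q * G Q"
        using w_0[of "snd Q" "fst Q"] by (cases "snd Q > 0") (simp_all add: G_def p_def algebra_simps)
    qed
    also have "\<dots> = (LBINT Q. ?\<phi> Q * w Q) - (LBINT Q. ?\<phi> Q * G Q)"
      using i2 i5 by simp
    finally have R: "(LINT s:{0..T}|lebesgue. (LINT y|lebesgue. \<phi>x y s * wx (y, s) + p y s * u y s * \<phi> y s))
      = (LBINT Q. space_test Q * wx Q) + ((LBINT Q. ?\<phi> Q * w Q) - (LBINT Q. ?\<phi> Q * G Q))" .
    have "(LBINT Q. time_test Q * lconv hk G Q) - (LBINT Q. space_test Q * lconv hkx G Q) = - (LBINT Q. ?\<phi> Q * G Q)"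
      by (rule weak_identity[OF G_meas G_bd]) (simp add: G_def)
    then have W: "(LBINT Q. time_test Q * w Q) - (LBINT Q. space_test Q * wx Q) = - (LBINT Q. ?\<phi> Q * G Q)"
      unfolding wx_def w_conv .
    have time_test_eq: "time_test Q * w Q = ?\<phi>t Q * w Q - ?\<phi> Q * w Q" for Q
      by (simp add: time_test_def on_strip_def algebra_simps)
    have "(LBINT Q. time_test Q * w Q) = (LBINT Q. ?\<phi>t Q * w Q) - (LBINT Q. ?\<phi> Q * w Q)"
      unfolding time_test_eq using i1 i2 by simp
    with W L R show ?thesis by linarith
  qed
  have ws: "weak_solution \<alpha> \<beta> ustar u p"
    unfolding weak_solution_def M_def[symmetric]
  proof (intro conjI)
    show "\<forall>x. \<forall>t\<ge>0. u (- x) t = u x t \<and> p (- x) t = p x t" using u_even p_even by blast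
    have "(\<lambda>Q. p (fst Q) (snd Q)) \<in> borel_measurable lborel" by simp
    from measurable_completion[OF this] have "(\<lambda>(x, t). p x t) \<in> borel_measurable lebesgue"
      by (simp add: split_beta')
    then show "(\<lambda>(x, t). p x t) \<in> borel_measurable (lebesgue_on (UNIV \<times> {0..}))"
      by (rule measurable_restrict_space1)
    show "\<forall>x. \<forall>t\<ge>0. (x, t) \<noteq> (0, 0) \<longrightarrow> (M x t < ustar \<longrightarrow> p x t = 0) \<and>
        (M x t = ustar \<longrightarrow> p x t \<in> {0..1}) \<and> (ustar < M x t \<longrightarrow> p x t = 1)"
      using p_cases by blast
    show "\<forall>x. mono_on {0..} (p x)" using p_mono by (auto intro!: mono_onI)
    show "\<forall>T>0. \<exists>w wx.
        (\<forall>x. \<forall>t\<in>{0..T}. (x, t) \<noteq> (0, 0) \<longrightarrow> w x t = u x t - psi \<alpha> \<beta> x t) \<and>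
        C10_deriv T w wx \<and>
        (\<exists>C. AE (x, t) in lebesgue_on (UNIV \<times> {0..T}). \<bar>w x t\<bar> \<le> C) \<and>
        (\<forall>\<phi> \<phi>x \<phi>t. C11_deriv T \<phi> \<phi>x \<phi>t \<and>
           (\<exists>R. \<forall>x. \<forall>t\<in>{0..T}. \<bar>x\<bar> > R \<longrightarrow> \<phi> x t = 0) \<and>
           (\<forall>x. \<phi> x T = 0) \<longrightarrow>
           (LINT s:{0..T}|lebesgue. (LINT y|lebesgue. \<phi>t y s * w y s)) =
           (LINT s:{0..T}|lebesgue. (LINT y|lebesgue.
              \<phi>x y s * wx y s + p y s * u y s * \<phi> y s)))"
    proof (intro allI impI, rule exI[of _ "\<lambda>x t. w (x, t)"], rule exI[of _ "\<lambda>x t. wx (x, t)"],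
        intro conjI allI ballI impI)
      fix T :: real assume T: "T > 0"
      show "w (x, t) = u x t - psi \<alpha> \<beta> x t" for x t by (simp add: u_def \<psi>_def)
      show "C10_deriv T (\<lambda>x t. w (x, t)) (\<lambda>x t. wx (x, t))" by (rule C10)
      show "\<exists>C. AE (x, t) in lebesgue_on (UNIV \<times> {0..T}). \<bar>w (x, t)\<bar> \<le> C"
      proof (intro exI AE_I2)
        fix Q :: "real \<times> real"
        have "\<bar>w Q\<bar> \<le> psi_max" using w_bd[of Q] by auto
        then show "case Q of (x, t) \<Rightarrow> \<bar>w (x, t)\<bar> \<le> psi_max" by (simp add: split_beta')
      qed
      fix \<phi> \<phi>x \<phi>t
      assume "C11_deriv T \<phi> \<phi>x \<phi>t \<and> (\<exists>R. \<forall>x. \<forall>t\<in>{0..T}. \<bar>x\<bar> > R \<longrightarrow> \<phi> x t = 0) \<and> (\<forall>x. \<phi> x T = 0)"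
      then show "(LINT s:{0..T}|lebesgue. (LINT y|lebesgue. \<phi>t y s * w (y, s))) =
           (LINT s:{0..T}|lebesgue. (LINT y|lebesgue. \<phi>x y s * wx (y, s) + p y s * u y s * \<phi> y s))"
        by (intro weak[OF T]) auto
    qed
  qed
  have P: "property_P \<alpha> p"
    unfolding property_P_def
  proof (rule bexI)
    \<comment> \<open>The value of \<open>p\<close> one unit of time behind the parabola serves as
      the final value.\<close>
    let ?ps = "\<lambda>x. p x (x\<^sup>2 / \<alpha>\<^sup>2 + 1)"
    have "(\<lambda>x. (x, x\<^sup>2 / \<alpha>\<^sup>2 + 1)) \<in> borel_measurable (borel :: real measure)"
      using alpha_pos by (intro borel_measurable_continuous_onI continuous_intros) auto
    from measurable_compose[OF this p_meas] have "?ps \<in> borel_measurable lborel" by simp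
    from measurable_completion[OF this] show "?ps \<in> borel_measurable (lebesgue_on {0..})"
      by (rule measurable_restrict_space1)
    have "AE Q in lborel. \<forall>n :: nat. snd Q > (fst Q)\<^sup>2 / \<alpha>\<^sup>2 \<longrightarrow> q Q = q (Q + (0, real n))"
      using AEs by (simp only: AE_all_countable) simp
    then have "AE Q in lborel \<Otimes>\<^sub>M lborel. \<forall>n :: nat. snd Q > (fst Q)\<^sup>2 / \<alpha>\<^sup>2 \<longrightarrow> q Q = q (Q + (0, real n))"
      by (simp only: lborel_prod)
    then have "AE x in lborel. AE s in lborel. \<forall>n :: nat. s > x\<^sup>2 / \<alpha>\<^sup>2 \<longrightarrow> q (x, s) = q (x, s + real n)"
      by (drule_tac lborel_pair.AE_pair) simp
    then have "AE x in lborel. \<forall>t. t > x\<^sup>2 / \<alpha>\<^sup>2 \<longrightarrow> p x t = ?ps x"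
      using AE_lborel_singleton[of 0]
    proof eventually_elim
      case (elim x)
      define \<theta> where "\<theta> = x\<^sup>2 / \<alpha>\<^sup>2"
      have \<theta>: "\<theta> > 0" using elim(2) alpha_pos by (simp add: \<theta>_def)
      \<comment> \<open>Choose s between \<theta> and a outside the null set and a natural number n
        with s + n \<ge> b. Then q at b is at most q at s + n, which equals q at s, which is at most
        q at a; monotonicity gives the converse.\<close>
      have q_const: "q (x, a) = q (x, b)" if a: "\<theta> < a" and ab: "a \<le> b" for a b
      proof -
        have "\<not> {\<theta><..<a} \<subseteq> {s. \<not> (\<forall>n :: nat. s > x\<^sup>2 / \<alpha>\<^sup>2 \<longrightarrow> q (x, s) = q (x, s + real n))}"
        proof
          assume sub: "{\<theta><..<a} \<subseteq> {s. \<not> (\<forall>n :: nat. s > x\<^sup>2 / \<alpha>\<^sup>2 \<longrightarrow> q (x, s) = q (x, s + real n))}"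
          from elim(1) obtain N where N: "{s. \<not> (\<forall>n :: nat. s > x\<^sup>2 / \<alpha>\<^sup>2 \<longrightarrow> q (x, s) = q (x, s + real n))} \<subseteq> N"
            "N \<in> null_sets lborel" unfolding eventually_ae_filter by auto
          have "emeasure lborel {\<theta><..<a} \<le> emeasure lborel N"
            using sub N by (intro emeasure_mono) auto
          also have "\<dots> = 0" using N by auto
          finally show False using a by simp
        qed
        then obtain s where s': "s \<in> {\<theta><..<a}" "\<forall>n :: nat. s > x\<^sup>2 / \<alpha>\<^sup>2 \<longrightarrow> q (x, s) = q (x, s + real n)"
          by blast
        then have s: "\<theta> < s" "s < a" by simp_all
        have "q (x, s) = q (x, s + real n)" for n :: nat
          using s'(2) s(1) by (simp only: \<theta>_def)
        note s = s this
        obtain n :: nat where "b - s \<le> real n" using real_arch_simple by blast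
        then have "q (x, b) \<le> q (x, s + real n)" by (intro q_mono) simp
        also have "\<dots> = q (x, s)" using s(3) by simp
        also have "\<dots> \<le> q (x, a)" using s by (intro q_mono) simp
        finally have "q (x, b) \<le> q (x, a)" .
        then show ?thesis using q_mono[OF ab, of x] by simp
      qed
      \<comment> \<open>Behind the parabola \<open>u\<close> is nonincreasing in time, so the
        running supremum is already attained or approached by time \<theta>. Hence all three cases
        in the definition of \<open>p\<close> are frozen from there on.\<close>
      have M_const: "M x t = M x \<theta>" if "\<theta> < t" for t
        unfolding M_def
      proof (rule running_sup_eq_at_max[where u = u and B = psi_max, OF \<theta> _ _ u_bd])
        show "u x s \<le> u x \<theta>" if "\<theta> \<le> s" for s
          using w_anti[OF that, of x] \<psi>_const[of x s] \<psi>_const[of x \<theta>] that \<theta>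
          by (simp add: u_def \<theta>_def)
      qed (use that in simp)
      show ?case
      proof (intro allI impI)
        fix t assume "t > x\<^sup>2 / \<alpha>\<^sup>2"
        then have t: "\<theta> < t" by (simp add: \<theta>_def)
        have "q (x, t) = q (x, \<theta> + 1)"
          using q_const[of t "\<theta> + 1"] q_const[of "\<theta> + 1" t] t by linarith
        then have "p x t = p x (\<theta> + 1)" using M_const[OF t] M_const[of "\<theta> + 1"] t \<theta> by (simp add: p_def)
        then show "p x t = ?ps x" by (simp add: \<theta>_def)
      qed
    qed
    then have "AE x in lebesgue. \<forall>t. t > x\<^sup>2 / \<alpha>\<^sup>2 \<longrightarrow> p x t = ?ps x"
      by (rule AE_completion)
    then show "AE x in lebesgue_on {0..}. \<forall>t. t > x\<^sup>2 / \<alpha>\<^sup>2 \<longrightarrow> p x t = ?ps x"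
      by (subst AE_restrict_space_iff) auto
  qed
  from ws P show ?thesis by blast
qed

end

theorem theorem5:
  fixes \<alpha> \<beta> ustar :: real
  assumes "\<alpha> > 0" and "\<beta> > 0" and "ustar > 0"
  shows "\<exists>u p. weak_solution \<alpha> \<beta> ustar u p \<and> property_P \<alpha> p"
proof -
  interpret hhmo \<alpha> \<beta> ustar using assms by unfold_locales
  show ?thesis by (rule existence)
qed

end
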